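(* Let $G$ be the plane Gaussian analytic function. 1. For every $A\in SL(2;\mathbb{R})$, the operator $V(A)$ preserves the GAF in distribution, i.e. $V(A)G\overset{d}{=}G$. 2. Suppose we factor $A\in SL(2;\mathbb{R})$ uniquely as $$A=\begin{pmatrix}\cos\theta & -\sin\theta\\ \sin\theta & \cos\theta\end{pmatrix}A_{\tau},$$ where $A_\tau$ is the positive symmetric matrix $$A_{\tau}=\frac{1}{\sqrt{1-|\tau|^{2}}}\begin{pmatrix}1+\operatorname{Re}\tau & \operatorname{Im}\tau\\ \operatorname{Im}\tau & 1-\operatorname{Re}\tau\end{pmatrix},\qquad \tau\in\mathbb{C},\ |\tau|<1.$$ Then the zeros of $V(A)G$ are related to the zeros of $e^{-\tau D^2/2}G$ by $$\mathcal{Z}(V(A)G)=\left\{e^{i\theta}\frac{z}{\sqrt{1-|\tau|^{2}}}\ :\ z\in\mathcal{Z}(e^{-\tau D^{2}/2}G)\right\}.$$ 3. For $a\in\mathbb{C}$ define $$u^{a}(A)=e^{i\theta}\frac{z^{a}(\tau)}{\sqrt{1-|\tau|^{2}}},$$ where $A\in SL(2;\mathbb{R})$ is factored as in item 2. Then we have the following equality in distribution: $$u^{a}(A)\overset{d}{=}Aa+u^{0}(A),$$ where $Aa$ denotes the action of $A$ on $a$, with $a$ viewed as an element of $\mathbb{R}^2$.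
   Context: The (plane) Gaussian analytic function (GAF) is $G(z)=\sum_{n=0}^\infty \xi_n \frac{z^n}{\sqrt{n!}}$, with $\xi_0,\xi_1,\dots$ i.i.d. standard complex Gaussian (density $\pi^{-1}e^{-|z|^2}$). $\mathcal{Z}(F)$ denotes the collection of zeros of $F$. With $D=d/dz$, $e^{-\tau D^2/2}F(z)=\sum_{k=0}^\infty\frac{1}{k!}\left(-\frac{\tau}{2}\right)^kD^{2k}F(z)$ (convergent almost surely for the GAF when $|\tau|<1$). For $A=\begin{pmatrix}a&b\\c&d\end{pmatrix}\in SL(2;\mathbb{R})$ put $p=\frac{a-ib+ic+d}{2}$, $q=\frac{a+ib+ic-d}{2}$ (so $|p|^2-|q|^2=1$). The pair of metaplectic operators $V(A)$, differing by a sign, is $$[V(A)f](z)=\pm\frac{1}{\sqrt{p}}\int_{\mathbb{C}}\exp\left\{\frac12\frac{\bar q}{p}z^2-\frac12\frac{q}{p}\bar w^2+\frac1p z\bar w\right\}f(w)\frac{e^{-|w|^2}}{\pi}\,dw,$$ where $dw$ is two-dimensional Lebesgue measure; this is defined for $f$ in the Segal--Bargmann space (entire functions with $\int|f|^2e^{-|z|^2}/\pi\,dz<\infty$) and, by the same (convergent) integral, for the GAF almost surely. For $a\in\mathbb{C}$, $G^a$ is the GAF conditioned on $G(a)=0$; almost surely its zero at $a$ is simple, and $z^a(\cdot)$ is the unique holomorphic function defined in a neighborhood of $0$ with $z^a(0)=a$ and $(e^{-\tau D^2/2}G^a)(z^a(\tau))=0$. It is defined only on a disk around $0$ of random radius,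 so $u^a(A)$ is defined only for those $A$ for which $\tau$ lies in this disk, and the equality in distribution in item 3 is understood accordingly. *)

theory Defs
  imports "HOL-Probability.Probability" "HOL-Complex_Analysis.Complex_Analysis"
begin

section \<open>Equality in distribution\<close>

text \<open>
  Random objects may be undefined (and take junk values) on a null set, so measurability and laws
  are taken with respect to the completed probability measures.
\<close>

definition eq_in_dist ::
  "'a measure \<Rightarrow> ('a \<Rightarrow> 'c) \<Rightarrow> 'b measure \<Rightarrow> ('b \<Rightarrow> 'c) \<Rightarrow> 'c measure \<Rightarrow> bool" where
  "eq_in_dist M X N Y K \<longleftrightarrow>
     X \<in> measurable (completion M) K \<and> Y \<in> measurable (completion N) K \<and>
     distr (completion M) K X = distr (completion N) K Y"

text \<open>
  For random entire functions: on the space of entire functions (locally uniform convergence) the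
  Borel sets are the traces of the product \<open>\<sigma>\<close>-algebra, so the law is the law of the process of
  values together with almost sure holomorphy.
\<close>

definition eq_in_dist_entire ::
  "'a measure \<Rightarrow> ('a \<Rightarrow> complex \<Rightarrow> complex) \<Rightarrow> 'b measure \<Rightarrow> ('b \<Rightarrow> complex \<Rightarrow> complex) \<Rightarrow> bool" where
  "eq_in_dist_entire M X N Y \<longleftrightarrow>
     (AE \<omega> in M. X \<omega> holomorphic_on UNIV) \<and> (AE \<omega> in N. Y \<omega> holomorphic_on UNIV) \<and>
     eq_in_dist M X N Y (Pi\<^sub>M UNIV (\<lambda>_. borel))"

text \<open>The disjoint union of the point \<open>None\<close> (``undefined'') and the complex plane.\<close>

definition option_borel :: "complex option measure" where
  "option_borel = sigma UNIV (insert {None} {Some ` B |B. B \<in> sets borel})"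


section \<open>The Gaussian analytic function\<close>

definition iid_std_complex_gaussian :: "'a measure \<Rightarrow> (nat \<Rightarrow> 'a \<Rightarrow> complex) \<Rightarrow> bool" where
  "iid_std_complex_gaussian M \<xi> \<longleftrightarrow>
     prob_space M \<and>
     prob_space.indep_vars M (\<lambda>_. borel) \<xi> UNIV \<and>
     (\<forall>n. distributed M lborel (\<xi> n) (\<lambda>z. ennreal (exp (- (cmod z)\<^sup>2) / pi)))"

definition gaf :: "(nat \<Rightarrow> 'a \<Rightarrow> complex) \<Rightarrow> 'a \<Rightarrow> complex \<Rightarrow> complex" where
  "gaf \<xi> \<omega> z = (\<Sum>n. \<xi> n \<omega> * z ^ n / of_real (sqrt (fact n)))"

definition zeros :: "(complex \<Rightarrow> complex) \<Rightarrow> complex set" where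
  "zeros F = {z. F z = 0}"

text \<open>
  \<open>H\<close> (on any probability space \<open>N\<close>) is the random entire function \<open>G\<close> conditioned on the null
  event \<open>G(a) = 0\<close>: its finite-dimensional distributions are the weak limits, as \<open>\<epsilon> \<down> 0\<close>, of those
  of \<open>G\<close> under \<open>P( \<cdot> | |G(a)| < \<epsilon>)\<close>.  Testing against sequences of evaluation points and bounded
  functions that are continuous for the product topology is the same as testing all finite
  families of points.
\<close>

definition conditioned_on_zero ::
  "'a measure \<Rightarrow> ('a \<Rightarrow> complex \<Rightarrow> complex) \<Rightarrow> complex \<Rightarrow>
   'b measure \<Rightarrow> ('b \<Rightarrow> complex \<Rightarrow> complex) \<Rightarrow> bool" where
  "conditioned_on_zero M G a N H \<longleftrightarrow>
     prob_space N \<and>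
     (\<forall>z. (\<lambda>\<omega>. H \<omega> z) \<in> borel_measurable N) \<and>
     (AE \<omega> in N. H \<omega> holomorphic_on UNIV) \<and>
     (\<forall>(z :: nat \<Rightarrow> complex) (\<phi> :: (nat \<Rightarrow> complex) \<Rightarrow> real).
        continuous_on UNIV \<phi> \<and> bounded (range \<phi>) \<longrightarrow>
        ((\<lambda>\<epsilon>. \<integral>\<omega>. \<phi> (\<lambda>i. G \<omega> (z i)) \<partial>uniform_measure M {\<omega> \<in> space M. cmod (G \<omega> a) < \<epsilon>})
           \<longlongrightarrow> (\<integral>\<omega>. \<phi> (\<lambda>i. H \<omega> (z i)) \<partial>N)) (at_right 0))"


section \<open>The heat operator and the zero issuing from a point\<close>

definition heat_term :: "complex \<Rightarrow> (complex \<Rightarrow> complex) \<Rightarrow> complex \<Rightarrow> nat \<Rightarrow> complex" where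
  "heat_term \<tau> F z k = (- \<tau> / 2) ^ k / fact k * (deriv ^^ (2 * k)) F z"

definition heat :: "complex \<Rightarrow> (complex \<Rightarrow> complex) \<Rightarrow> complex \<Rightarrow> complex" where
  "heat \<tau> F z = (\<Sum>k. heat_term \<tau> F z k)"

text \<open>The bound \<open>r \<le> 1\<close> keeps \<open>\<tau>\<close> in the region where the heat operator converges.\<close>

definition zero_path :: "(complex \<Rightarrow> complex) \<Rightarrow> complex \<Rightarrow> real \<Rightarrow> (complex \<Rightarrow> complex) \<Rightarrow> bool" where
  "zero_path F a r f \<longleftrightarrow>
     0 < r \<and> r \<le> 1 \<and> f holomorphic_on ball 0 r \<and> f 0 = a \<and>
     (\<forall>\<tau>\<in>ball 0 r. heat \<tau> F (f \<tau>) = 0)"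

text \<open>
  The function \<open>z\<^sup>a\<close>, on the largest disk around \<open>0\<close> on which it exists, and \<open>None\<close> outside.
\<close>

definition zero_fun :: "(complex \<Rightarrow> complex) \<Rightarrow> complex \<Rightarrow> complex \<Rightarrow> complex option" where
  "zero_fun F a \<tau> =
     (if \<exists>r f. zero_path F a r f \<and> cmod \<tau> < r
      then Some (THE v. \<exists>r f. zero_path F a r f \<and> cmod \<tau> < r \<and> v = f \<tau>)
      else None)"


section \<open>The group and the metaplectic operators\<close>

definition SL2R :: "(real^2^2) set" where
  "SL2R = {A. det A = 1}"

definition rot_mat :: "real \<Rightarrow> real^2^2" where
  "rot_mat \<theta> = vector [vector [cos \<theta>, - sin \<theta>], vector [sin \<theta>, cos \<theta>]]"

definition sym_mat :: "complex \<Rightarrow> real^2^2" where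
  "sym_mat \<tau> = (1 / sqrt (1 - (cmod \<tau>)\<^sup>2)) *\<^sub>R
     vector [vector [1 + Re \<tau>, Im \<tau>], vector [Im \<tau>, 1 - Re \<tau>]]"

definition factors_as :: "real^2^2 \<Rightarrow> real \<Rightarrow> complex \<Rightarrow> bool" where
  "factors_as A \<theta> \<tau> \<longleftrightarrow> cmod \<tau> < 1 \<and> A = rot_mat \<theta> ** sym_mat \<tau>"

text \<open>The angle is unique only modulo \<open>2\<pi>\<close>; it is normalised to lie in \<open>[0, 2\<pi>)\<close>.\<close>

definition factorization :: "real^2^2 \<Rightarrow> real \<times> complex" where
  "factorization A = (THE x. case x of (\<theta>, \<tau>) \<Rightarrow> 0 \<le> \<theta> \<and> \<theta> < 2 * pi \<and> factors_as A \<theta> \<tau>)"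

definition act :: "real^2^2 \<Rightarrow> complex \<Rightarrow> complex" where
  "act A z = (let v = A *v vector [Re z, Im z] in Complex (v $ 1) (v $ 2))"

definition mp_p :: "real^2^2 \<Rightarrow> complex" where
  "mp_p A = (of_real (A$1$1) - \<i> * of_real (A$1$2) + \<i> * of_real (A$2$1) + of_real (A$2$2)) / 2"

definition mp_q :: "real^2^2 \<Rightarrow> complex" where
  "mp_q A = (of_real (A$1$1) + \<i> * of_real (A$1$2) + \<i> * of_real (A$2$1) - of_real (A$2$2)) / 2"

definition mp_integrand ::
  "real^2^2 \<Rightarrow> (complex \<Rightarrow> complex) \<Rightarrow> complex \<Rightarrow> complex \<Rightarrow> complex" where
  "mp_integrand A f z w =
     exp (1/2 * (cnj (mp_q A) / mp_p A) * z\<^sup>2 - 1/2 * (mp_q A / mp_p A) * (cnj w)\<^sup>2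
          + 1 / mp_p A * z * cnj w)
     * f w * of_real (exp (- (cmod w)\<^sup>2) / pi)"

text \<open>The pair of operators; \<open>s\<close> runs through the two square roots of \<open>p\<close>.\<close>

definition metaplectic :: "real^2^2 \<Rightarrow> ((complex \<Rightarrow> complex) \<Rightarrow> complex \<Rightarrow> complex) set" where
  "metaplectic A = {(\<lambda>f z. 1 / s * (\<integral>w. mp_integrand A f z w \<partial>lborel)) |s. s\<^sup>2 = mp_p A}"

text \<open>The random function \<open>u\<^sup>a\<close>, with \<open>F\<close> a realisation of the conditioned Gaussian analytic function.\<close>

definition u_fun :: "(complex \<Rightarrow> complex) \<Rightarrow> complex \<Rightarrow> real^2^2 \<Rightarrow> complex option" where
  "u_fun F a A = (case factorization A of (\<theta>, \<tau>) \<Rightarrow>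
     map_option (\<lambda>z. cis \<theta> * (z / of_real (sqrt (1 - (cmod \<tau>)\<^sup>2)))) (zero_fun F a \<tau>))"

end

(*
  Expanding in the orthonormal basis z^n / sqrt(n!) of the Segal-Bargmann space, an entire function
  with coefficient sequence c of subexponential growth (almost surely true for the GAF) satisfies
  e^{-tau D^2/2} F (z) = sum_n c_n k_n(tau, z), where exp(-tau x^2/2 + z x) = sum_n k_n x^n / sqrt(n!);
  the same sum equals the integral of exp(-tau conj(w)^2/2 + z conj(w)) F(w) against the Gaussian
  weight.  With tau = q/p this shows V(A)F(z) = p^{-1/2} exp((conj(q)/2p) z^2) (e^{-tau D^2/2}F)(z/p),
  which gives item 2.  The covariance kernel of the Gaussian series V(A)G is a two-dimensional
  Gaussian integral and comes out as exp(z conj(w)); Gaussian series with equal kernels have equal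
  laws, because their joint characteristic functions agree, so item 1 follows.  The same argument
  applies to the translates T_a F(z) = exp(z conj(a) - |a|^2/2) F(z - a).

  For item 3, translation invariance and the independence of xi_0 from the other coefficients show
  that G^a has the law of T_a applied to sum_{n>0} xi_n z^n / sqrt(n!).  Shifting the integration
  variable gives, up to a factor without zeros, e^{-tau D^2/2} T_a F (z) = e^{-tau D^2/2}F (z - a - tau conj(a)),
  so that path by path z^a(tau) = a + tau conj(a) + z^0(tau), with the same disk of existence, and
  p (a + tau conj(a)) = p a + q conj(a) = Aa.  What remains is to see that u^0(A) is a measurable
  function of the Taylor coefficients of F.
*)
theory Submission
  imports Defs
begin

text \<open>Almost surely the GAF coefficients are not square summable, so a sample lies outside the
  Segal-Bargmann space and unitarity is of no use. The substitute is a duality of growth classes: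
  the coefficients grow slower than every t^n with t > 1, the functionals in play decay like some
  r^n with r < 1, and all pairings converge absolutely. Probability enters only through this growth
  and through laws of Gaussian series.

  Two obstacles shape item 3. The conditioning event is null and given only by weak limits of
  finite-dimensional laws; after \<open>a\<close> is moved to the origin it becomes, in law, a disk
  event for \<xi>_0 alone, so the limit of the characteristic functions can be computed. And
  \<open>zero_fun\<close> quantifies over all radii and holomorphic functions, which shows no
  measurability: the local zero is therefore a limit of explicit iterates, its Taylor coefficients
  are limits of countably many values, and existence at \<tau> becomes a condition on the radius of
  convergence.\<close>

unbundle no fps_syntax
no_notation Infinite_Set_Sum.abs_summable_on (infix \<open>abs'_summable'_on\<close> 50)

section \<open>Dual growth classes of coefficient sequences\<close>

text \<open>The bases \<open>1 + 1 / Suc j\<close> and the natural constants make this a countable combination of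
  conditions on finitely many entries, hence a measurable set of sequences.\<close>

definition subexp :: "(nat \<Rightarrow> 'a::real_normed_vector) \<Rightarrow> bool" where
  "subexp c \<longleftrightarrow> (\<forall>j::nat. \<exists>K::nat. \<forall>n. norm (c n) \<le> real K * (1 + 1 / Suc j) ^ n)"

text \<open>The dual class: pairing with a \<open>subexp\<close> sequence converges absolutely. The
  ratio may depend on the sequence, and the class is still closed under finite sums.\<close>

definition geom :: "(nat \<Rightarrow> 'a::real_normed_vector) \<Rightarrow> bool" where
  "geom d \<longleftrightarrow> (\<exists>C r. 0 < r \<and> r < 1 \<and> (\<forall>n. norm (d n) \<le> C * r ^ n))"

lemma subexp_bound:
  assumes "subexp c" "1 < (t::real)"
  obtains K where "0 \<le> K" "\<And>n. norm (c n) \<le> K * t ^ n"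
proof -
  obtain j :: nat where j: "1 / Suc j < t - 1"
    using nat_approx_posE[of "t - 1"] assms(2) by auto
  obtain K :: nat where K: "\<And>n. norm (c n) \<le> real K * (1 + 1 / Suc j) ^ n"
    using assms(1) unfolding subexp_def by blast
  have "real K * (1 + 1 / Suc j) ^ n \<le> real K * t ^ n" for n
    using j by (intro mult_left_mono power_mono) auto
  with K show ?thesis by (intro that[of "real K"]) (auto intro: order_trans)
qed

lemma subexpI:
  assumes "\<And>t. 1 < t \<Longrightarrow> \<exists>K. \<forall>n. norm (c n) \<le> K * t ^ n"
  shows "subexp c"
  unfolding subexp_def
proof
  fix j :: nat
  obtain K where K: "\<And>n. norm (c n) \<le> K * (1 + 1 / Suc j) ^ n"
    using assms[of "1 + 1 / Suc j"] by auto
  obtain K' :: nat where "K \<le> real K'" using real_arch_simple by blast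
  then have "K * (1 + 1 / Suc j) ^ n \<le> real K' * (1 + 1 / Suc j) ^ n" for n
    by (intro mult_right_mono) auto
  then show "\<exists>K::nat. \<forall>n. norm (c n) \<le> real K * (1 + 1 / Suc j) ^ n"
    using K by (intro exI[of _ K']) (auto intro: order_trans)
qed

lemma geom_imp_subexp:
  assumes "geom d"
  shows "subexp d"
proof (rule subexpI)
  fix t :: real assume t: "1 < t"
  obtain C r where r: "0 < r" "r < 1" "\<And>n. norm (d n) \<le> C * r ^ n"
    using assms unfolding geom_def by blast
  have "0 \<le> C" using r(3)[of 0] order_trans[OF norm_ge_zero] by simp
  then have "C * r ^ n \<le> C * t ^ n" for n
    using r t by (intro mult_left_mono power_mono) auto
  then show "\<exists>K. \<forall>n. norm (d n) \<le> K * t ^ n"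
    using r(3) by (intro exI[of _ C]) (auto intro: order_trans)
qed

lemma summable_subexp_geom:
  assumes "subexp c" "geom d"
  shows "summable (\<lambda>n. norm (c n) * norm (d n))"
proof -
  obtain C r where r: "0 < r" "r < 1" "\<And>n. norm (d n) \<le> C * r ^ n"
    using assms(2) unfolding geom_def by blast
  \<comment> \<open>Any base strictly between 1 and \<open>1 / r\<close> works; this one leaves the
    ratio \<open>sqrt r\<close> for the product.\<close>
  define t where "t = 1 / sqrt r"
  have t: "1 < t" using r by (simp add: t_def)
  have tr: "t * r = sqrt r" using r by (simp add: t_def real_div_sqrt)
  obtain K where K: "0 \<le> K" "\<And>n. norm (c n) \<le> K * t ^ n"
    using subexp_bound[OF assms(1) t] by blast
  show ?thesis
  proof (rule summable_comparison_test)
    show "\<exists>N. \<forall>n\<ge>N. norm (norm (c n) * norm (d n)) \<le> (K * C) * sqrt r ^ n"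
    proof (intro exI[of _ 0] allI impI)
      fix n
      have "norm (c n) * norm (d n) \<le> (K * t ^ n) * (C * r ^ n)"
        using K r t by (intro mult_mono) auto
      also have "\<dots> = (K * C) * sqrt r ^ n"
        by (simp add: tr[symmetric] power_mult_distrib)
      finally show "norm (norm (c n) * norm (d n)) \<le> (K * C) * sqrt r ^ n" by simp
    qed
    show "summable (\<lambda>n. K * C * sqrt r ^ n)"
      using r by (intro summable_mult summable_geometric) auto
  qed
qed

lemma geom_cmult:
  fixes d :: "nat \<Rightarrow> complex"
  assumes "geom d" shows "geom (\<lambda>n. a * d n)"
proof -
  obtain C r where r: "0 < r" "r < 1" "\<And>n. norm (d n) \<le> C * r ^ n"
    using assms unfolding geom_def by blast
  have "norm (a * d n) \<le> (norm a * C) * r ^ n" for n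
    using mult_left_mono[OF r(3), of "norm a" n] by (simp add: norm_mult mult.assoc)
  with r show ?thesis unfolding geom_def by blast
qed

lemma geom_mono:
  assumes "geom d" "\<And>n. norm (e n) \<le> norm (d n)" shows "geom e"
  using assms unfolding geom_def by (meson order_trans)

lemma geom_add:
  assumes "geom d" "geom e" shows "geom (\<lambda>n. d n + e n)"
proof -
  obtain C r where r: "0 < r" "r < 1" "\<And>n. norm (d n) \<le> C * r ^ n"
    using assms unfolding geom_def by blast
  obtain D s where s: "0 < s" "s < 1" "\<And>n. norm (e n) \<le> D * s ^ n"
    using assms unfolding geom_def by blast
  have C: "0 \<le> C" "0 \<le> D"
    using r(3)[of 0] s(3)[of 0] order_trans[OF norm_ge_zero] by auto
  have "norm (d n + e n) \<le> (C + D) * max r s ^ n" for n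
  proof -
    have "norm (d n + e n) \<le> C * r ^ n + D * s ^ n"
      using r(3)[of n] s(3)[of n] by (rule norm_triangle_mono)
    also have "\<dots> \<le> C * max r s ^ n + D * max r s ^ n"
      using C r s by (intro add_mono mult_left_mono power_mono) auto
    finally show ?thesis by (simp add: algebra_simps)
  qed
  then show ?thesis using r s unfolding geom_def
    by (intro exI[of _ "C + D"] exI[of _ "max r s"]) auto
qed

lemma geom_zero: "geom (\<lambda>n. 0)"
  unfolding geom_def by (intro exI[of _ 0] exI[of _ "1/2"]) auto

lemma geom_sum:
  assumes "finite J" "\<And>j. j \<in> J \<Longrightarrow> geom (d j)"
  shows "geom (\<lambda>n. \<Sum>j\<in>J. d j n)"
  using assms by (induction J rule: finite_induct) (auto intro: geom_zero geom_add)

lemma geom_Suc: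
  assumes "geom d" shows "geom (\<lambda>n. d (Suc n))"
proof -
  obtain C r where r: "0 < r" "r < 1" "\<And>n. norm (d n) \<le> C * r ^ n"
    using assms unfolding geom_def by blast
  have "norm (d (Suc n)) \<le> (C * r) * r ^ n" for n using r(3)[of "Suc n"] by (simp add: mult_ac)
  then show ?thesis using r unfolding geom_def by blast
qed


subsection \<open>Coefficients of quadratic exponentials\<close>

text \<open>The coefficient of x^n in exp(-\<tau> x^2/2 + \<zeta> x), a rescaled Hermite polynomial
  in \<zeta>. It is generic in the field because its real instance at \<open>- T\<close> majorises
  the complex one.\<close>

definition hcoef :: "'a::real_normed_field \<Rightarrow> 'a \<Rightarrow> nat \<Rightarrow> 'a" where
  "hcoef \<tau> \<zeta> n = (\<Sum>k\<le>n div 2. (- \<tau> / 2) ^ k / fact k * (\<zeta> ^ (n - 2 * k) / fact (n - 2 * k)))"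

lemma hcoef_nonneg: "0 \<le> T \<Longrightarrow> 0 \<le> Z \<Longrightarrow> 0 \<le> hcoef (- T) (Z::real) n"
  unfolding hcoef_def by (intro sum_nonneg) auto

text \<open>At first argument \<open>- T\<close> all terms are nonnegative, so the triangle
  inequality yields a majorant that is uniform on bounded sets of (\<tau>, \<zeta>).\<close>

lemma norm_hcoef_le:
  assumes "norm \<tau> \<le> T" "norm \<zeta> \<le> Z"
  shows "norm (hcoef \<tau> \<zeta> n) \<le> hcoef (- T) Z n"
  unfolding hcoef_def
proof (rule order_trans[OF norm_sum], rule sum_mono)
  fix k
  have "0 \<le> T" "0 \<le> Z" using assms order_trans[OF norm_ge_zero] by blast+
  then show "norm ((- \<tau> / 2) ^ k / fact k * (\<zeta> ^ (n - 2 * k) / fact (n - 2 * k)))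
     \<le> (- (- T) / 2) ^ k / fact k * (Z ^ (n - 2 * k) / fact (n - 2 * k))"
    using assms
    by (auto simp: norm_mult norm_divide norm_power intro!: mult_mono divide_right_mono power_mono)
qed

lemma bij_betw_pairs:
  "bij_betw (\<lambda>(k, m). (2 * k + m, k)) (UNIV :: (nat \<times> nat) set) (Sigma UNIV (\<lambda>n. {..n div 2}))"
  by (rule bij_betw_byWitness[where f' = "\<lambda>(n, k). (k, n - 2 * k)"]) auto

text \<open>Tonelli along the lines n = 2k + m: at fixed n the norms add up to the real majorant.
  The weights \<open>W\<close> stay free; powers of x give the generating function, and the rescaled
  coefficients of an entire function give the heat operator.\<close>

lemma abs_summable_pairs_iff:
  fixes W :: "nat \<Rightarrow> 'a::{real_normed_field, banach}"
  shows "(\<lambda>(k, m). (- \<tau> / 2) ^ k / fact k * (\<zeta> ^ m / fact m) * W (2 * k + m)) abs_summable_on UNIV \<longleftrightarrow>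
    summable (\<lambda>n. hcoef (- norm \<tau>) (norm \<zeta>) n * norm (W n))"
proof -
  define f where "f = (\<lambda>(n, k). (- \<tau> / 2) ^ k / fact k * (\<zeta> ^ (n - 2 * k) / fact (n - 2 * k)) * W n)"
  have "(\<lambda>(k, m). (- \<tau> / 2) ^ k / fact k * (\<zeta> ^ m / fact m) * W (2 * k + m)) abs_summable_on UNIV
     \<longleftrightarrow> f abs_summable_on (Sigma UNIV (\<lambda>n. {..n div 2}))"
    by (subst summable_on_reindex_bij_betw[OF bij_betw_pairs, symmetric])
      (simp add: f_def case_prod_unfold)
  also have "\<dots> \<longleftrightarrow> (\<lambda>n. hcoef (- norm \<tau>) (norm \<zeta>) n * norm (W n)) summable_on UNIV"
  proof -
    have "(\<Sum>k\<le>n div 2. norm (f (n, k))) = hcoef (- norm \<tau>) (norm \<zeta>) n * norm (W n)" for n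
      unfolding hcoef_def f_def sum_distrib_right
      by (intro sum.cong) (auto simp: norm_mult norm_divide norm_power)
    then show ?thesis
      by (simp add: Infinite_Sum.abs_summable_on_Sigma_iff abs_mult hcoef_nonneg)
  qed
  also have "\<dots> \<longleftrightarrow> summable (\<lambda>n. hcoef (- norm \<tau>) (norm \<zeta>) n * norm (W n))"
    by (intro summable_on_UNIV_nonneg_real_iff) (auto simp: hcoef_nonneg)
  finally show ?thesis .
qed

lemma pairs_has_sum:
  fixes W :: "nat \<Rightarrow> 'a::{real_normed_field, banach}"
  assumes "summable (\<lambda>n. hcoef (- norm \<tau>) (norm \<zeta>) n * norm (W n))"
  shows "((\<lambda>(k, m). (- \<tau> / 2) ^ k / fact k * (\<zeta> ^ m / fact m) * W (2 * k + m)) has_sum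
    (\<Sum>n. hcoef \<tau> \<zeta> n * W n)) UNIV"
proof -
  define g where "g = (\<lambda>(k, m). (- \<tau> / 2) ^ k / fact k * (\<zeta> ^ m / fact m) * W (2 * k + m))"
  define f where "f = (\<lambda>(n, k). (- \<tau> / 2) ^ k / fact k * (\<zeta> ^ (n - 2 * k) / fact (n - 2 * k)) * W n)"
  have gf: "g = (\<lambda>x. f (case x of (k, m) \<Rightarrow> (2 * k + m, k)))"
    by (auto simp: g_def f_def fun_eq_iff)
  have "g abs_summable_on UNIV"
    unfolding g_def abs_summable_pairs_iff by fact
  then obtain S where S: "(g has_sum S) UNIV"
    using abs_summable_summable summable_on_def by blast
  then have "(f has_sum S) (Sigma UNIV (\<lambda>n. {..n div 2}))"
    unfolding gf using has_sum_reindex_bij_betw[OF bij_betw_pairs, of f S] by simp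
  moreover have "((\<lambda>k. f (n, k)) has_sum (hcoef \<tau> \<zeta> n * W n)) {..n div 2}" for n
    unfolding f_def hcoef_def sum_distrib_right by (auto intro!: has_sum_finiteI)
  ultimately have "((\<lambda>n. hcoef \<tau> \<zeta> n * W n) has_sum S) UNIV"
    by (rule has_sum_SigmaD)
  then have "S = (\<Sum>n. hcoef \<tau> \<zeta> n * W n)"
    using has_sum_imp_sums sums_unique by blast
  with S show ?thesis by (simp add: g_def)
qed

lemma pairs_sums:
  fixes W :: "nat \<Rightarrow> 'a::{real_normed_field, banach}"
  assumes "summable (\<lambda>n. hcoef (- norm \<tau>) (norm \<zeta>) n * norm (W n))"
  shows "(\<lambda>k. \<Sum>m. (- \<tau> / 2) ^ k / fact k * (\<zeta> ^ m / fact m) * W (2 * k + m)) sums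
    (\<Sum>n. hcoef \<tau> \<zeta> n * W n)"
proof -
  define g where "g = (\<lambda>(k, m). (- \<tau> / 2) ^ k / fact k * (\<zeta> ^ m / fact m) * W (2 * k + m))"
  have S: "(g has_sum (\<Sum>n. hcoef \<tau> \<zeta> n * W n)) (Sigma UNIV (\<lambda>_. UNIV))"
    using pairs_has_sum[OF assms] by (simp add: g_def)
  have "g abs_summable_on (Sigma UNIV (\<lambda>_. UNIV))"
    using assms abs_summable_pairs_iff[of \<tau> \<zeta> W] by (simp add: g_def)
  then have "(\<lambda>m. g (k, m)) abs_summable_on UNIV" for k
    unfolding Infinite_Sum.abs_summable_on_Sigma_iff by blast
  then have "((\<lambda>m. g (k, m)) has_sum (\<Sum>\<^sub>\<infinity>m. g (k, m))) UNIV" for k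
    by (intro has_sum_infsum) (rule abs_summable_summable)
  moreover from this have "(\<Sum>\<^sub>\<infinity>m. g (k, m)) = (\<Sum>m. g (k, m))" for k
    by (rule sums_unique[OF has_sum_imp_sums])
  ultimately have "((\<lambda>m. g (k, m)) has_sum (\<Sum>m. g (k, m))) UNIV" for k
    by simp
  from has_sum_imp_sums[OF has_sum_SigmaD[OF S this]] show ?thesis
    by (simp add: g_def)
qed

text \<open>The double series factors into exponential series in x^2 and in x, both absolutely
  convergent; \<open>abs_summable_pairs_iff\<close> then regroups it by n.\<close>

lemma hcoef_power_summable:
  fixes x :: real
  assumes "0 \<le> T" "0 \<le> Z"
  shows "summable (\<lambda>n. hcoef (- T) Z n * \<bar>x\<bar> ^ n)"
proof -
  have 1: "summable (\<lambda>k. norm ((- (- T) / 2) ^ k / fact k * (x\<^sup>2) ^ k))"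
    using summable_norm_exp[of "T / 2 * x\<^sup>2"] by (simp add: power_mult_distrib field_simps)
  have 2: "summable (\<lambda>m. norm (Z ^ m / fact m * x ^ m))"
    using summable_norm_exp[of "Z * x"] by (simp add: power_mult_distrib field_simps)
  define a where "a k = (- (- T) / 2) ^ k / fact k * (x\<^sup>2) ^ k" for k
  define b where "b m = Z ^ m / fact m * x ^ m" for m
  have "(\<lambda>(k, m). a k * b m) abs_summable_on UNIV \<times> UNIV"
  proof (rule Infinite_Sum.abs_summable_on_Sigma_iff[THEN iffD2], intro conjI ballI)
    fix k
    have "b abs_summable_on UNIV"
      using 2 by (simp add: summable_on_UNIV_nonneg_real_iff b_def)
    then show "(\<lambda>m. case (k, m) of (k, m) \<Rightarrow> a k * b m) abs_summable_on UNIV"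
      unfolding prod.case norm_mult by (rule summable_on_cmult_right)
  next
    have "a abs_summable_on UNIV"
      using 1 by (simp add: summable_on_UNIV_nonneg_real_iff a_def)
    then have "(\<lambda>k. norm (a k) * (\<Sum>\<^sub>\<infinity>m. norm (b m))) summable_on UNIV"
      by (rule summable_on_cmult_left)
    then show "(\<lambda>k. \<Sum>\<^sub>\<infinity>m. norm (case (k, m) of (k, m) \<Rightarrow> a k * b m)) abs_summable_on UNIV"
      by (simp add: infsum_nonneg norm_mult infsum_cmult_right' abs_mult)
  qed
  moreover have "a k * b m = (- (- T) / 2) ^ k / fact k * (Z ^ m / fact m) * x ^ (2 * k + m)" for k m
    unfolding power_add power_mult a_def b_def by (simp only: mult_ac)
  ultimately have "(\<lambda>(k, m). (- (- T) / 2) ^ k / fact k * (Z ^ m / fact m) * x ^ (2 * k + m)) abs_summable_on UNIV"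
    by simp
  then show ?thesis
    using abs_summable_pairs_iff[of "- T" Z "\<lambda>n. x ^ n"] assms
    by (simp add: power_abs)
qed

lemma hcoef_power_sums:
  fixes \<tau> \<zeta> x :: "'a::{real_normed_field, banach}"
  shows "(\<lambda>n. hcoef \<tau> \<zeta> n * x ^ n) sums exp (- \<tau> / 2 * x\<^sup>2 + \<zeta> * x)"
proof -
  have s: "summable (\<lambda>n. hcoef (- norm \<tau>) (norm \<zeta>) n * norm (x ^ n))"
    using hcoef_power_summable[of "norm \<tau>" "norm \<zeta>" "norm x"] by (simp add: norm_power)
  \<comment> \<open>Row k: the sum over m is an exponential series, so the remaining sum over k
    becomes one as well.\<close>
  have "(\<Sum>m. (- \<tau> / 2) ^ k / fact k * (\<zeta> ^ m / fact m) * x ^ (2 * k + m)) =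
     (- \<tau> / 2 * x\<^sup>2) ^ k /\<^sub>R fact k * exp (\<zeta> * x)" for k
  proof -
    have "(\<lambda>m. ((- \<tau> / 2 * x\<^sup>2) ^ k /\<^sub>R fact k) * ((\<zeta> * x) ^ m /\<^sub>R fact m)) sums
       ((- \<tau> / 2 * x\<^sup>2) ^ k /\<^sub>R fact k * exp (\<zeta> * x))"
      by (intro sums_mult exp_converges)
    moreover have "((- \<tau> / 2 * x\<^sup>2) ^ k /\<^sub>R fact k) * ((\<zeta> * x) ^ m /\<^sub>R fact m) =
       (- \<tau> / 2) ^ k / fact k * (\<zeta> ^ m / fact m) * x ^ (2 * k + m)" for m
      unfolding power_mult_distrib[of _ "x\<^sup>2"] power_mult_distrib[of \<zeta>] power_add power_mult
        scaleR_conv_of_real of_real_inverse of_real_fact divide_inverse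
      by (simp only: mult_ac)
    ultimately show ?thesis by (simp add: sums_iff)
  qed
  with pairs_sums[OF s] have "(\<lambda>k. (- \<tau> / 2 * x\<^sup>2) ^ k /\<^sub>R fact k * exp (\<zeta> * x)) sums
      (\<Sum>n. hcoef \<tau> \<zeta> n * x ^ n)" by simp
  moreover have "(\<lambda>k. (- \<tau> / 2 * x\<^sup>2) ^ k /\<^sub>R fact k * exp (\<zeta> * x)) sums
      (exp (- \<tau> / 2 * x\<^sup>2) * exp (\<zeta> * x))"
    by (intro sums_mult2 exp_converges)
  ultimately have "(\<Sum>n. hcoef \<tau> \<zeta> n * x ^ n) = exp (- \<tau> / 2 * x\<^sup>2 + \<zeta> * x)"
    unfolding exp_add by (rule sums_unique2)
  moreover have "summable (\<lambda>n. hcoef \<tau> \<zeta> n * x ^ n)"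
    by (rule summable_comparison_test[OF _ s])
      (auto simp: norm_mult intro!: mult_right_mono norm_hcoef_le exI[of _ 0])
  ultimately show ?thesis by (simp add: sums_iff)
qed

text \<open>Square the hypothesis at \<open>x\<^sup>2 = u / \<rho>\<close> and integrate it against \<open>exp (- u)\<close>: the Gamma integral
  of \<open>u ^ n\<close> cancels the factorial, so that Stirling's formula is not needed.\<close>

lemma coef_growth:
  fixes b :: real
  assumes b: "0 \<le> b" and r: "0 \<le> r" "r < \<rho>"
  assumes le: "\<And>x. 0 \<le> x \<Longrightarrow> b * x ^ n / sqrt (fact n) \<le> C * exp (r * x\<^sup>2 / 2)"
  shows "b \<le> C / sqrt (1 - r / \<rho>) * sqrt \<rho> ^ n"
proof -
  \<comment> \<open>The decay rate that survives when exp(-u) meets the squared bound exp(r u /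
    \<rho>); it is positive because r < \<rho>.\<close>
  define \<delta> where "\<delta> = 1 - r / \<rho>"
  have \<delta>: "0 < \<delta>" and \<rho>: "0 < \<rho>" using r by (auto simp: \<delta>_def field_simps)
  have C: "0 \<le> C" using le[of 0] b by (cases n) (auto intro: order_trans[rotated])
  have sq: "b\<^sup>2 / \<rho> ^ n / fact n * (u ^ n * exp (- u)) \<le> C\<^sup>2 * exp (- \<delta> * u)" if u: "0 \<le> u" for u
  proof -
    have "(b * sqrt (u / \<rho>) ^ n / sqrt (fact n))\<^sup>2 \<le> (C * exp (r * (sqrt (u / \<rho>))\<^sup>2 / 2))\<^sup>2"
      using u \<rho> b by (intro power_mono le) (auto intro!: divide_nonneg_nonneg mult_nonneg_nonneg)
    moreover have "(b * sqrt (u / \<rho>) ^ n / sqrt (fact n))\<^sup>2 = b\<^sup>2 / \<rho> ^ n / fact n * u ^ n"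
    proof -
      have "(sqrt (u / \<rho>) ^ n)\<^sup>2 = (u / \<rho>) ^ n"
        using u \<rho> by (metis power_mult mult.commute real_sqrt_pow2 divide_nonneg_pos)
      then show ?thesis by (simp add: power_divide power_mult_distrib)
    qed
    moreover have "(C * exp (r * (sqrt (u / \<rho>))\<^sup>2 / 2))\<^sup>2 = C\<^sup>2 * exp (r * u / \<rho>)"
      using u \<rho> by (simp add: power_mult_distrib exp_double[symmetric])
    ultimately have "b\<^sup>2 / \<rho> ^ n / fact n * u ^ n * exp (- u) \<le> C\<^sup>2 * exp (r * u / \<rho>) * exp (- u)"
      by (intro mult_right_mono) auto
    also have "\<dots> = C\<^sup>2 * exp (- \<delta> * u)"
      by (simp add: exp_add[symmetric] \<delta>_def algebra_simps)
    finally show ?thesis by (simp add: mult.assoc)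
  qed
  \<comment> \<open>The total mass of the exponential density with rate \<delta>, solved for the
    integral.\<close>
  have nn0: "(\<integral>\<^sup>+u. ennreal (exp (- \<delta> * u)) * indicator {0..} u \<partial>lborel) = ennreal (1 / \<delta>)"
  proof -
    have "(\<integral>\<^sup>+u. ennreal (exponential_density \<delta> u) \<partial>lborel) = 1"
      using prob_space.emeasure_space_1[OF prob_space_exponential_density[OF \<delta>]]
      by (simp add: emeasure_density)
    moreover have "ennreal (exponential_density \<delta> u) = ennreal \<delta> * (ennreal (exp (- \<delta> * u)) * indicator {0..} u)" for u
      using \<delta> by (auto simp: exponential_density_def ennreal_mult'[symmetric] mult_ac indicator_def split: if_splits)
    ultimately have "ennreal \<delta> * (\<integral>\<^sup>+u. ennreal (exp (- \<delta> * u)) * indicator {0..} u \<partial>lborel) = 1"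
      by (simp add: nn_integral_cmult)
    moreover have "ennreal \<delta> * ennreal (1 / \<delta>) = 1"
      using \<delta> by (simp add: ennreal_mult'[symmetric])
    moreover have "X = b" if "a * X = 1" "a * b = 1" for a b X :: ennreal
    proof -
      have "X = X * (a * b)" using that by simp
      also have "\<dots> = (a * X) * b" by (simp only: mult_ac)
      finally show ?thesis using that by simp
    qed
    ultimately show ?thesis by blast
  qed
  have "ennreal (b\<^sup>2 / \<rho> ^ n) = ennreal (b\<^sup>2 / \<rho> ^ n / fact n) * (\<integral>\<^sup>+u. ennreal (u ^ n * exp (- u)) * indicator {0..} u \<partial>lborel)"
    unfolding nn_intergal_power_times_exp_Ici
    using \<rho> by (subst ennreal_mult'[symmetric]) auto
  also have "\<dots> = (\<integral>\<^sup>+u. ennreal (b\<^sup>2 / \<rho> ^ n / fact n * (u ^ n * exp (- u))) * indicator {0..} u \<partial>lborel)"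
    using \<rho> by (subst nn_integral_cmult[symmetric])
      (auto intro!: nn_integral_cong simp: ennreal_mult'[symmetric] indicator_def)
  also have "\<dots> \<le> (\<integral>\<^sup>+u. ennreal (C\<^sup>2 * exp (- \<delta> * u)) * indicator {0..} u \<partial>lborel)"
    by (intro nn_integral_mono) (use sq in \<open>auto simp: indicator_def intro!: ennreal_leI\<close>)
  also have "\<dots> = ennreal (C\<^sup>2) * (\<integral>\<^sup>+u. ennreal (exp (- \<delta> * u)) * indicator {0..} u \<partial>lborel)"
    by (subst nn_integral_cmult[symmetric])
      (auto intro!: nn_integral_cong simp: ennreal_mult' indicator_def)
  also have "\<dots> = ennreal (C\<^sup>2 / \<delta>)"
    unfolding nn0 by (subst ennreal_mult'[symmetric]) auto
  finally have "b\<^sup>2 / \<rho> ^ n \<le> C\<^sup>2 / \<delta>"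
    using \<delta> by (subst (asm) ennreal_le_iff) auto
  then have "b\<^sup>2 \<le> C\<^sup>2 / \<delta> * \<rho> ^ n" using \<rho> by (simp add: field_simps)
  also have "\<dots> = (C / sqrt \<delta> * sqrt \<rho> ^ n)\<^sup>2"
  proof -
    have "(sqrt \<rho> ^ n)\<^sup>2 = \<rho> ^ n"
      using \<rho> by (metis power_mult mult.commute real_sqrt_pow2 less_imp_le)
    then show ?thesis using \<delta> by (simp add: power_divide power_mult_distrib)
  qed
  finally show ?thesis
    unfolding \<delta>_def[symmetric] by (rule power2_le_imp_le) (use C \<delta> \<rho> in auto)
qed

text \<open>Normalised for the orthonormal basis: pairing a coefficient sequence with
  \<open>hk \<tau> \<zeta>\<close> evaluates its heat evolution at \<zeta>, and
  \<open>hk 0 \<zeta>\<close> is plain evaluation.\<close>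

definition hk :: "'a::real_normed_field \<Rightarrow> 'a \<Rightarrow> nat \<Rightarrow> 'a" where
  "hk \<tau> \<zeta> n = of_real (sqrt (fact n)) * hcoef \<tau> \<zeta> n"

lemma hk_power_sums:
  fixes \<tau> \<zeta> x :: "'a::{real_normed_field, banach}"
  shows "(\<lambda>n. hk \<tau> \<zeta> n * x ^ n / of_real (sqrt (fact n))) sums exp (- \<tau> / 2 * x\<^sup>2 + \<zeta> * x)"
  using hcoef_power_sums[of \<tau> \<zeta> x] by (simp add: hk_def mult_ac)

lemma hk_nonneg: "0 \<le> T \<Longrightarrow> 0 \<le> Z \<Longrightarrow> 0 \<le> hk (- T) (Z::real) n"
  unfolding hk_def by (simp add: hcoef_nonneg)

lemma norm_hk_le:
  assumes "norm \<tau> \<le> T" "norm \<zeta> \<le> Z"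
  shows "norm (hk \<tau> \<zeta> n) \<le> hk (- T) Z n"
  unfolding hk_def using norm_hcoef_le[OF assms, of n]
  by (auto simp: norm_mult intro!: mult_left_mono)

lemma geom_hk_real:
  assumes "0 \<le> T" "T < 1" "0 \<le> Z"
  shows "geom (hk (- T) (Z::real))"
proof -
  \<comment> \<open>T < r < \<rho> < 1 are equally spaced. The gap from T to r absorbs the linear
    term \<open>Z * x\<close>, the gap from r to \<rho> is what \<open>coef_growth\<close> asks for,
    and \<rho> < 1 gives the decay.\<close>
  define r where "r = (1 + 2 * T) / 3"
  define \<rho> where "\<rho> = (2 + T) / 3"
  define C where "C = exp (Z\<^sup>2 / (2 * (r - T)))"
  have r: "0 \<le> r" "T < r" "r < \<rho>" "\<rho> < 1" using assms by (auto simp: r_def \<rho>_def)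
  have "hk (- T) Z n \<le> C / sqrt (1 - r / \<rho>) * sqrt \<rho> ^ n" for n
  proof (rule coef_growth)
    fix x :: real assume x: "0 \<le> x"
    let ?f = "\<lambda>n. hk (- T) Z n * x ^ n / sqrt (fact n)"
    have s: "?f sums exp (T / 2 * x\<^sup>2 + Z * x)"
      using hk_power_sums[of "- T" Z x] by simp
    have "?f n = sum ?f {n}" by simp
    also have "\<dots> \<le> exp (T / 2 * x\<^sup>2 + Z * x)"
      using assms x by (subst sums_unique[OF s], intro sum_le_suminf sums_summable[OF s])
        (auto simp: hk_nonneg)
    also have "T / 2 * x\<^sup>2 + Z * x \<le> Z\<^sup>2 / (2 * (r - T)) + r * x\<^sup>2 / 2"
    proof -
      have "0 \<le> (Z - (r - T) * x)\<^sup>2 / (2 * (r - T))" using r by auto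
      also have "\<dots> = Z\<^sup>2 / (2 * (r - T)) + (r - T) * x\<^sup>2 / 2 - Z * x"
        using r by (simp add: power2_eq_square field_simps)
      finally show ?thesis by (simp add: algebra_simps diff_divide_distrib)
    qed
    then have "exp (T / 2 * x\<^sup>2 + Z * x) \<le> C * exp (r * x\<^sup>2 / 2)"
      by (simp add: C_def exp_add[symmetric])
    finally show "?f n \<le> C * exp (r * x\<^sup>2 / 2)" .
  qed (use r assms hk_nonneg in auto)
  then show ?thesis unfolding geom_def using r assms hk_nonneg[of T Z]
    by (intro exI[of _ "C / sqrt (1 - r / \<rho>)"] exI[of _ "sqrt \<rho>"]) auto
qed

lemma geom_hk:
  fixes \<tau> :: complex
  assumes "norm \<tau> < 1" shows "geom (hk \<tau> \<zeta>)"
proof (rule geom_mono)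
  show "geom (hk (- norm \<tau>) (norm \<zeta>))" by (rule geom_hk_real) (use assms in auto)
  show "norm (hk \<tau> \<zeta> n) \<le> norm (hk (- norm \<tau>) (norm \<zeta>) n)" for n
    using norm_hk_le[of \<tau> "norm \<tau>" \<zeta> "norm \<zeta>" n] by (auto intro: order_trans)
qed


subsection \<open>Gaussian integrals\<close>

text \<open>Complex boxes are products of intervals, and boxes determine Lebesgue measure; this
  makes Fubini available for plane integrals.\<close>

lemma lborel_complex_eq: "(lborel :: complex measure) = distr (lborel \<Otimes>\<^sub>M lborel) borel (\<lambda>(x, y). Complex x y)"
proof (rule lborel_eqI)
  have m: "(\<lambda>(x, y). Complex x y) \<in> (lborel \<Otimes>\<^sub>M lborel) \<rightarrow>\<^sub>M borel"
    by (simp add: Complex_eq case_prod_unfold)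
  fix l u :: complex
  assume le: "\<And>b. b \<in> Basis \<Longrightarrow> l \<bullet> b \<le> u \<bullet> b"
  have "(\<lambda>(x, y). Complex x y) -` box l u \<inter> space (lborel \<Otimes>\<^sub>M lborel) = {Re l<..<Re u} \<times> {Im l<..<Im u}"
    by (auto simp: in_box_complex_iff space_pair_measure)
  then have "emeasure (distr (lborel \<Otimes>\<^sub>M lborel) borel (\<lambda>(x, y). Complex x y)) (box l u) =
      emeasure lborel {Re l<..<Re u} * emeasure lborel {Im l<..<Im u}"
    by (subst emeasure_distr[OF m]) (auto simp: lborel.emeasure_pair_measure_Times)
  also have "\<dots> = ennreal ((Re u - Re l) * (Im u - Im l))"
    using le[of 1] le[of \<i>] by (simp add: ennreal_mult' Basis_complex_def)
  also have "\<dots> = ennreal (\<Prod>b\<in>Basis. (u - l) \<bullet> b)"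
    by (simp add: Basis_complex_def)
  finally show "emeasure (distr (lborel \<Otimes>\<^sub>M lborel) borel (\<lambda>(x, y). Complex x y)) (box l u) =
      ennreal (\<Prod>b\<in>Basis. (u - l) \<bullet> b)" .
qed simp

lemma measurable_Complex_pair [measurable]:
  "(\<lambda>p. Complex (fst p) (snd p)) \<in> borel_measurable (lborel \<Otimes>\<^sub>M lborel)"
  by (simp add: Complex_eq)

lemma integrable_complex_iff:
  fixes f :: "complex \<Rightarrow> 'b::{banach, second_countable_topology}"
  assumes [measurable]: "f \<in> borel_measurable borel"
  shows "integrable lborel f \<longleftrightarrow> integrable (lborel \<Otimes>\<^sub>M lborel) (\<lambda>p. f (Complex (fst p) (snd p)))"
  by (subst lborel_complex_eq) (simp add: integrable_distr_eq case_prod_unfold)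

lemma integral_complex_eq:
  fixes f :: "complex \<Rightarrow> 'b::{banach, second_countable_topology}"
  assumes [measurable]: "f \<in> borel_measurable borel" and f: "integrable lborel f"
  shows "integral\<^sup>L lborel f = (\<integral>x. (\<integral>y. f (Complex x y) \<partial>lborel) \<partial>lborel)"
proof -
  have "integral\<^sup>L lborel f = integral\<^sup>L (lborel \<Otimes>\<^sub>M lborel) (\<lambda>p. f (Complex (fst p) (snd p)))"
    by (subst lborel_complex_eq) (simp add: integral_distr case_prod_unfold)
  also have "\<dots> = (\<integral>x. (\<integral>y. f (Complex x y) \<partial>lborel) \<partial>lborel)"
    using f unfolding integrable_complex_iff[OF assms(1)]
    by (subst lborel_pair.integral_fst'[symmetric]) auto
  finally show ?thesis .
qed

text \<open>A complex linear term calls for no contour shift: after an affine real substitution the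
  integral is a value of the characteristic function of the standard normal law.\<close>

lemma gaussian_integral_1:
  fixes a :: real and b :: complex
  assumes a: "0 < a"
  shows "integrable lborel (\<lambda>x::real. exp (- of_real (a * x\<^sup>2) + b * of_real x))"
    and "(\<integral>x. exp (- of_real (a * x\<^sup>2) + b * of_real x) \<partial>lborel) =
      of_real (sqrt (pi / a)) * exp (b\<^sup>2 / (4 * of_real a))"
proof -
  define f where "f x = exp (- of_real (a * x\<^sup>2) + b * of_real x)" for x :: real
  \<comment> \<open>The substitution x -> t + c x: \<open>t\<close> completes the square for Re b,
    \<open>c\<close> normalises the quadratic term to x^2/2, and Im b survives as the frequency
    \<open>s\<close>.\<close>
  define c where "c = 1 / sqrt (2 * a)"
  define t where "t = Re b / (2 * a)"
  define s where "s = Im b * c"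
  have c: "0 < c" "c\<^sup>2 = 1 / (2 * a)" using a by (auto simp: c_def power_divide)
  define K where "K = exp (- of_real (a * t\<^sup>2) + b * of_real t) * of_real (sqrt (2 * pi))"
  have f: "f (t + c * x) = K * (std_normal_density x *\<^sub>R iexp (s * x))" for x
  proof -
    have "std_normal_density x *\<^sub>R iexp (s * x) = exp (of_real (- (x\<^sup>2) / 2) + \<i> * of_real (s * x)) / of_real (sqrt (2 * pi))"
    proof -
      have "complex_of_real (std_normal_density x) = exp (of_real (- (x\<^sup>2) / 2)) / of_real (sqrt (2 * pi))"
        unfolding std_normal_density_def exp_of_real by simp
      then show ?thesis unfolding exp_add scaleR_conv_of_real by simp
    qed
    then have "K * (std_normal_density x *\<^sub>R iexp (s * x)) =
      exp ((- of_real (a * t\<^sup>2) + b * of_real t) + (of_real (- (x\<^sup>2) / 2) + \<i> * of_real (s * x)))"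
      unfolding K_def exp_add by simp
    also have "(- of_real (a * t\<^sup>2) + b * of_real t) + (of_real (- (x\<^sup>2) / 2) + \<i> * of_real (s * x)) =
      - of_real (a * (t + c * x)\<^sup>2) + b * of_real (t + c * x)"
    proof (rule complex_eqI)
      have e: "2 * a * t = Re b" "a * c\<^sup>2 = 1/2" using a c by (auto simp: t_def)
      have "a * (t + c * x)\<^sup>2 = a * t\<^sup>2 + (2 * a * t) * (c * x) + (a * c\<^sup>2) * x\<^sup>2"
        by (simp add: power2_eq_square algebra_simps)
      then have *: "a * (t + c * x)\<^sup>2 = a * t\<^sup>2 + Re b * (c * x) + 1/2 * x\<^sup>2"
        unfolding e .
      show "Re ((- of_real (a * t\<^sup>2) + b * of_real t) + (of_real (- (x\<^sup>2) / 2) + \<i> * of_real (s * x))) =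
        Re (- of_real (a * (t + c * x)\<^sup>2) + b * of_real (t + c * x))"
        unfolding * by (simp add: algebra_simps)
      show "Im ((- of_real (a * t\<^sup>2) + b * of_real t) + (of_real (- (x\<^sup>2) / 2) + \<i> * of_real (s * x))) =
        Im (- of_real (a * (t + c * x)\<^sup>2) + b * of_real (t + c * x))"
        by (simp add: algebra_simps s_def)
    qed
    finally show ?thesis by (simp add: f_def)
  qed
  have int: "integrable lborel (\<lambda>x. std_normal_density x *\<^sub>R iexp (s * x))"
  proof (rule Bochner_Integration.integrable_bound)
    show "integrable lborel std_normal_density"
      by (rule integrable_normal_density) simp
    show "AE x in lborel. norm (std_normal_density x *\<^sub>R iexp (s * x)) \<le> norm (std_normal_density x)"
      by simp
  qed measurable
  have "integrable lborel (\<lambda>x. f (t + c * x))"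
    unfolding f by (intro integrable_mult_right int)
  then show "integrable lborel (\<lambda>x::real. exp (- of_real (a * x\<^sup>2) + b * of_real x))"
    using c unfolding f_def[symmetric] by (subst (asm) lborel_integrable_real_affine_iff) auto
  have "(\<integral>x. f x \<partial>lborel) = c *\<^sub>R (\<integral>x. f (t + c * x) \<partial>lborel)"
    using c by (subst lborel_integral_real_affine[of c _ t]) auto
  also have "(\<integral>x. f (t + c * x) \<partial>lborel) = K * (\<integral>x. std_normal_density x *\<^sub>R iexp (s * x) \<partial>lborel)"
    unfolding f by (rule integral_mult_right_zero)
  also have "(\<integral>x. std_normal_density x *\<^sub>R iexp (s * x) \<partial>lborel) = char std_normal_distribution s"
    unfolding char_def by (subst integral_density) auto
  also have "\<dots> = exp (of_real (- (s\<^sup>2) / 2))"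
    unfolding exp_of_real by (simp add: char_std_normal_distribution)
  also have "c *\<^sub>R (K * exp (of_real (- (s\<^sup>2) / 2))) =
     of_real (c * sqrt (2 * pi)) * exp (- of_real (a * t\<^sup>2) + b * of_real t + of_real (- (s\<^sup>2) / 2))"
    unfolding exp_add K_def by (simp add: scaleR_conv_of_real)
  also have "c * sqrt (2 * pi) = sqrt (pi / a)"
    using a by (simp add: c_def real_sqrt_mult real_sqrt_divide field_simps)
  also have "- of_real (a * t\<^sup>2) + b * of_real t + of_real (- (s\<^sup>2) / 2) = b\<^sup>2 / (4 * of_real a)"
  proof -
    have "s\<^sup>2 = (Im b)\<^sup>2 / (2 * a)" using c by (simp add: s_def power_mult_distrib)
    moreover have "b\<^sup>2 / (4 * of_real a) = Complex (((Re b)\<^sup>2 - (Im b)\<^sup>2) / (4 * a)) (2 * Re b * Im b / (4 * a))"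
      using a by (intro complex_eqI) (auto simp: Re_divide Im_divide power2_eq_square field_simps)
    ultimately show ?thesis
      using a by (simp add: complex_eq_iff t_def power2_eq_square field_simps)
  qed
  finally show "(\<integral>x. exp (- of_real (a * x\<^sup>2) + b * of_real x) \<partial>lborel) =
      of_real (sqrt (pi / a)) * exp (b\<^sup>2 / (4 * of_real a))"
    by (simp add: f_def)
qed

lemma integrable_exp_neg_norm2:
  assumes d: "0 < \<delta>"
  shows "integrable lborel (\<lambda>w::complex. exp (- \<delta> * (norm w)\<^sup>2))"
proof -
  have 1: "integrable lborel (\<lambda>x::real. exp (- \<delta> * x\<^sup>2))"
  proof -
    have "integrable lborel (\<lambda>x::real. Re (exp (- of_real (\<delta> * x\<^sup>2) + 0 * of_real x)))"
      using gaussian_integral_1(1)[OF d, of 0] by (rule integrable_Re)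
    then show ?thesis by (simp add: Re_exp)
  qed
  have "integrable (lborel \<Otimes>\<^sub>M lborel) (\<lambda>p::real \<times> real. exp (- \<delta> * (fst p)\<^sup>2) * exp (- \<delta> * (snd p)\<^sup>2))"
  proof (rule lborel_pair.Fubini_integrable)
    show "integrable lborel (\<lambda>x. \<integral>y. norm (exp (- \<delta> * (fst (x, y))\<^sup>2) * exp (- \<delta> * (snd (x, y))\<^sup>2)) \<partial>lborel)"
      using 1 by simp
    show "AE x in lborel. integrable lborel (\<lambda>y. exp (- \<delta> * (fst (x, y))\<^sup>2) * exp (- \<delta> * (snd (x, y))\<^sup>2))"
      using 1 by simp
  qed measurable
  then show ?thesis
    by (subst integrable_complex_iff) (auto simp: cmod_def exp_add[symmetric] algebra_simps)
qed

text \<open>Half of the Gaussian decay pays for the linear term.\<close>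

lemma integrable_exp_norm:
  assumes d: "0 < \<delta>"
  shows "integrable lborel (\<lambda>w::complex. exp (b * norm w - \<delta> * (norm w)\<^sup>2))"
proof (rule Bochner_Integration.integrable_bound)
  show "integrable lborel (\<lambda>w::complex. exp (b\<^sup>2 / (2 * \<delta>)) * exp (- (\<delta> / 2) * (norm w)\<^sup>2))"
    using d by (intro integrable_mult_right integrable_exp_neg_norm2) auto
  have "b * r - \<delta> * r\<^sup>2 \<le> b\<^sup>2 / (2 * \<delta>) + - (\<delta> / 2) * r\<^sup>2" for r
  proof -
    have "0 \<le> (b - \<delta> * r)\<^sup>2 / (2 * \<delta>)" using d by auto
    also have "\<dots> = b\<^sup>2 / (2 * \<delta>) - b * r + \<delta> / 2 * r\<^sup>2"
      using d by (simp add: power2_eq_square field_simps)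
    finally show ?thesis by (simp add: algebra_simps)
  qed
  then show "AE w in lborel. norm (exp (b * cmod w - \<delta> * (cmod w)\<^sup>2)) \<le>
      norm (exp (b\<^sup>2 / (2 * \<delta>)) * exp (- (\<delta> / 2) * (cmod w)\<^sup>2))"
    by (simp add: exp_add[symmetric])
qed measurable

text \<open>The terms in \<tau> and its conjugate add up to a real quadratic form in (Re u, Im u),
  so all complex parameters sit in the linear term and the one-dimensional formula applies
  twice.\<close>

lemma gaussian_integral_2:
  fixes \<tau> z v :: complex
  assumes "norm \<tau> < 1"
  shows "integrable lborel (\<lambda>u. exp (- \<tau> / 2 * (cnj u)\<^sup>2 - cnj \<tau> / 2 * u\<^sup>2 + z * cnj u + v * u - of_real ((norm u)\<^sup>2)))"
      (is ?int)
    and "(\<integral>u. exp (- \<tau> / 2 * (cnj u)\<^sup>2 - cnj \<tau> / 2 * u\<^sup>2 + z * cnj u + v * u - of_real ((norm u)\<^sup>2)) \<partial>lborel) =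
      of_real (pi / sqrt (1 - (norm \<tau>)\<^sup>2)) *
      exp ((z * v - cnj \<tau> / 2 * z\<^sup>2 - \<tau> / 2 * v\<^sup>2) / of_real (1 - (norm \<tau>)\<^sup>2))" (is ?eq)
proof -
  let ?f = "\<lambda>u. exp (- \<tau> / 2 * (cnj u)\<^sup>2 - cnj \<tau> / 2 * u\<^sup>2 + z * cnj u + v * u - of_real ((norm u)\<^sup>2))"
  have m: "?f \<in> borel_measurable borel" by (intro borel_measurable_continuous_onI continuous_intros)
  have nt: "(norm \<tau>)\<^sup>2 < 1" using assms by (simp add: power_less_one_iff abs_square_less_1)
  show ?int
  proof (rule Bochner_Integration.integrable_bound)
    show "integrable lborel (\<lambda>u::complex. exp ((norm z + norm v) * norm u - (1 - norm \<tau>) * (norm u)\<^sup>2))"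
      using assms by (intro integrable_exp_norm) auto
    have "norm (?f u) \<le> exp ((norm z + norm v) * norm u - (1 - norm \<tau>) * (norm u)\<^sup>2)" for u
    proof -
      have "Re (- \<tau> / 2 * (cnj u)\<^sup>2) \<le> norm (- \<tau> / 2 * (cnj u)\<^sup>2)" "Re (- cnj \<tau> / 2 * u\<^sup>2) \<le> norm (- cnj \<tau> / 2 * u\<^sup>2)"
         "Re (z * cnj u) \<le> norm (z * cnj u)" "Re (v * u) \<le> norm (v * u)"
        by (rule complex_Re_le_cmod)+
      moreover have "norm (- \<tau> / 2 * (cnj u)\<^sup>2) = norm \<tau> / 2 * (norm u)\<^sup>2" "norm (- cnj \<tau> / 2 * u\<^sup>2) = norm \<tau> / 2 * (norm u)\<^sup>2"
         "norm (z * cnj u) = norm z * norm u" "norm (v * u) = norm v * norm u"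
        by (simp_all add: norm_mult norm_power norm_divide)
      moreover have "Re (- \<tau> / 2 * (cnj u)\<^sup>2 - cnj \<tau> / 2 * u\<^sup>2 + z * cnj u + v * u - of_real ((norm u)\<^sup>2)) =
         Re (- \<tau> / 2 * (cnj u)\<^sup>2) + Re (- cnj \<tau> / 2 * u\<^sup>2) + Re (z * cnj u) + Re (v * u) - (norm u)\<^sup>2"
        by simp
      moreover have "(norm z + norm v) * norm u - (1 - norm \<tau>) * (norm u)\<^sup>2 =
         norm z * norm u + norm v * norm u - (norm u)\<^sup>2 + norm \<tau> / 2 * (norm u)\<^sup>2 + norm \<tau> / 2 * (norm u)\<^sup>2"
        by (simp add: algebra_simps)
      ultimately show ?thesis unfolding norm_exp_eq_Re exp_le_cancel_iff by linarith
    qed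
    then show "AE u in lborel. norm (?f u) \<le> norm (exp ((norm z + norm v) * norm u - (1 - norm \<tau>) * (norm u)\<^sup>2))"
      by simp
  qed (use m in simp)
  define t1 t2 where "t1 = Re \<tau>" and "t2 = Im \<tau>"
  \<comment> \<open>The form is (1 + t1) x^2 + 2 t2 x y + a y^2. Eliminating y first leaves the
    Schur complement \<open>A\<close> in x; \<open>b x\<close> and \<open>B\<close> are the linear
    coefficients met by the inner and the outer integral.\<close>
  define a where "a = 1 - t1"
  define A where "A = (1 - (norm \<tau>)\<^sup>2) / a"
  define b where "b x = \<i> * (v - z) - of_real (2 * t2 * x)" for x
  define B where "B = (z + v) - \<i> * of_real t2 * (v - z) / of_real a"
  have a: "0 < a" using assms complex_Re_le_cmod[of \<tau>] by (auto simp: a_def t1_def)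
  then have A: "0 < A" using nt by (auto simp: A_def)
  have nt2: "(norm \<tau>)\<^sup>2 = t1\<^sup>2 + t2\<^sup>2" by (simp add: cmod_power2 t1_def t2_def)
  have inner: "(\<integral>y. ?f (Complex x y) \<partial>lborel) = of_real (sqrt (pi / a)) * exp (- ((v - z)\<^sup>2) / (4 * of_real a)) *
      exp (- of_real (A * x\<^sup>2) + B * of_real x)" for x
  proof -
    have "?f (Complex x y) = exp (- of_real ((1 + t1) * x\<^sup>2) + (z + v) * of_real x) *
        exp (- of_real (a * y\<^sup>2) + b x * of_real y)" for y
      unfolding exp_add[symmetric]
      by (rule arg_cong[of _ _ exp])
        (auto simp: complex_eq_iff t1_def t2_def a_def b_def power2_eq_square cmod_def algebra_simps
           add_divide_distrib diff_divide_distrib)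
    then have "(\<integral>y. ?f (Complex x y) \<partial>lborel) = exp (- of_real ((1 + t1) * x\<^sup>2) + (z + v) * of_real x) *
        (of_real (sqrt (pi / a)) * exp ((b x)\<^sup>2 / (4 * of_real a)))"
      by (simp only: integral_mult_right_zero gaussian_integral_1(2)[OF a])
    also have "\<dots> = of_real (sqrt (pi / a)) * exp (- of_real ((1 + t1) * x\<^sup>2) + (z + v) * of_real x + (b x)\<^sup>2 / (4 * of_real a))"
      by (simp add: exp_add)
    also have "- of_real ((1 + t1) * x\<^sup>2) + (z + v) * of_real x + (b x)\<^sup>2 / (4 * of_real a) =
       - ((v - z)\<^sup>2) / (4 * of_real a) + (- of_real (A * x\<^sup>2) + B * of_real x)"
    proof -
      have "complex_of_real (a * A) = of_real ((1 + t1) * a - t2\<^sup>2)"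
      proof (rule arg_cong[where f = of_real])
        have "a * A = 1 - (t1\<^sup>2 + t2\<^sup>2)" using a by (simp add: A_def nt2)
        then show "a * A = (1 + t1) * a - t2\<^sup>2" by (simp add: a_def power2_eq_square algebra_simps)
      qed
      then have 1: "of_real a * of_real A = (1 + of_real t1) * of_real a - (of_real t2 :: complex)\<^sup>2"
        by simp
      have 2: "of_real a * B = (z + v) * of_real a - \<i> * of_real t2 * (v - z)"
        using a unfolding B_def right_diff_distrib[of "complex_of_real a" "z + v"] by (simp add: mult.commute)
      have 3: "(b x)\<^sup>2 = - ((v - z)\<^sup>2) - 4 * \<i> * of_real t2 * (v - z) * of_real x + 4 * (of_real t2)\<^sup>2 * (of_real x)\<^sup>2"
        by (simp add: b_def power2_eq_square algebra_simps)
      have "of_real (4 * a) * (- of_real ((1 + t1) * x\<^sup>2) + (z + v) * of_real x + (b x)\<^sup>2 / (4 * of_real a)) =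
        4 * of_real a * (- of_real ((1 + t1) * x\<^sup>2) + (z + v) * of_real x) + (b x)\<^sup>2"
        using a by (simp add: distrib_left)
      also have "\<dots> = - ((v - z)\<^sup>2) - 4 * (of_real a * of_real A) * (of_real x)\<^sup>2 + 4 * (of_real a * B) * of_real x"
        unfolding 1 2 3 by (simp add: algebra_simps)
      also have "\<dots> = of_real (4 * a) * (- ((v - z)\<^sup>2) / (4 * of_real a) + (- of_real (A * x\<^sup>2) + B * of_real x))"
      proof -
        have "- (W\<^sup>2) - 4 * (c * d) * X\<^sup>2 + 4 * (c * B) * X = 4 * c * (- (W\<^sup>2) / (4 * c) + (- (d * X\<^sup>2) + B * X))"
          if "c \<noteq> 0" for c d W X :: complex
          using that by (simp add: field_simps)
        from this[of "of_real a" "v - z" "of_real A" "of_real x"] show ?thesis using a by simp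
      qed
      finally show ?thesis using a by simp
    qed
    also have "exp (- ((v - z)\<^sup>2) / (4 * of_real a) + (- of_real (A * x\<^sup>2) + B * of_real x)) =
       exp (- ((v - z)\<^sup>2) / (4 * of_real a)) * exp (- of_real (A * x\<^sup>2) + B * of_real x)"
      by (rule exp_add)
    finally show ?thesis by simp
  qed
  have "integral\<^sup>L lborel ?f = (\<integral>x. (\<integral>y. ?f (Complex x y) \<partial>lborel) \<partial>lborel)"
    using m \<open>?int\<close> by (rule integral_complex_eq)
  also have "\<dots> = of_real (sqrt (pi / a)) * exp (- ((v - z)\<^sup>2) / (4 * of_real a)) *
      (of_real (sqrt (pi / A)) * exp (B\<^sup>2 / (4 * of_real A)))"
    unfolding inner by (simp only: integral_mult_right_zero gaussian_integral_1(2)[OF A])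
  also have "\<dots> = of_real (sqrt (pi / a) * sqrt (pi / A)) *
      exp (- ((v - z)\<^sup>2) / (4 * of_real a) + B\<^sup>2 / (4 * of_real A))"
    unfolding exp_add of_real_mult by (simp only: mult_ac)
  also have "sqrt (pi / a) * sqrt (pi / A) = pi / sqrt (1 - (norm \<tau>)\<^sup>2)"
  proof -
    have "pi / a * (pi / A) = pi\<^sup>2 / (1 - (norm \<tau>)\<^sup>2)"
      using a by (simp add: A_def power2_eq_square)
    then show ?thesis unfolding real_sqrt_mult[symmetric] by (simp add: real_sqrt_divide)
  qed
  also have "- ((v - z)\<^sup>2) / (4 * of_real a) + B\<^sup>2 / (4 * of_real A) =
     (z * v - cnj \<tau> / 2 * z\<^sup>2 - \<tau> / 2 * v\<^sup>2) / of_real (1 - (norm \<tau>)\<^sup>2)"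
  proof -
    define D where "D = complex_of_real (1 - (norm \<tau>)\<^sup>2)"
    have D: "D \<noteq> 0" using nt unfolding D_def of_real_eq_0_iff by simp
    have D2: "D = 1 - (of_real t1)\<^sup>2 - (of_real t2)\<^sup>2"
      unfolding D_def nt2 by simp
    define a' where "a' = complex_of_real a"
    have a': "a' \<noteq> 0" "a' = 1 - of_real t1" using a by (auto simp: a'_def a_def)
    have B: "B = ((z + v) * a' - \<i> * of_real t2 * (v - z)) / a'"
      using a'(1) unfolding B_def a'_def[symmetric] diff_divide_distrib by simp
    have A': "of_real A = D / a'" by (simp add: A_def D_def a'_def)
    have t: "\<tau> = of_real t1 + \<i> * of_real t2" "cnj \<tau> = of_real t1 - \<i> * of_real t2"
      by (auto simp: t1_def t2_def complex_eq_iff)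
    have "- ((v - z)\<^sup>2) / (4 * a') + B\<^sup>2 / (4 * (D / a')) =
      (- ((v - z)\<^sup>2) * D + ((z + v) * a' - \<i> * of_real t2 * (v - z))\<^sup>2) / (4 * a' * D)"
    proof -
      have "- (W\<^sup>2) / (4 * c) + (N / c)\<^sup>2 / (4 * (d / c)) = (- (W\<^sup>2) * d + N\<^sup>2) / (4 * c * d)"
        if "c \<noteq> 0" "d \<noteq> 0" for c d W N :: complex
        using that by (simp add: field_simps power2_eq_square)
      from this[of a' D "v - z"] show ?thesis using a' D unfolding B by simp
    qed
    \<comment> \<open>The numerator is divisible by the pivot \<open>a'\<close>, so the asymmetry
      between x and y disappears from the result.\<close>
    also have "- ((v - z)\<^sup>2) * D + ((z + v) * a' - \<i> * of_real t2 * (v - z))\<^sup>2 =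
       (4 * (z * v) - 2 * (cnj \<tau> * z\<^sup>2) - 2 * (\<tau> * v\<^sup>2)) * a'"
      unfolding D2 a'(2) t by (simp add: power2_eq_square algebra_simps)
    also have "4 * (z * v) - 2 * (cnj \<tau> * z\<^sup>2) - 2 * (\<tau> * v\<^sup>2) =
       4 * (z * v - cnj \<tau> / 2 * z\<^sup>2 - \<tau> / 2 * v\<^sup>2)"
      by (simp add: algebra_simps)
    also have "(4 * X) * a' / (4 * a' * D) = X / D" for X using a'(1) by simp
    finally show ?thesis unfolding A' D_def[symmetric] a'_def[symmetric] .
  qed
  finally show ?eq .
qed


subsection \<open>Integrals of series against the Gaussian weight\<close>

text \<open>Dominated convergence for the partial sums, with one integrable bound for the pointwise
  sum of norms. Every exchange of a series with an integral against \<open>gweight\<close> goes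
  through it.\<close>

lemma integral_sums_dominated:
  fixes f :: "nat \<Rightarrow> 'a \<Rightarrow> 'b::{banach, second_countable_topology}"
  assumes f [measurable]: "\<And>n. f n \<in> borel_measurable M"
    and g: "integrable M g"
    and s: "\<And>x. summable (\<lambda>n. norm (f n x))"
    and le: "\<And>x. (\<Sum>n. norm (f n x)) \<le> g x"
  shows "\<And>n. integrable M (f n)"
    and "integrable M (\<lambda>x. \<Sum>n. f n x)"
    and "(\<lambda>n. integral\<^sup>L M (f n)) sums (\<integral>x. (\<Sum>n. f n x) \<partial>M)"
proof -
  have part: "(\<Sum>n<N. norm (f n x)) \<le> g x" for N x
    using sum_le_suminf[OF s, of "{..<N}" x] le[of x] by auto
  show i: "integrable M (f n)" for n
  proof (rule Bochner_Integration.integrable_bound[OF g])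
    have "norm (f n x) \<le> g x" for x
      using part[where N = "Suc n" and x = x] by (simp add: sum_nonneg order_trans[rotated])
    then show "AE x in M. norm (f n x) \<le> norm (g x)"
      by (auto intro: order_trans abs_ge_self)
  qed measurable
  have lim: "AE x in M. (\<lambda>N. \<Sum>n<N. f n x) \<longlonglongrightarrow> (\<Sum>n. f n x)"
    using summable_norm_cancel[OF s] by (intro AE_I2 summable_LIMSEQ)
  have bd: "AE x in M. norm (\<Sum>n<N. f n x) \<le> g x" for N
    using part by (intro AE_I2 order_trans[OF norm_sum])
  show "integrable M (\<lambda>x. \<Sum>n. f n x)"
    by (rule integrable_dominated_convergence[OF _ _ g lim bd]) measurable
  have "(\<lambda>N. \<integral>x. (\<Sum>n<N. f n x) \<partial>M) \<longlonglongrightarrow> (\<integral>x. (\<Sum>n. f n x) \<partial>M)"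
    by (rule integral_dominated_convergence[OF _ _ g lim bd]) measurable
  then show "(\<lambda>n. integral\<^sup>L M (f n)) sums (\<integral>x. (\<Sum>n. f n x) \<partial>M)"
    unfolding sums_def by (simp add: Bochner_Integration.integral_sum i)
qed

lemma powser_sums_unique:
  fixes a b :: "nat \<Rightarrow> complex"
  assumes "\<And>x. (\<lambda>n. a n * x ^ n) sums f x" "\<And>x. (\<lambda>n. b n * x ^ n) sums f x"
  shows "a n = b n"
proof -
  have "f has_fps_expansion Abs_fps a" "f has_fps_expansion Abs_fps b"
    using assms by (auto intro!: has_fps_expansionI)
  then have "Abs_fps a = Abs_fps b" by (rule fps_expansion_unique_complex)
  then show ?thesis by (metis fps_nth_Abs_fps)
qed


subsection \<open>Entire functions of the Gaussian type\<close>

definition fock :: "(nat \<Rightarrow> complex) \<Rightarrow> complex \<Rightarrow> complex" where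
  "fock c z = (\<Sum>n. c n * z ^ n / of_real (sqrt (fact n)))"

definition gweight :: "complex \<Rightarrow> complex" where
  "gweight w = of_real (exp (- (cmod w)\<^sup>2) / pi)"

lemma measurable_cnj [measurable]: "cnj \<in> borel_measurable borel" "cnj \<in> borel_measurable lborel"
  by (simp_all add: borel_measurable_continuous_onI continuous_on_cnj)

lemma gweight_measurable [measurable]: "gweight \<in> borel_measurable borel" "gweight \<in> borel_measurable lborel"
  unfolding gweight_def by measurable

lemma norm_gweight: "norm (gweight w) = exp (- (cmod w)\<^sup>2) / pi"
  unfolding gweight_def norm_of_real by simp

text \<open>Weighted AM-GM, a termwise stand-in for Cauchy-Schwarz, splits each term into one from
  the series of exp((Q r)^2) and one from a geometric series. Convergence and bound come out
  together.\<close>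

lemma fock_abs_bound:
  assumes "subexp c" "0 < \<epsilon>"
  obtains C where "0 \<le> C"
    "\<And>r. 0 \<le> r \<Longrightarrow> summable (\<lambda>n. norm (c n) * r ^ n / sqrt (fact n))"
    "\<And>r. 0 \<le> r \<Longrightarrow> (\<Sum>n. norm (c n) * r ^ n / sqrt (fact n)) \<le> C * exp ((1 + \<epsilon>) * r\<^sup>2 / 2)"
proof -
  \<comment> \<open>\<open>Q\<close> squares to 1 + \<epsilon> and \<open>q\<close> squares to
    \<open>Q\<close>: the allowed growth q^n equals Q^n times (1/q)^n, and the squares of the second
    factor form the geometric series in 1/Q.\<close>
  define Q where "Q = sqrt (1 + \<epsilon>)"
  define q where "q = sqrt Q"
  have Q: "1 < Q" "Q\<^sup>2 = 1 + \<epsilon>" using assms(2) by (auto simp: Q_def)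
  then have q: "1 < q" "q\<^sup>2 = Q" by (auto simp: q_def)
  obtain K where K: "0 \<le> K" "\<And>n. norm (c n) \<le> K * q ^ n"
    using subexp_bound[OF assms(1) q(1)] by blast
  define S where "S = (\<Sum>n. (1 / Q) ^ n)"
  have S: "(\<lambda>n. (1 / Q) ^ n) sums S"
    unfolding S_def using Q by (intro summable_sums summable_geometric) auto
  have S0: "0 \<le> S" using Q sums_le[OF _ sums_zero S] by simp
  define B where "B r n = K / 2 * (exp (- ((Q * r)\<^sup>2 / 2)) * (((Q * r)\<^sup>2) ^ n / fact n) + exp ((Q * r)\<^sup>2 / 2) * (1 / Q) ^ n)" for r n
  have B: "B r sums (K / 2 * (1 + S) * exp ((1 + \<epsilon>) * r\<^sup>2 / 2))" for r
  proof -
    have "(\<lambda>n. ((Q * r)\<^sup>2) ^ n / fact n) sums exp ((Q * r)\<^sup>2)"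
      using exp_converges[of "(Q * r)\<^sup>2"] by (simp add: divide_inverse mult.commute)
    then have "B r sums (K / 2 * (exp (- ((Q * r)\<^sup>2 / 2)) * exp ((Q * r)\<^sup>2) + exp ((Q * r)\<^sup>2 / 2) * S))"
      unfolding B_def by (intro sums_mult sums_add S)
    moreover have "exp (- ((Q * r)\<^sup>2 / 2)) * exp ((Q * r)\<^sup>2) = exp ((Q * r)\<^sup>2 / 2)"
      by (simp add: exp_add[symmetric])
    moreover have "E + E * S = (1 + S) * E" for E by (simp add: algebra_simps)
    ultimately show ?thesis by (simp add: power_mult_distrib Q mult.assoc)
  qed
  have le: "norm (c n) * r ^ n / sqrt (fact n) \<le> B r n" if "0 \<le> r" for r n
  proof -
    define x where "x = (Q * r) ^ n / sqrt (fact n)"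
    define y where "y = (1 / q) ^ n"
    \<comment> \<open>This weight balances the two halves: both come out proportional to exp((Q r)^2
      / 2).\<close>
    define l where "l = exp (- ((Q * r)\<^sup>2 / 2))"
    have l: "0 < l" "1 / l = exp ((Q * r)\<^sup>2 / 2)" by (auto simp: l_def exp_minus field_simps)
    have "norm (c n) * r ^ n / sqrt (fact n) \<le> (K * q ^ n) * r ^ n / sqrt (fact n)"
      using that by (intro divide_right_mono mult_right_mono K) auto
    also have "\<dots> = K * (x * y)"
      using q by (simp add: x_def y_def q(2)[symmetric] power_mult_distrib power_divide power2_eq_square)
    also have "x * y \<le> (l * x\<^sup>2 + 1 / l * y\<^sup>2) / 2"
    proof -
      have "0 \<le> (l * x - y)\<^sup>2 / (2 * l)" using l by auto
      also have "\<dots> = (l * x\<^sup>2 + 1 / l * y\<^sup>2) / 2 - x * y"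
        using l by (simp add: power2_eq_square field_simps)
      finally show ?thesis by simp
    qed
    then have "K * (x * y) \<le> K * ((l * x\<^sup>2 + 1 / l * y\<^sup>2) / 2)" using K by (intro mult_left_mono)
    also have "x\<^sup>2 = ((Q * r)\<^sup>2) ^ n / fact n"
      by (simp add: x_def power_divide power_mult[symmetric] mult.commute)
    also have "y\<^sup>2 = (1 / Q) ^ n"
      unfolding y_def power_mult[symmetric] mult.commute[of n] using q
      by (simp add: power_mult power_divide)
    finally show ?thesis unfolding B_def l(2)[symmetric] by (simp add: l_def)
  qed
  have s: "summable (\<lambda>n. norm (c n) * r ^ n / sqrt (fact n))" if "0 \<le> r" for r
    by (rule summable_comparison_test[OF _ sums_summable[OF B[of r]]])
      (use le that in \<open>auto intro!: exI[of _ 0]\<close>)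
  show ?thesis
  proof (rule that[of "K / 2 * (1 + S)"])
    fix r :: real assume r: "0 \<le> r"
    show "(\<Sum>n. norm (c n) * r ^ n / sqrt (fact n)) \<le> K / 2 * (1 + S) * exp ((1 + \<epsilon>) * r\<^sup>2 / 2)"
      unfolding sums_unique[OF B] using r by (intro suminf_le s le sums_summable[OF B]) auto
  qed (use K S0 s in auto)
qed

lemma fock_summable:
  fixes z :: complex
  assumes "subexp c" shows "summable (\<lambda>n. norm (c n * z ^ n / of_real (sqrt (fact n))))"
proof -
  have "summable (\<lambda>n. norm (c n) * norm z ^ n / sqrt (fact n))"
    by (rule fock_abs_bound[OF assms zero_less_one]) simp
  then show ?thesis by (simp add: norm_mult norm_divide norm_power)
qed

lemma fock_bound:
  assumes "subexp c" "0 < \<epsilon>"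
  obtains C where "0 \<le> C" "\<And>z. norm (fock c z) \<le> C * exp ((1 + \<epsilon>) * (norm z)\<^sup>2 / 2)"
proof -
  obtain C where C: "0 \<le> C"
    "\<And>r. 0 \<le> r \<Longrightarrow> (\<Sum>n. norm (c n) * r ^ n / sqrt (fact n)) \<le> C * exp ((1 + \<epsilon>) * r\<^sup>2 / 2)"
    using fock_abs_bound[OF assms] by metis
  have "norm (fock c z) \<le> (\<Sum>n. norm (c n) * norm z ^ n / sqrt (fact n))" for z
    unfolding fock_def using summable_norm[OF fock_summable[OF assms(1), of z]]
    by (simp add: norm_mult norm_divide norm_power)
  then show ?thesis using C by (intro that[of C]) (auto intro: order_trans[OF _ C(2)[OF norm_ge_zero]])
qed

lemma fock_power_series:
  assumes "subexp c"
  shows "(\<lambda>n. c n / of_real (sqrt (fact n)) * z ^ n) sums fock c z"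
  using summable_norm_cancel[OF fock_summable[OF assms, of z]]
  unfolding fock_def by (simp add: sums_iff)

text \<open>Differentiation in the orthonormal basis, that is, the annihilation operator acting on
  coefficients.\<close>

definition dshift :: "(nat \<Rightarrow> complex) \<Rightarrow> nat \<Rightarrow> complex" where
  "dshift c n = of_real (sqrt (Suc n)) * c (Suc n)"

lemma subexp_dshift:
  assumes "subexp c" shows "subexp (dshift c)"
proof (rule subexpI)
  fix t :: real assume t: "1 < t"
  define s where "s = sqrt t"
  have s: "1 < s" "s * s = t" using t by (auto simp: s_def)
  obtain K where K: "0 \<le> K" "\<And>n. norm (c n) \<le> K * s ^ n"
    using subexp_bound[OF assms s(1)] by blast
  \<comment> \<open>Chosen so that n + 1 is at most L (1 + n (s - 1)), which Bernoulli bounds by L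
    s^n; the other factor of t = s^2 bounds the coefficients.\<close>
  define L where "L = max 1 (1 / (s - 1))"
  have L: "1 \<le> L" "1 \<le> L * (s - 1)" using s by (auto simp: L_def max_def field_simps)
  have "norm (dshift c n) \<le> (K * s * L) * t ^ n" for n
  proof -
    have "sqrt (Suc n) \<le> Suc n" by (rule real_le_lsqrt) (auto simp: power2_eq_square)
    also have "real (Suc n) \<le> L * (1 + n * (s - 1))"
    proof -
      have "1 + real n * 1 \<le> L + real n * (L * (s - 1))"
        using L by (intro add_mono mult_left_mono) auto
      then show ?thesis by (simp add: algebra_simps)
    qed
    also have "\<dots> \<le> L * s ^ n"
      using Bernoulli_inequality[of "s - 1" n] s L by (intro mult_left_mono) auto
    finally have "sqrt (Suc n) * norm (c (Suc n)) \<le> (L * s ^ n) * (K * s ^ Suc n)"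
      using L s by (intro mult_mono[OF _ K(2)]) auto
    also have "\<dots> = (K * s * L) * t ^ n" by (simp add: s(2)[symmetric] power_mult_distrib)
    finally show ?thesis by (simp add: dshift_def norm_mult del: of_nat_Suc)
  qed
  then show "\<exists>K. \<forall>n. norm (dshift c n) \<le> K * t ^ n" by blast
qed

lemma fock_has_field_derivative:
  assumes "subexp c"
  shows "(fock c has_field_derivative fock (dshift c) z) (at z)"
proof -
  let ?a = "\<lambda>n. c n / of_real (sqrt (fact n))"
  have eq: "fock c = (\<lambda>z. \<Sum>n. ?a n * z ^ n)"
    using fock_power_series[OF assms] by (auto simp: sums_iff)
  have "((\<lambda>z. \<Sum>n. ?a n * z ^ n) has_field_derivative (\<Sum>n. diffs ?a n * z ^ n)) (at z)"
    by (rule termdiffs_strong_converges_everywhere) (use fock_power_series[OF assms] in \<open>auto simp: sums_iff\<close>)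
  moreover have "diffs ?a n * z ^ n = dshift c n * z ^ n / of_real (sqrt (fact n))" for n
  proof -
    have "complex_of_real (sqrt (Suc n)) * of_real (sqrt (Suc n)) = of_nat (Suc n)"
      unfolding of_real_mult[symmetric] real_sqrt_mult_self by simp
    then have "of_nat (Suc n) / complex_of_real (sqrt (fact (Suc n))) = of_real (sqrt (Suc n)) / of_real (sqrt (fact n))"
      by (simp add: real_sqrt_mult field_simps del: of_nat_Suc)
    then show ?thesis unfolding diffs_def dshift_def by (simp add: field_simps del: of_nat_Suc fact_Suc)
  qed
  ultimately show ?thesis unfolding eq by (simp add: fock_def)
qed

lemma fock_holomorphic: "subexp c \<Longrightarrow> fock c holomorphic_on S"
  using fock_has_field_derivative by (metis holomorphic_on_open holomorphic_on_subset open_UNIV subset_UNIV)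

lemma fock_continuous: "subexp c \<Longrightarrow> continuous_on S (fock c)"
  by (intro holomorphic_on_imp_continuous_on fock_holomorphic)

lemma fock_measurable: "subexp c \<Longrightarrow> fock c \<in> borel_measurable borel"
  by (intro borel_measurable_continuous_onI fock_continuous)

lemma funpow_dshift: "(dshift ^^ j) c n = of_real (sqrt (fact (n + j) / fact n)) * c (n + j)"
proof (induction j arbitrary: n)
  case (Suc j)
  have "(dshift ^^ Suc j) c n = of_real (sqrt (Suc n)) * (of_real (sqrt (fact (Suc n + j) / fact (Suc n))) * c (Suc n + j))"
    by (simp add: dshift_def Suc.IH del: of_nat_Suc fact_Suc)
  also have "\<dots> = of_real (sqrt (Suc n * (fact (Suc n + j) / fact (Suc n)))) * c (n + Suc j)"
    unfolding real_sqrt_mult[of "real (Suc n)"] by (simp del: of_nat_Suc fact_Suc)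
  also have "Suc n * (fact (Suc n + j) / fact (Suc n)) = (fact (n + Suc j) / fact n :: real)"
    by (simp del: of_nat_Suc)
  finally show ?case .
qed simp

lemma deriv_funpow_fock:
  assumes "subexp c" shows "(deriv ^^ j) (fock c) = fock ((dshift ^^ j) c) \<and> subexp ((dshift ^^ j) c)"
proof (induction j)
  case (Suc j)
  then have "deriv (fock ((dshift ^^ j) c)) z = fock (dshift ((dshift ^^ j) c)) z" for z
    by (intro DERIV_imp_deriv fock_has_field_derivative) auto
  with Suc subexp_dshift show ?case by auto
qed (use assms in auto)

lemma summable_hk_abs:
  assumes "subexp c" "0 \<le> T" "T < 1" "0 \<le> Z"
  shows "summable (\<lambda>n. norm (c n) * hk (- T) Z n)"
  using summable_subexp_geom[OF assms(1) geom_hk_real[of T Z]] assms hk_nonneg[of T Z] by simp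

text \<open>The heat term of order k is row k of the double series over (k, m), since 2k derivatives
  shift the coefficients by 2k. Decay of \<open>hk\<close> makes the double series absolutely
  summable, so it may be regrouped by n = 2k + m.\<close>

lemma heat_fock:
  assumes "subexp c" "norm \<tau> < 1"
  shows "summable (heat_term \<tau> (fock c) \<zeta>)"
    and "heat \<tau> (fock c) \<zeta> = (\<Sum>n. c n * hk \<tau> \<zeta> n)"
proof -
  define W where "W n = of_real (sqrt (fact n)) * c n" for n
  have s: "summable (\<lambda>n. hcoef (- norm \<tau>) (norm \<zeta>) n * norm (W n))"
    using summable_hk_abs[OF assms(1) _ assms(2), of "norm \<zeta>"]
    by (simp add: hk_def W_def norm_mult mult_ac)
  have "heat_term \<tau> (fock c) \<zeta> k = (\<Sum>m. (- \<tau> / 2) ^ k / fact k * (\<zeta> ^ m / fact m) * W (2 * k + m))" for k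
  proof -
    let ?d = "(dshift ^^ (2 * k)) c"
    have sd: "subexp ?d" using deriv_funpow_fock[OF assms(1)] by blast
    have eq: "?d m / of_real (sqrt (fact m)) * \<zeta> ^ m = \<zeta> ^ m / fact m * W (2 * k + m)" for m
    proof -
      have "complex_of_real (sqrt (fact m)) * of_real (sqrt (fact m)) = fact m"
        unfolding of_real_mult[symmetric] real_sqrt_mult_self by simp
      then have "?d m / of_real (sqrt (fact m)) = W (2 * k + m) / fact m"
        by (simp add: funpow_dshift W_def add.commute real_sqrt_divide)
      then show ?thesis by simp
    qed
    have "heat_term \<tau> (fock c) \<zeta> k = (- \<tau> / 2) ^ k / fact k * fock ?d \<zeta>"
      using deriv_funpow_fock[OF assms(1), of "2 * k"] by (simp add: heat_term_def)
    moreover have "(\<lambda>m. (- \<tau> / 2) ^ k / fact k * (?d m / of_real (sqrt (fact m)) * \<zeta> ^ m)) sums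
        ((- \<tau> / 2) ^ k / fact k * fock ?d \<zeta>)"
      by (intro sums_mult fock_power_series sd)
    ultimately show ?thesis unfolding eq by (simp add: sums_iff mult.assoc)
  qed
  then have eq: "heat_term \<tau> (fock c) \<zeta> =
      (\<lambda>k. \<Sum>m. (- \<tau> / 2) ^ k / fact k * (\<zeta> ^ m / fact m) * W (2 * k + m))"
    by (rule ext)
  have "heat_term \<tau> (fock c) \<zeta> sums (\<Sum>n. hcoef \<tau> \<zeta> n * W n)"
    unfolding eq by (rule pairs_sums[OF s])
  then show "summable (heat_term \<tau> (fock c) \<zeta>)" "heat \<tau> (fock c) \<zeta> = (\<Sum>n. c n * hk \<tau> \<zeta> n)"
    by (auto simp: heat_def sums_iff hk_def W_def mult_ac)
qed

section \<open>Orthogonality of monomials and the integral form of the heat operator\<close>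

lemma exp_gaussian_integral:
  "integrable lborel (\<lambda>w. exp (\<beta> * cnj w + \<alpha> * w) * gweight w)"
  "(\<integral>w. exp (\<beta> * cnj w + \<alpha> * w) * gweight w \<partial>lborel) = exp (\<alpha> * \<beta>)"
proof -
  have e: "exp (\<beta> * cnj w + \<alpha> * w) * gweight w =
     of_real (1 / pi) * exp (- 0 / 2 * (cnj w)\<^sup>2 - cnj 0 / 2 * w\<^sup>2 + \<beta> * cnj w + \<alpha> * w - of_real ((norm w)\<^sup>2))" for w
    by (simp add: gweight_def exp_diff exp_minus exp_of_real[symmetric] field_simps)
  show "integrable lborel (\<lambda>w::complex. exp (\<beta> * cnj w + \<alpha> * w) * gweight w)"
    unfolding e by (intro integrable_mult_right gaussian_integral_2) simp
  show "(\<integral>w. exp (\<beta> * cnj w + \<alpha> * w) * gweight w \<partial>lborel) = exp (\<alpha> * \<beta>)"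
    unfolding e integral_mult_right_zero by (subst gaussian_integral_2) (auto simp: mult.commute)
qed

text \<open>Expanding exp(\<alpha> w) inside \<open>exp_gaussian_integral\<close> and comparing
  coefficients of \<alpha>^n avoids polar coordinates and differentiation under the
  integral.\<close>

lemma monomial_exp_integral:
  "(\<integral>w. w ^ n * exp (\<beta> * cnj w) * gweight w \<partial>lborel) = \<beta> ^ n"
proof -
  define a where "a n = (\<integral>w. w ^ n * exp (\<beta> * cnj w) * gweight w \<partial>lborel) / fact n" for n
  define f where "f \<alpha> n w = (\<alpha> * w) ^ n / fact n * (exp (\<beta> * cnj w) * gweight w)" for \<alpha> n w
  have nf: "(\<lambda>n. norm (f \<alpha> n w)) sums (exp (norm \<alpha> * norm w) * norm (exp (\<beta> * cnj w) * gweight w))" for \<alpha> w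
  proof -
    have "norm (f \<alpha> n w) = (norm \<alpha> * norm w) ^ n /\<^sub>R fact n * norm (exp (\<beta> * cnj w) * gweight w)" for n
      by (simp add: f_def norm_mult norm_divide norm_inverse norm_power divide_inverse mult_ac)
    then show ?thesis by (simp only:) (intro sums_mult2 exp_converges)
  qed
  have le: "(\<Sum>n. norm (f \<alpha> n w)) \<le> exp ((norm \<alpha> + norm \<beta>) * norm w - 1 * (norm w)\<^sup>2)" for \<alpha> w
  proof -
    have "Re (\<beta> * cnj w) \<le> norm \<beta> * norm w"
      using complex_Re_le_cmod[of "\<beta> * cnj w"] by (simp add: norm_mult)
    then have "norm (exp (\<beta> * cnj w) * gweight w) \<le> exp (norm \<beta> * norm w) * (exp (- (cmod w)\<^sup>2) / 1)"
      unfolding norm_mult norm_gweight norm_exp_eq_Re using pi_gt3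
      by (intro mult_mono divide_left_mono) auto
    then have "exp (norm \<alpha> * norm w) * norm (exp (\<beta> * cnj w) * gweight w) \<le>
       exp (norm \<alpha> * norm w) * (exp (norm \<beta> * norm w) * (exp (- (cmod w)\<^sup>2) / 1))"
      by (intro mult_left_mono) auto
    also have "\<dots> = exp ((norm \<alpha> + norm \<beta>) * norm w - 1 * (norm w)\<^sup>2)"
      by (simp add: exp_add[symmetric] algebra_simps)
    finally show ?thesis using sums_unique[OF nf] by simp
  qed
  have "(\<lambda>n. integral\<^sup>L lborel (f \<alpha> n)) sums (\<integral>w. (\<Sum>n. f \<alpha> n w) \<partial>lborel)" for \<alpha>
  proof (rule integral_sums_dominated(3))
    show "integrable lborel (\<lambda>w::complex. exp ((norm \<alpha> + norm \<beta>) * norm w - 1 * (norm w)\<^sup>2) :: real)"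
      by (rule integrable_exp_norm) simp
    show "f \<alpha> n \<in> borel_measurable lborel" for n unfolding f_def measurable_lborel2 by measurable
  qed (use nf le in \<open>auto simp: sums_iff\<close>)
  moreover have "(\<Sum>n. f \<alpha> n w) = exp (\<beta> * cnj w + \<alpha> * w) * gweight w" for \<alpha> w
  proof -
    have "(\<lambda>n. (\<alpha> * w) ^ n /\<^sub>R fact n * (exp (\<beta> * cnj w) * gweight w)) sums (exp (\<alpha> * w) * (exp (\<beta> * cnj w) * gweight w))"
      by (intro sums_mult2 exp_converges)
    moreover have "(\<alpha> * w) ^ n /\<^sub>R fact n * (exp (\<beta> * cnj w) * gweight w) = f \<alpha> n w" for n
      by (simp add: f_def scaleR_conv_of_real divide_inverse mult_ac)
    ultimately show ?thesis by (simp add: sums_iff exp_add mult_ac)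
  qed
  moreover have "integral\<^sup>L lborel (f \<alpha> n) = a n * \<alpha> ^ n" for \<alpha> n
  proof -
    have "f \<alpha> n = (\<lambda>w. \<alpha> ^ n / fact n * (w ^ n * exp (\<beta> * cnj w) * gweight w))"
      by (auto simp: f_def power_mult_distrib)
    then show ?thesis by (simp add: a_def)
  qed
  ultimately have 1: "(\<lambda>n. a n * \<alpha> ^ n) sums exp (\<alpha> * \<beta>)" for \<alpha>
    by (simp add: exp_gaussian_integral(2))
  have 2: "(\<lambda>n. \<beta> ^ n / fact n * \<alpha> ^ n) sums exp (\<alpha> * \<beta>)" for \<alpha>
    using exp_converges[of "\<alpha> * \<beta>"] by (simp add: power_mult_distrib scaleR_conv_of_real divide_inverse mult_ac)
  from powser_sums_unique[OF 1 2, of n] show ?thesis by (simp add: a_def)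
qed

lemma power_le_fact_exp: "0 \<le> r \<Longrightarrow> r ^ n \<le> fact n * exp (r::real)"
proof -
  assume r: "0 \<le> r"
  have "r ^ n /\<^sub>R fact n = (\<Sum>k\<in>{n}. r ^ k /\<^sub>R fact k)" by simp
  also have "\<dots> \<le> exp r"
    unfolding sums_unique[OF exp_converges[of r]] using r
    by (intro sum_le_suminf sums_summable[OF exp_converges]) auto
  finally show ?thesis by (simp add: field_simps)
qed

text \<open>The same comparison of coefficients once more, now in powers of \<beta> in
  \<open>monomial_exp_integral\<close>.\<close>

lemma monomial_orthogonality:
  "(\<integral>w. w ^ n * cnj w ^ m * gweight w \<partial>lborel) = (if n = m then fact n else 0)"
proof -
  define a where "a m = (\<integral>w. w ^ n * cnj w ^ m * gweight w \<partial>lborel) / fact m" for m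
  define f where "f \<beta> m w = (\<beta> * cnj w) ^ m / fact m * (w ^ n * gweight w)" for \<beta> m w
  have nf: "(\<lambda>m. norm (f \<beta> m w)) sums (exp (norm \<beta> * norm w) * norm (w ^ n * gweight w))" for \<beta> w
  proof -
    have "norm (f \<beta> m w) = (norm \<beta> * norm w) ^ m /\<^sub>R fact m * norm (w ^ n * gweight w)" for m
      by (simp add: f_def norm_mult norm_divide norm_inverse norm_power divide_inverse mult_ac)
    then show ?thesis by (simp only:) (intro sums_mult2 exp_converges)
  qed
  have le: "(\<Sum>m. norm (f \<beta> m w)) \<le> fact n * exp ((norm \<beta> + 1) * norm w - 1 * (norm w)\<^sup>2)" for \<beta> w
  proof -
    have "norm (w ^ n * gweight w) \<le> (fact n * exp (norm w)) * (exp (- (cmod w)\<^sup>2) / 1)"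
      unfolding norm_mult norm_gweight norm_power using pi_gt3
      by (intro mult_mono divide_left_mono power_le_fact_exp) auto
    then have "exp (norm \<beta> * norm w) * norm (w ^ n * gweight w) \<le>
       exp (norm \<beta> * norm w) * ((fact n * exp (norm w)) * (exp (- (cmod w)\<^sup>2) / 1))"
      by (intro mult_left_mono) auto
    also have "\<dots> = fact n * (exp (norm \<beta> * norm w) * exp (norm w) * exp (- (cmod w)\<^sup>2))"
      by simp
    also have "\<dots> = fact n * exp ((norm \<beta> + 1) * norm w - 1 * (norm w)\<^sup>2)"
      unfolding exp_add[symmetric] by (simp add: algebra_simps)
    finally show ?thesis using sums_unique[OF nf] by simp
  qed
  have "(\<lambda>m. integral\<^sup>L lborel (f \<beta> m)) sums (\<integral>w. (\<Sum>m. f \<beta> m w) \<partial>lborel)" for \<beta>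
  proof (rule integral_sums_dominated(3))
    show "integrable lborel (\<lambda>w::complex. fact n * exp ((norm \<beta> + 1) * norm w - 1 * (norm w)\<^sup>2) :: real)"
      by (intro integrable_mult_right integrable_exp_norm) simp
    show "f \<beta> m \<in> borel_measurable lborel" for m unfolding f_def measurable_lborel2 by measurable
  qed (use nf le in \<open>auto simp: sums_iff\<close>)
  moreover have "(\<Sum>m. f \<beta> m w) = w ^ n * exp (\<beta> * cnj w) * gweight w" for \<beta> w
  proof -
    have "(\<lambda>m. (\<beta> * cnj w) ^ m /\<^sub>R fact m * (w ^ n * gweight w)) sums (exp (\<beta> * cnj w) * (w ^ n * gweight w))"
      by (intro sums_mult2 exp_converges)
    moreover have "(\<beta> * cnj w) ^ m /\<^sub>R fact m * (w ^ n * gweight w) = f \<beta> m w" for m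
      by (simp add: f_def scaleR_conv_of_real divide_inverse mult_ac)
    ultimately show ?thesis by (simp add: sums_iff mult_ac)
  qed
  moreover have "integral\<^sup>L lborel (f \<beta> m) = a m * \<beta> ^ m" for \<beta> m
  proof -
    have "f \<beta> m = (\<lambda>w. \<beta> ^ m / fact m * (w ^ n * cnj w ^ m * gweight w))"
      by (auto simp: f_def power_mult_distrib)
    then show ?thesis by (simp add: a_def)
  qed
  ultimately have 1: "(\<lambda>m. a m * \<beta> ^ m) sums \<beta> ^ n" for \<beta>
    by (simp add: monomial_exp_integral)
  have 2: "(\<lambda>m. (if m = n then 1 else 0) * \<beta> ^ m) sums \<beta> ^ n" for \<beta> :: complex
  proof -
    have eq: "(\<lambda>m. (if m = n then 1 else 0) * \<beta> ^ m) = (\<lambda>m. if m = n then \<beta> ^ m else 0)" by auto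
    show ?thesis unfolding eq by (rule sums_single)
  qed
  from powser_sums_unique[OF 1 2, of m] show ?thesis
    by (auto simp: a_def split: if_splits)
qed


lemma norm_heat_kernel_le:
  "norm (exp (- \<tau> / 2 * (cnj w)\<^sup>2 + \<zeta> * cnj w)) \<le> exp (norm \<tau> / 2 * (norm w)\<^sup>2 + norm \<zeta> * norm w)"
proof -
  have "Re (- \<tau> / 2 * (cnj w)\<^sup>2 + \<zeta> * cnj w) \<le> norm (- \<tau> / 2 * (cnj w)\<^sup>2) + norm (\<zeta> * cnj w)"
    using complex_Re_le_cmod[of "- \<tau> / 2 * (cnj w)\<^sup>2 + \<zeta> * cnj w"] norm_triangle_ineq order_trans by blast
  then show ?thesis unfolding norm_exp_eq_Re by (simp add: norm_mult norm_divide norm_power)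
qed

text \<open>The kernel is the generating function of \<open>hk \<tau> \<zeta>\<close> at
  \<open>cnj w\<close>; orthogonality of the monomials leaves a single term of it.\<close>

lemma hk_integral:
  assumes "norm \<tau> < 1"
  shows "(\<integral>w. exp (- \<tau> / 2 * (cnj w)\<^sup>2 + \<zeta> * cnj w) * w ^ n * gweight w \<partial>lborel) = of_real (sqrt (fact n)) * hk \<tau> \<zeta> n"
proof -
  define f where "f m w = hk \<tau> \<zeta> m * cnj w ^ m / of_real (sqrt (fact m)) * (w ^ n * gweight w)" for m w
  define T Z where "T = norm \<tau>" and "Z = norm \<zeta>"
  have TZ: "0 \<le> T" "0 \<le> Z" "T < 1" using assms by (auto simp: T_def Z_def)
  have maj: "(\<lambda>m. hk (- T) Z m * norm w ^ m / sqrt (fact m) * norm (w ^ n * gweight w)) sums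
      (exp (T / 2 * (norm w)\<^sup>2 + Z * norm w) * norm (w ^ n * gweight w))" for w
    using hk_power_sums[of "- T" Z "norm w"] by (intro sums_mult2) simp
  have nf: "norm (f m w) \<le> hk (- T) Z m * norm w ^ m / sqrt (fact m) * norm (w ^ n * gweight w)" for m w
    unfolding f_def norm_mult[of "hk \<tau> \<zeta> m * cnj w ^ m / of_real (sqrt (fact m))"]
    by (intro mult_right_mono)
      (auto simp: norm_mult norm_divide norm_power T_def Z_def intro!: divide_right_mono mult_right_mono norm_hk_le)
  have s: "summable (\<lambda>m. norm (f m w))" for w
    by (rule summable_comparison_test[OF _ sums_summable[OF maj[of w]]]) (use nf in auto)
  have "(\<lambda>m. integral\<^sup>L lborel (f m)) sums (\<integral>w. (\<Sum>m. f m w) \<partial>lborel)"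
  proof (rule integral_sums_dominated(3)[OF _ _ s])
    show "integrable lborel (\<lambda>w::complex. fact n * exp ((Z + 1) * norm w - ((1 - T / 2)) * (norm w)\<^sup>2))"
      using TZ by (intro integrable_mult_right integrable_exp_norm) auto
    show "f m \<in> borel_measurable lborel" for m unfolding f_def measurable_lborel2 by measurable
    fix w
    have "(\<Sum>m. norm (f m w)) \<le> exp (T / 2 * (norm w)\<^sup>2 + Z * norm w) * norm (w ^ n * gweight w)"
      unfolding sums_unique[OF maj] by (intro suminf_le nf s sums_summable[OF maj])
    also have "\<dots> \<le> exp (T / 2 * (norm w)\<^sup>2 + Z * norm w) * ((fact n * exp (norm w)) * (exp (- (cmod w)\<^sup>2) / 1))"
      unfolding norm_mult norm_gweight norm_power using pi_gt3
      by (intro mult_mono divide_left_mono power_le_fact_exp) auto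
    also have "\<dots> = fact n * (exp (T / 2 * (norm w)\<^sup>2 + Z * norm w) * exp (norm w) * exp (- (cmod w)\<^sup>2))"
      by simp
    also have "\<dots> = fact n * exp ((Z + 1) * norm w - (1 - T / 2) * (norm w)\<^sup>2)"
      unfolding exp_add[symmetric] by (simp add: algebra_simps)
    finally show "(\<Sum>m. norm (f m w)) \<le> fact n * exp ((Z + 1) * norm w - (1 - T / 2) * (norm w)\<^sup>2)" .
  qed
  moreover have "(\<Sum>m. f m w) = exp (- \<tau> / 2 * (cnj w)\<^sup>2 + \<zeta> * cnj w) * w ^ n * gweight w" for w
    using sums_mult2[OF hk_power_sums[of \<tau> \<zeta> "cnj w"], of "w ^ n * gweight w"]
    by (simp add: sums_iff f_def mult.assoc)
  moreover have "integral\<^sup>L lborel (f m) = (if m = n then of_real (sqrt (fact n)) * hk \<tau> \<zeta> n else 0)" for m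
  proof -
    have "f m = (\<lambda>w. hk \<tau> \<zeta> m / of_real (sqrt (fact m)) * (w ^ n * cnj w ^ m * gweight w))"
      by (auto simp: f_def)
    then have "integral\<^sup>L lborel (f m) = hk \<tau> \<zeta> m / of_real (sqrt (fact m)) * (if n = m then fact n else 0)"
      by (simp only: integral_mult_right_zero monomial_orthogonality)
    moreover have "(fact n :: complex) = of_real (sqrt (fact n)) * of_real (sqrt (fact n))"
      unfolding of_real_mult[symmetric] real_sqrt_mult_self by simp
    ultimately show ?thesis by auto
  qed
  ultimately have "(\<lambda>m. if m = n then of_real (sqrt (fact n)) * hk \<tau> \<zeta> n else 0) sums
    (\<integral>w. exp (- \<tau> / 2 * (cnj w)\<^sup>2 + \<zeta> * cnj w) * w ^ n * gweight w \<partial>lborel)" by simp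
  from sums_unique2[OF this sums_single] show ?thesis .
qed

text \<open>Membership of \<open>fock c\<close> in the Segal-Bargmann space is replaced by the
  absolute bound exp((1 + \<epsilon>) |w|^2 / 2) on its series; the kernel grows only like
  exp(|\<tau>| |w|^2 / 2) up to a linear exponent, so the Gaussian weight still wins.\<close>

lemma heat_integral:
  assumes c: "subexp c" and t: "norm \<tau> < 1"
  shows "integrable lborel (\<lambda>w. exp (- \<tau> / 2 * (cnj w)\<^sup>2 + \<zeta> * cnj w) * fock c w * gweight w)"
    and "heat \<tau> (fock c) \<zeta> = (\<integral>w. exp (- \<tau> / 2 * (cnj w)\<^sup>2 + \<zeta> * cnj w) * fock c w * gweight w \<partial>lborel)"
proof -
  define E where "E w = exp (- \<tau> / 2 * (cnj w)\<^sup>2 + \<zeta> * cnj w)" for w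
  define f where "f n w = c n * w ^ n / of_real (sqrt (fact n)) * (E w * gweight w)" for n w
  \<comment> \<open>Half of the gap 1 - |\<tau>| goes to the growth of \<open>fock c\<close>; the
    other half leaves the decay exp(-\<epsilon> |w|^2 / 2).\<close>
  define T Z \<epsilon> where "T = norm \<tau>" and "Z = norm \<zeta>" and "\<epsilon> = (1 - norm \<tau>) / 2"
  have TZ: "0 \<le> T" "0 \<le> Z" "T < 1" "0 < \<epsilon>" using t by (auto simp: T_def Z_def \<epsilon>_def)
  obtain C where C: "0 \<le> C"
    "\<And>r. 0 \<le> r \<Longrightarrow> summable (\<lambda>n. norm (c n) * r ^ n / sqrt (fact n))"
    "\<And>r. 0 \<le> r \<Longrightarrow> (\<Sum>n. norm (c n) * r ^ n / sqrt (fact n)) \<le> C * exp ((1 + \<epsilon>) * r\<^sup>2 / 2)"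
    using fock_abs_bound[OF c TZ(4)] by blast
  have nf: "(\<lambda>n. norm (f n w)) = (\<lambda>n. norm (c n) * norm w ^ n / sqrt (fact n) * norm (E w * gweight w))" for w
    by (auto simp: f_def norm_mult norm_divide norm_power)
  have s: "summable (\<lambda>n. norm (f n w))" for w
    unfolding nf by (intro summable_mult2 C) simp
  have Em [measurable]: "E \<in> borel_measurable borel"
    unfolding E_def by (intro borel_measurable_continuous_onI continuous_intros)
  have g: "integrable lborel (\<lambda>w::complex. C * exp (Z * norm w - \<epsilon> / 2 * (norm w)\<^sup>2))"
    using TZ by (intro integrable_mult_right integrable_exp_norm) auto
  have m: "f n \<in> borel_measurable lborel" for n unfolding f_def measurable_lborel2 by measurable
  have le: "(\<Sum>n. norm (f n w)) \<le> C * exp (Z * norm w - \<epsilon> / 2 * (norm w)\<^sup>2)" for w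
  proof -
    have "(\<Sum>n. norm (f n w)) = (\<Sum>n. norm (c n) * norm w ^ n / sqrt (fact n)) * norm (E w * gweight w)"
      unfolding nf by (intro suminf_mult2[symmetric] C) simp
    also have "\<dots> \<le> (C * exp ((1 + \<epsilon>) * (norm w)\<^sup>2 / 2)) *
        (exp (T / 2 * (norm w)\<^sup>2 + Z * norm w) * (exp (- (cmod w)\<^sup>2) / 1))"
      unfolding norm_mult norm_gweight E_def T_def Z_def using pi_gt3 C(1)
      by (intro mult_mono norm_heat_kernel_le divide_left_mono C(3)) auto
    also have "\<dots> = C * (exp ((1 + \<epsilon>) * (norm w)\<^sup>2 / 2) * exp (T / 2 * (norm w)\<^sup>2 + Z * norm w) * exp (- (cmod w)\<^sup>2))"
      by simp
    also have "\<dots> = C * exp ((1 + \<epsilon>) * (norm w)\<^sup>2 / 2 + (T / 2 * (norm w)\<^sup>2 + Z * norm w) + - (cmod w)\<^sup>2)"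
      unfolding exp_add[symmetric] ..
    also have "(1 + \<epsilon>) * (norm w)\<^sup>2 / 2 + (T / 2 * (norm w)\<^sup>2 + Z * norm w) + - (cmod w)\<^sup>2 =
        Z * norm w - \<epsilon> / 2 * (norm w)\<^sup>2"
      by (simp add: \<epsilon>_def T_def field_simps)
    finally show ?thesis .
  qed
  have F: "(\<Sum>n. f n w) = E w * fock c w * gweight w" for w
    using sums_mult2[OF summable_sums[OF summable_norm_cancel[OF fock_summable[OF c, of w]]], of "E w * gweight w"]
    by (simp add: sums_iff f_def fock_def mult_ac)
  show "integrable lborel (\<lambda>w. exp (- \<tau> / 2 * (cnj w)\<^sup>2 + \<zeta> * cnj w) * fock c w * gweight w)"
    using integral_sums_dominated(2)[OF m g s le] unfolding F E_def .
  have "integral\<^sup>L lborel (f n) = c n * hk \<tau> \<zeta> n" for n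
  proof -
    have "f n = (\<lambda>w. c n / of_real (sqrt (fact n)) * (E w * w ^ n * gweight w))"
      by (auto simp: f_def)
    then have "integral\<^sup>L lborel (f n) = c n / of_real (sqrt (fact n)) * (of_real (sqrt (fact n)) * hk \<tau> \<zeta> n)"
      unfolding E_def by (simp only: integral_mult_right_zero hk_integral[OF t])
    then show ?thesis by simp
  qed
  then have "(\<lambda>n. c n * hk \<tau> \<zeta> n) sums (\<integral>w. E w * fock c w * gweight w \<partial>lborel)"
    using integral_sums_dominated(3)[OF m g s le] unfolding F by simp
  then show "heat \<tau> (fock c) \<zeta> = (\<integral>w. exp (- \<tau> / 2 * (cnj w)\<^sup>2 + \<zeta> * cnj w) * fock c w * gweight w \<partial>lborel)"
    using heat_fock(2)[OF c t] by (simp add: sums_iff E_def)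
qed

text \<open>Cauchy's estimate on all circles feeds \<open>coef_growth\<close>. Translates are shown
  to have subexponential coefficients through this growth criterion, without computing those
  coefficients.\<close>

lemma entire_eq_fock:
  assumes hol: "F holomorphic_on UNIV"
    and bd: "\<And>\<epsilon>. 0 < \<epsilon> \<Longrightarrow> \<exists>C. \<forall>z. norm (F z) \<le> C * exp ((1 + \<epsilon>) * (norm z)\<^sup>2 / 2)"
  shows "\<exists>c. subexp c \<and> F = fock c"
proof (intro exI conjI)
  define c where "c n = of_real (sqrt (fact n)) * ((deriv ^^ n) F 0 / fact n)" for n
  show "subexp c"
  proof (rule subexpI)
    fix t :: real assume t: "1 < t"
    \<comment> \<open>Then 1 + \<epsilon> is the midpoint between 1 and t^2, strictly below the
      value t^2 taken for \<rho> in \<open>coef_growth\<close>.\<close>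
    define \<epsilon> where "\<epsilon> = (t\<^sup>2 - 1) / 2"
    have "1 < t\<^sup>2" using t by (simp add: one_less_power)
    then have \<epsilon>: "0 < \<epsilon>" "1 + \<epsilon> < t\<^sup>2" by (auto simp: \<epsilon>_def field_simps)
    obtain C where C: "\<And>z. norm (F z) \<le> C * exp ((1 + \<epsilon>) * (norm z)\<^sup>2 / 2)" using bd[OF \<epsilon>(1)] by blast
    have C0: "0 \<le> C" using C[of 0] order_trans[OF norm_ge_zero] by fastforce
    have "norm (c n) \<le> C / sqrt (1 - (1 + \<epsilon>) / t\<^sup>2) * sqrt (t\<^sup>2) ^ n" for n
    proof (rule coef_growth)
      fix x :: real assume x: "0 \<le> x"
      show "norm (c n) * x ^ n / sqrt (fact n) \<le> C * exp ((1 + \<epsilon>) * x\<^sup>2 / 2)"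
      proof (cases "x = 0")
        case True
        have "norm (F 0) \<le> C" using C[of 0] by simp
        then show ?thesis using True C0 by (cases n) (auto simp: c_def)
      next
        case False
        with x have x: "0 < x" by simp
        have "norm ((deriv ^^ n) F 0) \<le> fact n * (C * exp ((1 + \<epsilon>) * x\<^sup>2 / 2)) / x ^ n"
        proof (rule Cauchy_inequality)
          show "F holomorphic_on ball 0 x" using hol by (rule holomorphic_on_subset) simp
          show "continuous_on (cball 0 x) F"
            using hol by (meson holomorphic_on_imp_continuous_on holomorphic_on_subset subset_UNIV)
          show "norm (F y) \<le> C * exp ((1 + \<epsilon>) * x\<^sup>2 / 2)" if "norm (0 - y) = x" for y
            using C[of y] that by simp
        qed (use x in auto)
        then have "norm ((deriv ^^ n) F 0) / fact n * x ^ n \<le> C * exp ((1 + \<epsilon>) * x\<^sup>2 / 2)"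
          using x by (simp add: field_simps)
        then show ?thesis by (simp add: c_def norm_mult norm_divide)
      qed
    qed (use \<epsilon> in auto)
    then show "\<exists>K. \<forall>n. norm (c n) \<le> K * t ^ n"
      using t by (intro exI[of _ "C / sqrt (1 - (1 + \<epsilon>) / t\<^sup>2)"]) simp
  qed
  show "F = fock c"
  proof
    fix z
    have "(\<lambda>n. (deriv ^^ n) F 0 / fact n * (z - 0) ^ n) sums F z"
      by (rule holomorphic_power_series[of _ _ "norm z + 1"])
        (use hol in \<open>auto intro: holomorphic_on_subset\<close>)
    moreover have "(deriv ^^ n) F 0 / fact n * (z - 0) ^ n = c n * z ^ n / of_real (sqrt (fact n))" for n
      by (simp add: c_def)
    ultimately show "F z = fock c z" by (simp add: fock_def sums_iff)
  qed
qed

section \<open>Weyl translations of the Segal-Bargmann space\<close>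

definition trans_op :: "complex \<Rightarrow> (complex \<Rightarrow> complex) \<Rightarrow> complex \<Rightarrow> complex" where
  "trans_op a F z = exp (z * cnj a - of_real ((norm a)\<^sup>2) / 2) * F (z - a)"

lemma trans_op_0 [simp]: "trans_op 0 F = F"
  by (simp add: trans_op_def fun_eq_iff)

lemma trans_op_inverse: "trans_op a (trans_op (- a) F) = F"
proof
  fix z
  have "(z * cnj a - of_real ((norm a)\<^sup>2) / 2) + ((z - a) * cnj (- a) - of_real ((norm (- a))\<^sup>2) / 2) = 0"
    unfolding complex_norm_square by (simp add: algebra_simps)
  then have "exp (z * cnj a - of_real ((norm a)\<^sup>2) / 2) * exp ((z - a) * cnj (- a) - of_real ((norm (- a))\<^sup>2) / 2) = 1"
    unfolding exp_add[symmetric] by simp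
  then show "trans_op a (trans_op (- a) F) z = F z"
    unfolding trans_op_def mult.assoc[symmetric] by simp
qed

lemma trans_op_fock:
  assumes "subexp c" shows "\<exists>c'. subexp c' \<and> trans_op a (fock c) = fock c'"
proof (rule entire_eq_fock)
  show "trans_op a (fock c) holomorphic_on UNIV"
  proof -
    have "fock c \<circ> (\<lambda>z. z - a) holomorphic_on UNIV"
      by (intro holomorphic_on_compose holomorphic_intros fock_holomorphic assms)
    then show ?thesis unfolding trans_op_def by (intro holomorphic_intros) (simp add: o_def)
  qed
  fix \<epsilon> :: real assume e: "0 < \<epsilon>"
  \<comment> \<open>Half of \<epsilon> is granted to \<open>fock c\<close>; the other half absorbs
    the linear term with coefficient \<open>b\<close>, which the shift and the exponential factor
    create.\<close>
  define d where "d = \<epsilon> / 2"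
  have d: "0 < d" using e by (simp add: d_def)
  obtain C where C: "0 \<le> C" "\<And>z. norm (fock c z) \<le> C * exp ((1 + d) * (norm z)\<^sup>2 / 2)"
    using fock_bound[OF assms d] by blast
  define A where "A = norm a"
  define b where "b = A + (1 + d) * A"
  have "norm (trans_op a (fock c) z) \<le> (C * exp ((1 + d) * A\<^sup>2 / 2 + b\<^sup>2 / (2 * d))) * exp ((1 + \<epsilon>) * (norm z)\<^sup>2 / 2)" for z
  proof -
    let ?r = "norm z"
    have 1: "norm (exp (z * cnj a - of_real ((norm a)\<^sup>2) / 2)) \<le> exp (A * ?r)"
    proof -
      have "Re (z * cnj a) \<le> A * ?r" using complex_Re_le_cmod[of "z * cnj a"] by (simp add: norm_mult A_def mult.commute)
      then show ?thesis unfolding norm_exp_eq_Re by (simp add: order_trans[rotated])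
    qed
    have "norm (z - a) \<le> ?r + A" unfolding A_def by (rule norm_triangle_ineq4)
    then have "(1 + d) * (norm (z - a))\<^sup>2 / 2 \<le> (1 + d) * (?r + A)\<^sup>2 / 2"
      using d by (intro divide_right_mono mult_left_mono power_mono) auto
    then have 2: "norm (fock c (z - a)) \<le> C * exp ((1 + d) * (?r + A)\<^sup>2 / 2)"
      using C by (meson order_trans mult_left_mono exp_le_cancel_iff)
    have "norm (trans_op a (fock c) z) \<le> exp (A * ?r) * (C * exp ((1 + d) * (?r + A)\<^sup>2 / 2))"
      unfolding trans_op_def norm_mult by (intro mult_mono 1 2) auto
    also have "\<dots> = C * exp (A * ?r + (1 + d) * (?r + A)\<^sup>2 / 2)" by (simp add: exp_add)
    also have "A * ?r + (1 + d) * (?r + A)\<^sup>2 / 2 \<le> ((1 + d) * A\<^sup>2 / 2 + b\<^sup>2 / (2 * d)) + (1 + \<epsilon>) * ?r\<^sup>2 / 2"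
    proof -
      have "A * ?r + (1 + d) * (?r + A)\<^sup>2 / 2 = (1 + d) * A\<^sup>2 / 2 + b * ?r + (1 + d) * ?r\<^sup>2 / 2"
        by (simp add: b_def power2_eq_square field_simps)
      moreover have "b * ?r \<le> b\<^sup>2 / (2 * d) + d * ?r\<^sup>2 / 2"
      proof -
        have "0 \<le> (b - d * ?r)\<^sup>2 / (2 * d)" using d by auto
        also have "\<dots> = b\<^sup>2 / (2 * d) - b * ?r + d * ?r\<^sup>2 / 2"
          using d by (simp add: power2_eq_square field_simps)
        finally show ?thesis by simp
      qed
      moreover have "(1 + \<epsilon>) * ?r\<^sup>2 / 2 = (1 + d) * ?r\<^sup>2 / 2 + d * ?r\<^sup>2 / 2" by (simp add: d_def field_simps)
      ultimately show ?thesis by linarith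
    qed
    then have "C * exp (A * ?r + (1 + d) * (?r + A)\<^sup>2 / 2) \<le>
       C * exp (((1 + d) * A\<^sup>2 / 2 + b\<^sup>2 / (2 * d)) + (1 + \<epsilon>) * ?r\<^sup>2 / 2)"
      using C by (intro mult_left_mono) auto
    finally show ?thesis by (simp add: exp_add)
  qed
  then show "\<exists>C. \<forall>z. norm (trans_op a (fock c) z) \<le> C * exp ((1 + \<epsilon>) * (norm z)\<^sup>2 / 2)" by blast
qed

lemma integral_lborel_shift:
  fixes f :: "complex \<Rightarrow> complex"
  assumes [measurable]: "f \<in> borel_measurable borel"
  shows "integral\<^sup>L lborel f = (\<integral>w. f (a + w) \<partial>lborel)"
  by (subst lborel_distr_plus[of a, symmetric], subst integral_distr) auto

text \<open>After w is replaced by a + w, the terms w cnj a of the translation factor and of the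
  Gaussian weight cancel. What is left is linear in \<open>cnj w\<close> and only moves the
  evaluation point, by a from the weight and by \<tau> cnj a from the quadratic kernel.\<close>

lemma heat_trans_op:
  assumes c: "subexp c" and t: "norm \<tau> < 1"
  shows "heat \<tau> (trans_op a (fock c)) \<zeta> =
    exp (\<zeta> * cnj a - \<tau> / 2 * (cnj a)\<^sup>2 - of_real ((norm a)\<^sup>2) / 2) * heat \<tau> (fock c) (\<zeta> - a - \<tau> * cnj a)"
proof -
  obtain c' where c': "subexp c'" "trans_op a (fock c) = fock c'" using trans_op_fock[OF c] by blast
  define f where "f w = exp (- \<tau> / 2 * (cnj w)\<^sup>2 + \<zeta> * cnj w) * fock c' w * gweight w" for w
  have [measurable]: "fock c' \<in> borel_measurable borel" by (rule fock_measurable[OF c'(1)])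
  have m: "f \<in> borel_measurable borel" unfolding f_def by measurable
  have f: "f (a + w) = exp (\<zeta> * cnj a - \<tau> / 2 * (cnj a)\<^sup>2 - of_real ((norm a)\<^sup>2) / 2) *
      (exp (- \<tau> / 2 * (cnj w)\<^sup>2 + (\<zeta> - a - \<tau> * cnj a) * cnj w) * fock c w * gweight w)" for w
  proof -
    have n: "complex_of_real ((norm (a + w))\<^sup>2) = (a + w) * (cnj a + cnj w)"
       "complex_of_real ((norm a)\<^sup>2) = a * cnj a" "complex_of_real ((norm w)\<^sup>2) = w * cnj w"
      by (simp_all only: complex_norm_square complex_cnj_add)
    have g: "gweight u = exp (- of_real ((norm u)\<^sup>2)) / of_real pi" for u
      by (simp add: gweight_def exp_of_real[symmetric])
    have "f (a + w) = exp (- \<tau> / 2 * (cnj a + cnj w)\<^sup>2 + \<zeta> * (cnj a + cnj w)) *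
       (exp ((a + w) * cnj a - a * cnj a / 2) * fock c w) * (exp (- ((a + w) * (cnj a + cnj w))) / of_real pi)"
      unfolding f_def c'(2)[symmetric] trans_op_def g n by simp
    also have "\<dots> = exp ((- \<tau> / 2 * (cnj a + cnj w)\<^sup>2 + \<zeta> * (cnj a + cnj w)) +
        ((a + w) * cnj a - a * cnj a / 2) + - ((a + w) * (cnj a + cnj w))) * fock c w / of_real pi"
      unfolding exp_add by simp
    also have "(- \<tau> / 2 * (cnj a + cnj w)\<^sup>2 + \<zeta> * (cnj a + cnj w)) +
        ((a + w) * cnj a - a * cnj a / 2) + - ((a + w) * (cnj a + cnj w)) =
       (\<zeta> * cnj a - \<tau> / 2 * (cnj a)\<^sup>2 - a * cnj a / 2) +
       ((- \<tau> / 2 * (cnj w)\<^sup>2 + (\<zeta> - a - \<tau> * cnj a) * cnj w) + - (w * cnj w))"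
      by (simp add: power2_eq_square field_simps)
    finally show ?thesis unfolding g n exp_add by simp
  qed
  have "heat \<tau> (trans_op a (fock c)) \<zeta> = integral\<^sup>L lborel f"
    unfolding c'(2) f_def[abs_def] by (rule heat_integral(2)[OF c'(1) t])
  also have "\<dots> = (\<integral>w. f (a + w) \<partial>lborel)" by (rule integral_lborel_shift[OF m])
  finally show ?thesis unfolding f integral_mult_right_zero heat_integral(2)[OF c t] .
qed


subsection \<open>Joint characteristic functions determine the law\<close>

lemma integrable_bounded_prob:
  fixes f :: "'a \<Rightarrow> complex"
  assumes "prob_space M" "f \<in> borel_measurable M" "\<And>x. norm (f x) \<le> B"
  shows "integrable M f"
proof -
  interpret prob_space M by fact
  show ?thesis by (rule integrable_const_bound[of _ B]) (use assms in auto)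
qed

text \<open>Divided by their common mass the weights are probability densities, so Levy uniqueness
  applies to the image measures on the line. The lower bound 1 keeps that mass positive.\<close>

lemma Levy_weighted_pos:
  fixes U :: "'a \<Rightarrow> real" and V :: "'b \<Rightarrow> real" and g :: "'a \<Rightarrow> real" and k :: "'b \<Rightarrow> real"
  assumes M: "prob_space M" and N: "prob_space N"
    and U [measurable]: "U \<in> borel_measurable M" and V [measurable]: "V \<in> borel_measurable N"
    and g [measurable]: "g \<in> borel_measurable M" and k [measurable]: "k \<in> borel_measurable N"
    and gb: "\<And>x. 1 \<le> g x \<and> g x \<le> 3" and kb: "\<And>x. 1 \<le> k x \<and> k x \<le> 3"
    and eq: "\<And>t. (\<integral>x. iexp (t * U x) * of_real (g x) \<partial>M) = (\<integral>x. iexp (t * V x) * of_real (k x) \<partial>N)"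
    and B [measurable]: "B \<in> sets borel"
  shows "(\<integral>x. indicator B (U x) * g x \<partial>M) = (\<integral>x. indicator B (V x) * k x \<partial>N)"
proof -
  define m where "m = (\<integral>x. g x \<partial>M)"
  \<comment> \<open>Frequency 0 shows that both weights have the same mass, so one normalising
    constant serves both sides.\<close>
  have mk: "m = (\<integral>x. k x \<partial>N)"
  proof -
    have "complex_of_real m = of_real (\<integral>x. k x \<partial>N)"
      using eq[of 0] by (simp add: m_def)
    then show ?thesis by simp
  qed
  have dens: "real_distribution (distr (density P (\<lambda>x. ennreal (h x / m))) borel W)"
      and chr: "char (distr (density P (\<lambda>x. ennreal (h x / m))) borel W) t = (\<integral>x. iexp (t * W x) * of_real (h x) \<partial>P) / of_real m"
      and mea: "measure (distr (density P (\<lambda>x. ennreal (h x / m))) borel W) B = (\<integral>x. indicator B (W x) * h x \<partial>P) / m"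
      and m1: "1 \<le> m"
    if P: "prob_space P" and W [measurable]: "W \<in> borel_measurable P" and h [measurable]: "h \<in> borel_measurable P"
      and hb: "\<And>x. 1 \<le> h x \<and> h x \<le> 3" and m: "m = (\<integral>x. h x \<partial>P)"
    for P :: "'c measure" and W h t
  proof -
    interpret P: prob_space P by fact
    have "norm (h x) \<le> 3" for x using hb[of x] by auto
    then have hi: "integrable P h" by (intro P.integrable_const_bound[of _ 3]) auto
    have "(\<integral>x. 1 \<partial>P) \<le> (\<integral>x. h x \<partial>P)" by (rule integral_mono) (use hi hb in auto)
    then show m1: "1 \<le> m" using m by (simp add: P.prob_space)
    have h0: "0 \<le> h x / m" for x using m1 hb[of x] by auto
    have "emeasure (density P (\<lambda>x. ennreal (h x / m))) (space P) = ennreal (\<integral>x. h x / m \<partial>P)"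
    proof -
      have "emeasure (density P (\<lambda>x. ennreal (h x / m))) (space P) = (\<integral>\<^sup>+ x. ennreal (h x / m) \<partial>P)"
        by (subst emeasure_density) (auto intro!: nn_integral_cong)
      also have "\<dots> = ennreal (\<integral>x. h x / m \<partial>P)"
        by (rule nn_integral_eq_integral) (use hi h0 in auto)
      finally show ?thesis .
    qed
    also have "\<dots> = 1" using m m1 by simp
    finally interpret D: prob_space "density P (\<lambda>x. ennreal (h x / m))" by (intro prob_spaceI) simp
    show rd: "real_distribution (distr (density P (\<lambda>x. ennreal (h x / m))) borel W)"
      by (rule D.real_distribution_distr) simp
    show "char (distr (density P (\<lambda>x. ennreal (h x / m))) borel W) t = (\<integral>x. iexp (t * W x) * of_real (h x) \<partial>P) / of_real m"
    proof -
      have "char (distr (density P (\<lambda>x. ennreal (h x / m))) borel W) t = (\<integral>x. (h x / m) *\<^sub>R iexp (t * W x) \<partial>P)"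
        unfolding char_def using h0 by (subst integral_distr, simp, simp, subst integral_density) auto
      also have "\<dots> = (\<integral>x. iexp (t * W x) * of_real (h x) / of_real m \<partial>P)"
        by (simp add: scaleR_conv_of_real mult.commute)
      finally show ?thesis by simp
    qed
    interpret DD: real_distribution "distr (density P (\<lambda>x. ennreal (h x / m))) borel W" by fact
    have "measure (distr (density P (\<lambda>x. ennreal (h x / m))) borel W) B =
       (\<integral>x. indicator B x \<partial>distr (density P (\<lambda>x. ennreal (h x / m))) borel W)"
      by simp
    also have "\<dots> = (\<integral>x. (h x / m) *\<^sub>R indicator B (W x) \<partial>P)"
      using h0 by (subst integral_distr, simp, simp, subst integral_density) auto
    finally show "measure (distr (density P (\<lambda>x. ennreal (h x / m))) borel W) B = (\<integral>x. indicator B (W x) * h x \<partial>P) / m"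
      by (simp add: mult.commute)
  qed
  have "distr (density M (\<lambda>x. ennreal (g x / m))) borel U = distr (density N (\<lambda>x. ennreal (k x / m))) borel V"
    by (intro Levy_uniqueness dens[OF M U g gb m_def] dens[OF N V k kb mk] ext)
      (simp only: chr[OF M U g gb m_def] chr[OF N V k kb mk] eq)
  then show ?thesis
    using mea[OF M U g gb m_def] mea[OF N V k kb mk] m1[OF M U g gb m_def] by simp
qed

text \<open>Levy's theorem is applied to the densities \<open>2 + Re (c * h)\<close>, which are bounded away from \<open>0\<close>.\<close>

lemma Levy_weighted:
  fixes U :: "'a \<Rightarrow> real" and V :: "'b \<Rightarrow> real" and h :: "'a \<Rightarrow> complex" and k :: "'b \<Rightarrow> complex"
  assumes M: "prob_space M" and N: "prob_space N"
    and U [measurable]: "U \<in> borel_measurable M" and V [measurable]: "V \<in> borel_measurable N"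
    and h [measurable]: "h \<in> borel_measurable M" and k [measurable]: "k \<in> borel_measurable N"
    and hb: "\<And>x. norm (h x) \<le> 1" and kb: "\<And>x. norm (k x) \<le> 1"
    and eq: "\<And>t. (\<integral>x. iexp (t * U x) * h x \<partial>M) = (\<integral>x. iexp (t * V x) * k x \<partial>N)"
    and eq1: "\<And>t. (\<integral>x. iexp (t * U x) \<partial>M) = (\<integral>x. iexp (t * V x) \<partial>N)"
    and B [measurable]: "B \<in> sets borel"
  shows "(\<integral>x. indicator B (U x) * h x \<partial>M) = (\<integral>x. indicator B (V x) * k x \<partial>N)"
proof -
  interpret M: prob_space M by fact
  interpret N: prob_space N by fact
  have key: "(\<integral>x. indicator B (U x) * Re (c * h x) \<partial>M) = (\<integral>x. indicator B (V x) * Re (c * k x) \<partial>N)"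
    if c: "norm c \<le> 1" for c :: complex
  proof -
    have chb: "norm (c * h x) \<le> 1" "norm (c * k y) \<le> 1" for x y
      using c hb[of x] kb[of y] by (auto simp: norm_mult intro!: mult_le_one)
    have bd: "1 \<le> 2 + Re (c * h x) \<and> 2 + Re (c * h x) \<le> 3" "1 \<le> 2 + Re (c * k y) \<and> 2 + Re (c * k y) \<le> 3" for x y
      using abs_Re_le_cmod[of "c * h x"] abs_Re_le_cmod[of "c * k y"] chb(1)[of x] chb(2)[of y] by linarith+
    \<comment> \<open>Re(c f) is half the sum of c f and its conjugate, and conjugation reverses the
      frequency; hence the hypothesis is used at t and at -t.\<close>
    have expand: "(\<integral>x. iexp (t * W x) * of_real (2 + Re (c * f x)) \<partial>P) =
        2 * (\<integral>x. iexp (t * W x) \<partial>P) + c * (\<integral>x. iexp (t * W x) * f x \<partial>P) / 2 +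
        cnj (c * (\<integral>x. iexp (- t * W x) * f x \<partial>P)) / 2"
      if P: "prob_space P" and W [measurable]: "W \<in> borel_measurable P" and f [measurable]: "f \<in> borel_measurable P"
        and fb: "\<And>x. norm (f x) \<le> 1" for P :: "'c measure" and W f t
    proof -
      have i1: "integrable P (\<lambda>x. iexp (t * W x))" for t
        by (rule integrable_bounded_prob[OF P, of _ 1]) auto
      have i2: "integrable P (\<lambda>x. iexp (t * W x) * f x)" for t
        by (rule integrable_bounded_prob[OF P, of _ 1]) (auto simp: norm_mult fb)
      have "iexp (t * W x) * of_real (2 + Re (c * f x)) =
          2 * iexp (t * W x) + (c * (iexp (t * W x) * f x) / 2 + cnj (c * (iexp (- t * W x) * f x)) / 2)" for x
      proof -
        have r: "of_real (Re z) = (z + cnj z) / 2" for z by (simp add: complex_eq_iff)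
        have gen: "E * of_real (2 + Re z) = 2 * E + (E * z / 2 + cnj (E' * z) / 2)" if "cnj E' = E" for E E' z
          using that by (simp add: r algebra_simps add_divide_distrib)
        have "cnj (iexp (- t * W x)) = iexp (t * W x)" by (simp add: exp_cnj)
        from gen[OF this, of "c * f x"] show ?thesis
          by (simp only: mult.left_commute[of c])
      qed
      then have "(\<integral>x. iexp (t * W x) * of_real (2 + Re (c * f x)) \<partial>P) =
        (\<integral>x. 2 * iexp (t * W x) + (c * (iexp (t * W x) * f x) / 2 + cnj (c * (iexp (- t * W x) * f x)) / 2) \<partial>P)"
        by (simp only:)
      also have "\<dots> = (\<integral>x. 2 * iexp (t * W x) \<partial>P) + ((\<integral>x. c * (iexp (t * W x) * f x) / 2 \<partial>P) + (\<integral>x. cnj (c * (iexp (- t * W x) * f x)) / 2 \<partial>P))"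
        by (subst Bochner_Integration.integral_add, intro integrable_mult_right i1,
            intro Bochner_Integration.integrable_add integrable_divide integrable_mult_right integrable_cnj i2,
            subst Bochner_Integration.integral_add,
            intro integrable_divide integrable_mult_right i2,
            intro integrable_divide integrable_cnj integrable_mult_right i2) simp
      also have "(\<integral>x. cnj (c * (iexp (- t * W x) * f x)) / 2 \<partial>P) = cnj (c * (\<integral>x. iexp (- t * W x) * f x \<partial>P)) / 2"
        by (simp only: integral_divide_zero Bochner_Integration.integral_cnj integral_mult_right_zero)
      finally show ?thesis by (simp only: integral_divide_zero integral_mult_right_zero add.assoc)
    qed
    have 1: "(\<integral>x. indicator B (U x) * (2 + Re (c * h x)) \<partial>M) = (\<integral>x. indicator B (V x) * (2 + Re (c * k x)) \<partial>N)"
      by (rule Levy_weighted_pos[OF M N U V _ _ bd]) (auto simp only: expand[OF M U h hb] expand[OF N V k kb] eq eq1, measurable)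
    \<comment> \<open>The constant weight 2 is treated separately so that it can be subtracted,
      leaving the weight Re(c h).\<close>
    have 2: "(\<integral>x. indicator B (U x) * (2 :: real) \<partial>M) = (\<integral>x. indicator B (V x) * 2 \<partial>N)"
      by (rule Levy_weighted_pos[OF M N U V]) (use eq1 in auto)
    have split: "(\<integral>x. indicator B (W x) * (2 + Re (c * f x)) \<partial>P) =
        (\<integral>x. indicator B (W x) * 2 \<partial>P) + (\<integral>x. indicator B (W x) * Re (c * f x) \<partial>P)"
      if P: "prob_space P" and W [measurable]: "W \<in> borel_measurable P" and f [measurable]: "f \<in> borel_measurable P"
        and fb: "\<And>x. norm (c * f x) \<le> 1" for P :: "'c measure" and W f
    proof -
      interpret prob_space P by fact
      have "integrable P (\<lambda>x. indicator B (W x) * 2 :: real)"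
        by (rule integrable_const_bound[of _ 2]) (auto simp: indicator_def)
      moreover have "integrable P (\<lambda>x. indicator B (W x) * Re (c * f x))"
        by (rule integrable_const_bound[of _ 1])
          (auto simp: indicator_def simp del: times_complex.sel intro!: order_trans[OF abs_Re_le_cmod fb])
      ultimately show ?thesis unfolding distrib_left by (rule Bochner_Integration.integral_add)
    qed
    show ?thesis using 1 2 split[OF M U h chb(1)] split[OF N V k chb(2)] by simp
  qed
  \<comment> \<open>The choices c = 1 and c = -\<i> recover real and imaginary parts.\<close>
  have ri: "(\<integral>x. indicator B (W x) * f x \<partial>P) =
      Complex (\<integral>x. indicator B (W x) * Re (1 * f x) \<partial>P) (\<integral>x. indicator B (W x) * Re (- \<i> * f x) \<partial>P)"
    if P: "prob_space P" and W [measurable]: "W \<in> borel_measurable P" and f [measurable]: "f \<in> borel_measurable P"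
      and fb: "\<And>x. norm (f x) \<le> 1" for P :: "'c measure" and W :: "'c \<Rightarrow> real" and f :: "'c \<Rightarrow> complex"
  proof -
    have i: "integrable P (\<lambda>x. indicator B (W x) * f x)"
      by (rule integrable_bounded_prob[OF P, of _ 1]) (auto simp: indicator_def fb)
    have "Re (indicator B (W x) * f x) = indicator B (W x) * Re (1 * f x)"
        "Im (indicator B (W x) * f x) = indicator B (W x) * Re (- \<i> * f x)" for x
      by (auto simp: indicator_def)
    then show ?thesis
      using integral_Re[OF i] integral_Im[OF i] by (simp only: complex_eq_iff complex.sel)
  qed
  show ?thesis unfolding ri[OF M U h hb] ri[OF N V k kb]
    using key[of 1] key[of "- \<i>"] by (simp only: norm_one norm_minus_cancel norm_ii order_refl)
qed

text \<open>A multivariate uniqueness theorem from the one-dimensional one. The frequency of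
  coordinate i is arbitrary, so \<open>Levy_weighted\<close> trades its exponential for an
  indicator, one coordinate per induction step, while the coordinates in \<open>K\<close> keep their
  exponentials.\<close>

lemma cylinder_expectation_eq:
  fixes U :: "'i \<Rightarrow> 'a \<Rightarrow> real" and V :: "'i \<Rightarrow> 'b \<Rightarrow> real"
  assumes M: "prob_space M" and N: "prob_space N"
    and U [measurable]: "\<And>i. U i \<in> borel_measurable M" and V [measurable]: "\<And>i. V i \<in> borel_measurable N"
    and eq: "\<And>J t. finite J \<Longrightarrow> (\<integral>x. iexp (\<Sum>j\<in>J. t j * U j x) \<partial>M) = (\<integral>x. iexp (\<Sum>j\<in>J. t j * V j x) \<partial>N)"
    and I: "finite I" and B [measurable]: "\<And>i. B i \<in> sets borel" and K: "finite K" "I \<inter> K = {}"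
  shows "(\<integral>x. (\<Prod>i\<in>I. indicator (B i) (U i x)) * iexp (\<Sum>j\<in>K. t j * U j x) \<partial>M) =
     (\<integral>x. (\<Prod>i\<in>I. indicator (B i) (V i x)) * iexp (\<Sum>j\<in>K. t j * V j x) \<partial>N)"
  using I K
proof (induction I arbitrary: K t rule: finite_induct)
  case empty
  then show ?case using eq by simp
next
  case (insert i I)
  define h where "h x = (\<Prod>i\<in>I. indicator (B i) (U i x)) * iexp (\<Sum>j\<in>K. t j * U j x)" for x
  define k where "k x = (\<Prod>i\<in>I. indicator (B i) (V i x)) * iexp (\<Sum>j\<in>K. t j * V j x)" for x
  have pb: "norm (\<Prod>i\<in>I. indicator (B i) (f i) :: complex) \<le> 1" for f :: "'i \<Rightarrow> real"
    unfolding prod_norm[symmetric] by (intro prod_le_1) (auto simp: indicator_def)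
  have "(\<integral>x. indicator (B i) (U i x) * h x \<partial>M) = (\<integral>x. indicator (B i) (V i x) * k x \<partial>N)"
  proof (rule Levy_weighted[OF M N U V])
    show "h \<in> borel_measurable M" "k \<in> borel_measurable N" unfolding h_def k_def by measurable
    show "norm (h x) \<le> 1" "norm (k y) \<le> 1" for x y
      unfolding h_def k_def norm_mult using pb by auto
    fix s
    have "iexp (s * U i x) * h x = (\<Prod>i\<in>I. indicator (B i) (U i x)) * iexp (\<Sum>j\<in>insert i K. (t(i := s)) j * U j x)"
        "iexp (s * V i y) * k y = (\<Prod>i\<in>I. indicator (B i) (V i y)) * iexp (\<Sum>j\<in>insert i K. (t(i := s)) j * V j y)" for x y
      using insert by (auto simp: h_def k_def distrib_left exp_add mult_ac intro!: arg_cong[of _ _ exp] sum.cong)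
    then show "(\<integral>x. iexp (s * U i x) * h x \<partial>M) = (\<integral>x. iexp (s * V i x) * k x \<partial>N)"
      using insert by (simp only:) (intro insert.IH, auto)
    show "(\<integral>x. iexp (s * U i x) \<partial>M) = (\<integral>x. iexp (s * V i x) \<partial>N)"
      using eq[of "{i}" "\<lambda>_. s"] by simp
  qed simp
  then show ?case using insert by (simp add: h_def k_def mult.assoc)
qed

lemma law_eqI_real:
  fixes U :: "'i \<Rightarrow> 'a \<Rightarrow> real" and V :: "'i \<Rightarrow> 'b \<Rightarrow> real"
  assumes M: "prob_space M" and N: "prob_space N"
    and U [measurable]: "\<And>i. U i \<in> borel_measurable M" and V [measurable]: "\<And>i. V i \<in> borel_measurable N"
    and eq: "\<And>J t. finite J \<Longrightarrow> (\<integral>x. iexp (\<Sum>j\<in>J. t j * U j x) \<partial>M) = (\<integral>x. iexp (\<Sum>j\<in>J. t j * V j x) \<partial>N)"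
  shows "distr M (\<Pi>\<^sub>M i\<in>UNIV. borel) (\<lambda>\<omega> i. U i \<omega>) = distr N (\<Pi>\<^sub>M i\<in>UNIV. borel) (\<lambda>\<omega> i. V i \<omega>)"
proof -
  interpret M: prob_space M by fact
  interpret N: prob_space N by fact
  have mU: "(\<lambda>\<omega> i. U i \<omega>) \<in> measurable M (\<Pi>\<^sub>M i\<in>UNIV. borel)" and mV: "(\<lambda>\<omega> i. V i \<omega>) \<in> measurable N (\<Pi>\<^sub>M i\<in>UNIV. borel)"
    by (auto intro!: measurable_PiM_single')
  show ?thesis
  proof (rule measure_eqI_PiM_infinite)
    show "finite_measure (distr M (\<Pi>\<^sub>M i\<in>UNIV. borel) (\<lambda>\<omega> i. U i \<omega>))"
      using mU by (intro prob_space.finite_measure M.prob_space_distr)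
    fix A :: "'i \<Rightarrow> real set" and J :: "'i set"
    assume J: "finite J" and A: "\<And>i. i \<in> J \<Longrightarrow> A i \<in> sets borel"
    \<comment> \<open>Outside \<open>J\<close> nothing is known about \<open>A\<close>; the full
      space makes all \<open>B i\<close> Borel without changing the cylinder.\<close>
    define B where "B i = (if i \<in> J then A i else UNIV)" for i
    have B [measurable]: "B i \<in> sets borel" for i using A by (auto simp: B_def)
    have em: "emeasure (distr P (\<Pi>\<^sub>M i\<in>UNIV. borel) (\<lambda>\<omega> i. W i \<omega>)) (prod_emb UNIV (\<lambda>i. borel) J (Pi\<^sub>E J A)) =
        ennreal (Re (\<integral>x. (\<Prod>i\<in>J. indicator (B i) (W i x)) * iexp (\<Sum>j\<in>{}. 0 * W j x) \<partial>P))"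
      if P: "prob_space P" and W [measurable]: "\<And>i. W i \<in> borel_measurable P" for P :: "'c measure" and W :: "'i \<Rightarrow> 'c \<Rightarrow> real"
    proof -
      interpret P: prob_space P by fact
      have mW: "(\<lambda>\<omega> i. W i \<omega>) \<in> measurable P (\<Pi>\<^sub>M i\<in>UNIV. borel)" by (auto intro!: measurable_PiM_single')
      let ?S = "{x \<in> space P. \<forall>i\<in>J. W i x \<in> B i}"
      have S: "?S \<in> sets P" using J by measurable
      have pe: "prod_emb UNIV (\<lambda>i. borel) J (Pi\<^sub>E J A) \<in> sets (\<Pi>\<^sub>M i\<in>UNIV. borel)"
        using J A by (intro sets_PiM_I) auto
      have "emeasure (distr P (\<Pi>\<^sub>M i\<in>UNIV. borel) (\<lambda>\<omega> i. W i \<omega>)) (prod_emb UNIV (\<lambda>i. borel) J (Pi\<^sub>E J A)) = emeasure P ?S"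
        unfolding emeasure_distr[OF mW pe]
        by (rule arg_cong[where f = "emeasure P"])
          (auto simp: prod_emb_def B_def PiE_iff extensional_def restrict_def)
      also have "\<dots> = ennreal (measure P ?S)" by (simp add: P.emeasure_eq_measure)
      also have "measure P ?S = Re (\<integral>x. of_real (indicator ?S x) \<partial>P)" using S by simp
      also have "(\<integral>x. of_real (indicator ?S x) \<partial>P) = (\<integral>x. (\<Prod>i\<in>J. indicator (B i) (W i x)) * iexp (\<Sum>j\<in>{}. 0 * W j x) \<partial>P :: complex)"
        using J by (intro Bochner_Integration.integral_cong) (auto simp: indicator_def prod_zero_iff)
      finally show ?thesis .
    qed
    show "emeasure (distr M (\<Pi>\<^sub>M i\<in>UNIV. borel) (\<lambda>\<omega> i. U i \<omega>)) (prod_emb UNIV (\<lambda>i. borel) J (Pi\<^sub>E J A)) =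
        emeasure (distr N (\<Pi>\<^sub>M i\<in>UNIV. borel) (\<lambda>\<omega> i. V i \<omega>)) (prod_emb UNIV (\<lambda>i. borel) J (Pi\<^sub>E J A))"
      unfolding em[OF M U] em[OF N V]
      using cylinder_expectation_eq[of M N U V J B "{}" "\<lambda>_. 0", OF M N U V eq J B] by simp
  qed simp_all
qed

text \<open>Lets the real-valued uniqueness theorem serve complex processes, by doubling the index
  set.\<close>

definition re_im_part :: "('i \<Rightarrow> 'a \<Rightarrow> complex) \<Rightarrow> 'i \<times> bool \<Rightarrow> 'a \<Rightarrow> real" where
  "re_im_part Z p x = (if snd p then Re (Z (fst p) x) else Im (Z (fst p) x))"

lemma law_eqI:
  fixes X :: "'i \<Rightarrow> 'a \<Rightarrow> complex" and Y :: "'i \<Rightarrow> 'b \<Rightarrow> complex"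
  assumes M: "prob_space M" and N: "prob_space N"
    and X [measurable]: "\<And>i. X i \<in> borel_measurable M" and Y [measurable]: "\<And>i. Y i \<in> borel_measurable N"
    and eq: "\<And>J l. finite J \<Longrightarrow> (\<integral>x. iexp (Re (\<Sum>j\<in>J. l j * X j x)) \<partial>M) = (\<integral>x. iexp (Re (\<Sum>j\<in>J. l j * Y j x)) \<partial>N)"
  shows "distr M (\<Pi>\<^sub>M i\<in>UNIV. borel) (\<lambda>\<omega> i. X i \<omega>) = distr N (\<Pi>\<^sub>M i\<in>UNIV. borel) (\<lambda>\<omega> i. Y i \<omega>)"
proof -
  define T where "T f = (\<lambda>i. Complex (f (i, True)) (f (i, False)))" for f :: "'i \<times> bool \<Rightarrow> real"
  have T: "T \<in> measurable (\<Pi>\<^sub>M i\<in>UNIV. borel) (\<Pi>\<^sub>M i\<in>UNIV. borel)"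
    unfolding T_def Complex_eq by (intro measurable_PiM_single') (auto intro!: borel_measurable_add borel_measurable_times borel_measurable_of_real)
  have pm: "re_im_part Z p \<in> borel_measurable P" if "\<And>i. Z i \<in> borel_measurable P" for Z :: "'i \<Rightarrow> 'c \<Rightarrow> complex" and P p
  proof (cases "snd p")
    case True
    then show ?thesis using that by (simp add: re_im_part_def[abs_def])
  next
    case False
    then show ?thesis using that by (simp add: re_im_part_def[abs_def])
  qed
  have d: "distr P (\<Pi>\<^sub>M i\<in>UNIV. borel) (\<lambda>\<omega> i. Z i \<omega>) = distr (distr P (\<Pi>\<^sub>M i\<in>UNIV. borel) (\<lambda>\<omega> p. re_im_part Z p \<omega>)) (\<Pi>\<^sub>M i\<in>UNIV. borel) T"
    if "\<And>i. Z i \<in> borel_measurable P" for Z :: "'i \<Rightarrow> 'c \<Rightarrow> complex" and P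
  proof -
    have "(\<lambda>\<omega> p. re_im_part Z p \<omega>) \<in> measurable P (\<Pi>\<^sub>M i\<in>UNIV. borel)"
      by (intro measurable_PiM_single' pm that) auto
    from distr_distr[OF T this] show ?thesis by (simp add: o_def T_def re_im_part_def)
  qed
  \<comment> \<open>Re((\<alpha> - \<i> \<beta>)(x + \<i> y)) = \<alpha> x + \<beta> y; a pair
    missing from \<open>J\<close> gets coefficient 0.\<close>
  have e: "(\<Sum>p\<in>J. t p * re_im_part Z p x) = Re (\<Sum>i\<in>fst ` J. (of_real (if (i, True) \<in> J then t (i, True) else 0) - \<i> * of_real (if (i, False) \<in> J then t (i, False) else 0)) * Z i x)"
    if J: "finite J" for J t and Z :: "'i \<Rightarrow> 'c \<Rightarrow> complex" and x
  proof -
    have "(\<Sum>p\<in>J. t p * re_im_part Z p x) = (\<Sum>p\<in>fst ` J \<times> UNIV. (if p \<in> J then t p else 0) * re_im_part Z p x)"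
      using J by (intro sum.mono_neutral_cong_left) (auto intro: rev_image_eqI)
    also have "\<dots> = (\<Sum>i\<in>fst ` J. \<Sum>b\<in>UNIV. (if (i, b) \<in> J then t (i, b) else 0) * re_im_part Z (i, b) x)"
      by (simp add: sum.cartesian_product)
    also have "\<dots> = (\<Sum>i\<in>fst ` J. Re ((of_real (if (i, True) \<in> J then t (i, True) else 0) - \<i> * of_real (if (i, False) \<in> J then t (i, False) else 0)) * Z i x))"
      by (intro sum.cong refl) (auto simp: UNIV_bool re_im_part_def)
    finally show ?thesis by (simp only: Re_sum)
  qed
  have "distr M (\<Pi>\<^sub>M i\<in>UNIV. borel) (\<lambda>\<omega> p. re_im_part X p \<omega>) = distr N (\<Pi>\<^sub>M i\<in>UNIV. borel) (\<lambda>\<omega> p. re_im_part Y p \<omega>)"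
    by (rule law_eqI_real[OF M N]) (auto intro!: pm simp: e intro!: eq simp del: of_real_sum Re_sum)
  then show ?thesis unfolding d[OF X] d[OF Y] by simp
qed


subsection \<open>Gaussian series\<close>

lemma hk_0: "hk 0 \<zeta> n = \<zeta> ^ n / of_real (sqrt (fact n))" for \<zeta> :: complex
proof -
  have "hcoef 0 \<zeta> n = (\<Sum>k\<in>{0}. (- 0 / 2) ^ k / fact k * (\<zeta> ^ (n - 2 * k) / fact (n - 2 * k)))"
    unfolding hcoef_def by (intro sum.mono_neutral_right) auto
  then have "hk 0 \<zeta> n = of_real (sqrt (fact n)) * (\<zeta> ^ n / fact n)" by (simp add: hk_def)
  also have "(fact n :: complex) = of_real (sqrt (fact n)) * of_real (sqrt (fact n))"
    unfolding of_real_mult[symmetric] real_sqrt_mult_self by simp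
  finally show ?thesis by simp
qed

lemma gaf_eq_fock: "gaf \<xi> \<omega> = fock (\<lambda>n. \<xi> n \<omega>)"
  by (simp add: gaf_def fock_def fun_eq_iff)

lemma fock_eq_hk: "fock c z = (\<Sum>n. c n * hk 0 z n)"
  by (simp add: fock_def hk_0)

lemma geom_summable_norm_sq:
  fixes d :: "nat \<Rightarrow> complex"
  assumes "geom d" "geom e"
  shows "summable (\<lambda>n. norm (d n * cnj (e n)))"
  using summable_subexp_geom[OF geom_imp_subexp[OF assms(1)] assms(2)] by (simp add: norm_mult)

lemma integral_uniform_measure:
  fixes f :: "'a \<Rightarrow> complex"
  assumes "prob_space M" and A [measurable]: "A \<in> sets M" and pos: "0 < measure M A"
    and f [measurable]: "f \<in> borel_measurable M"
  shows "(\<integral>x. f x \<partial>uniform_measure M A) = (\<integral>x. indicator A x * f x \<partial>M) / of_real (measure M A)"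
proof -
  interpret prob_space M by fact
  have "indicator A x / emeasure M A = ennreal (indicator A x / measure M A)" for x
    using pos by (simp add: emeasure_eq_measure divide_ennreal[symmetric] indicator_def)
  then have "uniform_measure M A = density M (\<lambda>x. ennreal (indicator A x / measure M A))"
    by (simp add: uniform_measure_def)
  then have "(\<integral>x. f x \<partial>uniform_measure M A) = (\<integral>x. (indicator A x / measure M A) *\<^sub>R f x \<partial>M)"
    using pos by (simp add: integral_density)
  also have "\<dots> = (\<integral>x. indicator A x * f x / of_real (measure M A) \<partial>M)"
    by (intro Bochner_Integration.integral_cong) (auto simp: indicator_def scaleR_conv_of_real)
  finally show ?thesis by simp
qed

context
  fixes M :: "'a measure" and \<xi> :: "nat \<Rightarrow> 'a \<Rightarrow> complex"
  assumes iid: "iid_std_complex_gaussian M \<xi>"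
begin

interpretation prob_space M
  using iid by (simp add: iid_std_complex_gaussian_def)

lemma xi_distributed: "distributed M lborel (\<xi> n) (\<lambda>z. ennreal (exp (- (cmod z)\<^sup>2) / pi))"
  using iid by (simp add: iid_std_complex_gaussian_def)

lemma xi_measurable [measurable]: "\<xi> n \<in> borel_measurable M"
  using distributed_measurable[OF xi_distributed] by simp

lemma distr_xi: "distr M lborel (\<xi> n) = density lborel (\<lambda>z. ennreal (exp (- (cmod z)\<^sup>2) / pi))"
  by (rule distributed_distr_eq_density[OF xi_distributed])

lemma expectation_xi:
  fixes g :: "complex \<Rightarrow> 'b::{banach, second_countable_topology}"
  assumes [measurable]: "g \<in> borel_measurable borel"
  shows "(\<integral>\<omega>. g (\<xi> n \<omega>) \<partial>M) = (\<integral>w. (exp (- (cmod w)\<^sup>2) / pi) *\<^sub>R g w \<partial>lborel)"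
    and "integrable M (\<lambda>\<omega>. g (\<xi> n \<omega>)) \<longleftrightarrow> integrable lborel (\<lambda>w. (exp (- (cmod w)\<^sup>2) / pi) *\<^sub>R g w)"
proof -
  have "(\<integral>\<omega>. g (\<xi> n \<omega>) \<partial>M) = (\<integral>w. g w \<partial>distr M lborel (\<xi> n))"
    by (rule integral_distr[symmetric]) auto
  also have "\<dots> = (\<integral>w. (exp (- (cmod w)\<^sup>2) / pi) *\<^sub>R g w \<partial>lborel)"
    unfolding distr_xi by (rule integral_density) auto
  finally show "(\<integral>\<omega>. g (\<xi> n \<omega>) \<partial>M) = (\<integral>w. (exp (- (cmod w)\<^sup>2) / pi) *\<^sub>R g w \<partial>lborel)" .
  have "integrable M (\<lambda>\<omega>. g (\<xi> n \<omega>)) \<longleftrightarrow> integrable (distr M lborel (\<xi> n)) g"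
    by (rule integrable_distr_eq[symmetric]) auto
  also have "\<dots> \<longleftrightarrow> integrable lborel (\<lambda>w. (exp (- (cmod w)\<^sup>2) / pi) *\<^sub>R g w)"
    unfolding distr_xi by (rule integrable_density) auto
  finally show "integrable M (\<lambda>\<omega>. g (\<xi> n \<omega>)) \<longleftrightarrow> integrable lborel (\<lambda>w. (exp (- (cmod w)\<^sup>2) / pi) *\<^sub>R g w)" .
qed

lemma char_xi: "(\<integral>\<omega>. iexp (Re (d * \<xi> n \<omega>)) \<partial>M) = exp (- of_real ((norm d)\<^sup>2 / 4))"
proof -
  have e: "(exp (- (cmod w)\<^sup>2) / pi) *\<^sub>R iexp (Re (d * w)) = exp ((\<i> * cnj d / 2) * cnj w + (\<i> * d / 2) * w) * gweight w" for w
  proof -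
    have "complex_of_real (Re (d * w)) = (d * w + cnj (d * w)) / 2" by (simp add: complex_eq_iff)
    then have "\<i> * of_real (Re (d * w)) = (\<i> * cnj d / 2) * cnj w + (\<i> * d / 2) * w"
      by (simp add: algebra_simps add_divide_distrib)
    then show ?thesis unfolding gweight_def by (simp only: scaleR_conv_of_real mult.commute)
  qed
  have "(\<integral>\<omega>. iexp (Re (d * \<xi> n \<omega>)) \<partial>M) = (\<integral>w. (exp (- (cmod w)\<^sup>2) / pi) *\<^sub>R iexp (Re (d * w)) \<partial>lborel)"
    by (rule expectation_xi(1)) measurable
  also have "\<dots> = exp ((\<i> * d / 2) * (\<i> * cnj d / 2))"
    unfolding e by (rule exp_gaussian_integral(2))
  also have "(\<i> * d / 2) * (\<i> * cnj d / 2) = - of_real ((norm d)\<^sup>2 / 4)"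
  proof -
    have "(\<i> * d / 2) * (\<i> * cnj d / 2) = - (d * cnj d) / 4" by (simp add: mult.assoc mult.left_commute[of d \<i>])
    then show ?thesis by (simp add: complex_norm_square del: of_real_power)
  qed
  finally show ?thesis .
qed

lemma AE_xi_nonzero: "AE \<omega> in M. \<xi> n \<omega> \<noteq> 0"
proof -
  have "AE w in distr M lborel (\<xi> n). w \<noteq> 0"
    unfolding distr_xi by (subst AE_density) (use AE_lborel_singleton[of "0::complex"] in auto)
  then show ?thesis by (subst (asm) AE_distr_iff) auto
qed

text \<open>Keeps the conditioning events of positive probability, so that the conditional laws are
  genuine quotients.\<close>

lemma prob_xi_ball_pos:
  assumes "0 < \<delta>" shows "0 < measure M {\<omega> \<in> space M. norm (\<xi> n \<omega>) < \<delta>}"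
proof (rule ccontr)
  assume "\<not> 0 < measure M {\<omega> \<in> space M. norm (\<xi> n \<omega>) < \<delta>}"
  then have "measure M {\<omega> \<in> space M. norm (\<xi> n \<omega>) < \<delta>} = 0" using measure_nonneg[of M] by (simp add: not_less antisym)
  then have "AE \<omega> in M. \<not> norm (\<xi> n \<omega>) < \<delta>"
    by (subst AE_iff_measurable[OF _ refl]) (auto simp: emeasure_eq_measure)
  then have "AE w in distr M lborel (\<xi> n). \<not> norm w < \<delta>"
    by (subst AE_distr_iff) auto
  then have "AE w in lborel. w \<notin> ball (0::complex) \<delta>"
    unfolding distr_xi by (subst (asm) AE_density) auto
  then have "emeasure lborel (ball (0::complex) \<delta>) = 0"
    by (subst (asm) AE_iff_measurable[OF _ refl]) (auto simp: ball_def)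
  then show False using content_ball_pos[OF assms, of "0::complex"] by (simp add: measure_def)
qed

text \<open>First moments suffice: for each s < 1 the expectation of the sum of |\<xi>_n| s^n is
  finite, and countably many s reach every base in \<open>subexp\<close>.\<close>

lemma AE_subexp: "AE \<omega> in M. subexp (\<lambda>n. \<xi> n \<omega>)"
proof -
  define c where "c = (\<integral>w. (exp (- (cmod w)\<^sup>2) / pi) *\<^sub>R cmod w \<partial>lborel)"
  have "integrable lborel (\<lambda>w::complex. (exp (- (cmod w)\<^sup>2) / pi) *\<^sub>R norm w)"
  proof (rule Bochner_Integration.integrable_bound)
    show "integrable lborel (\<lambda>w::complex. exp (1 * norm w - 1 * (norm w)\<^sup>2))"
      by (rule integrable_exp_norm) simp
    have "exp (- (cmod w)\<^sup>2) / pi * norm w \<le> exp (1 * norm w - 1 * (norm w)\<^sup>2)" for w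
    proof -
      have "norm w \<le> exp (norm w)" using exp_ge_add_one_self[of "norm w"] by linarith
      moreover have "exp (- (cmod w)\<^sup>2) / pi \<le> exp (- (cmod w)\<^sup>2) / 1" using pi_gt3 by (intro divide_left_mono) auto
      ultimately have "exp (- (cmod w)\<^sup>2) / pi * norm w \<le> exp (- (cmod w)\<^sup>2) / 1 * exp (norm w)" by (intro mult_mono) auto
      then show ?thesis by (simp add: exp_add[symmetric])
    qed
    then show "AE w in lborel. norm ((exp (- (cmod w)\<^sup>2) / pi) *\<^sub>R norm w) \<le> norm (exp (1 * norm w - 1 * (norm w)\<^sup>2))"
      by simp
  qed measurable
  then have i: "integrable M (\<lambda>\<omega>. norm (\<xi> n \<omega>))" for n
    using expectation_xi(2)[of norm n] by simp
  have c: "(\<integral>\<omega>. norm (\<xi> n \<omega>) \<partial>M) = c" for n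
    unfolding c_def by (rule expectation_xi(1)) simp
  have c0: "0 \<le> c" unfolding c_def by simp
  have "AE \<omega> in M. summable (\<lambda>n. norm (\<xi> n \<omega>) * s ^ n)" if s: "0 < s" "s < 1" for s
  proof -
    have eq: "(\<integral>\<^sup>+\<omega>. ennreal (norm (\<xi> n \<omega>) * s ^ n) \<partial>M) = ennreal (c * s ^ n)" for n
      using s i by (subst nn_integral_eq_integral) (auto simp: c)
    have "(\<integral>\<^sup>+\<omega>. (\<Sum>n. ennreal (norm (\<xi> n \<omega>) * s ^ n)) \<partial>M) = (\<Sum>n. ennreal (c * s ^ n))"
      unfolding eq[symmetric] by (rule nn_integral_suminf) measurable
    also have "(\<Sum>n. ennreal (c * s ^ n)) = ennreal (\<Sum>n. c * s ^ n)"
      using s c0 by (intro suminf_ennreal2 summable_mult summable_geometric) auto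
    finally have "(\<integral>\<^sup>+\<omega>. (\<Sum>n. ennreal (norm (\<xi> n \<omega>) * s ^ n)) \<partial>M) \<noteq> \<infinity>" by simp
    then have "AE \<omega> in M. (\<Sum>n. ennreal (norm (\<xi> n \<omega>) * s ^ n)) \<noteq> \<infinity>"
      by (intro nn_integral_PInf_AE) measurable
    then show ?thesis
      by eventually_elim (rule summable_suminf_not_top, use s in auto)
  qed
  then have "AE \<omega> in M. \<forall>j::nat. summable (\<lambda>n. norm (\<xi> n \<omega>) * (1 / (1 + 1 / Suc j)) ^ n)"
    by (subst AE_all_countable) (auto simp: add_pos_pos)
  then show ?thesis
  proof eventually_elim
    case (elim \<omega>)
    show ?case unfolding subexp_def
    proof
      fix j :: nat
      define t where "t = 1 + 1 / real (Suc j)"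
      have t: "0 < t" by (simp add: t_def add_pos_pos)
      have s: "summable (\<lambda>n. norm (\<xi> n \<omega>) * (1 / t) ^ n)" using elim unfolding t_def by blast
      obtain K :: nat where K: "(\<Sum>n. norm (\<xi> n \<omega>) * (1 / t) ^ n) \<le> real K" using real_arch_simple by blast
      have "norm (\<xi> n \<omega>) \<le> real K * t ^ n" for n
      proof -
        have "norm (\<xi> n \<omega>) * (1 / t) ^ n \<le> (\<Sum>n. norm (\<xi> n \<omega>) * (1 / t) ^ n)"
          using sum_le_suminf[OF s, of "{n}"] t by simp
        with K have "norm (\<xi> n \<omega>) * (1 / t) ^ n \<le> real K" by linarith
        then show ?thesis using t by (simp add: power_divide field_simps)
      qed
      then show "\<exists>K::nat. \<forall>n. norm (\<xi> n \<omega>) \<le> real K * (1 + 1 / real (Suc j)) ^ n" unfolding t_def by blast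
    qed
  qed
qed

lemma AE_gaussian_series_summable:
  assumes "geom e" shows "AE \<omega> in M. summable (\<lambda>n. norm (\<xi> n \<omega> * e n))"
  using AE_subexp by eventually_elim (use summable_subexp_geom[OF _ assms] in \<open>simp add: norm_mult\<close>)

text \<open>The extra factor \<open>f (\<xi> 0 \<omega>)\<close> is there for the conditioning,
  where it becomes the indicator of a small disk. Finite sums factor by independence, and dominated
  convergence passes to the series.\<close>

lemma gaussian_series_char:
  assumes e: "geom e" and f [measurable]: "f \<in> borel_measurable borel" and fb: "\<And>w. norm (f w) \<le> 1"
  shows "(\<integral>\<omega>. f (\<xi> 0 \<omega>) * iexp (Re (\<Sum>n. \<xi> n \<omega> * e n)) \<partial>M) =
    (\<integral>\<omega>. f (\<xi> 0 \<omega>) * iexp (Re (e 0 * \<xi> 0 \<omega>)) \<partial>M) * exp (- of_real (\<Sum>n. (norm (e (Suc n)))\<^sup>2 / 4))"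
proof -
  define g where "g n w = (if n = 0 then f w * iexp (Re (e 0 * w)) else iexp (Re (e n * w)))" for n w
  have [measurable]: "g n \<in> borel_measurable borel" for n unfolding g_def by (cases "n = 0") auto
  have gb: "norm (g n w) \<le> 1" for n w using fb by (auto simp: g_def norm_mult)
  have part: "(\<integral>\<omega>. f (\<xi> 0 \<omega>) * iexp (Re (\<Sum>n<Suc N. \<xi> n \<omega> * e n)) \<partial>M) =
     (\<integral>\<omega>. f (\<xi> 0 \<omega>) * iexp (Re (e 0 * \<xi> 0 \<omega>)) \<partial>M) * exp (- of_real (\<Sum>n<N. (norm (e (Suc n)))\<^sup>2 / 4))" for N
  proof -
    have "f (\<xi> 0 \<omega>) * iexp (Re (\<Sum>n<Suc N. \<xi> n \<omega> * e n)) = (\<Prod>n<Suc N. g n (\<xi> n \<omega>))" for \<omega>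
    proof -
      have "(\<Prod>n<Suc N. g n (\<xi> n \<omega>)) = f (\<xi> 0 \<omega>) * (iexp (Re (e 0 * \<xi> 0 \<omega>)) * (\<Prod>n<N. iexp (Re (e (Suc n) * \<xi> (Suc n) \<omega>))))"
        by (simp add: prod.lessThan_Suc_shift g_def del: prod.lessThan_Suc)
      also have "iexp (Re (e 0 * \<xi> 0 \<omega>)) * (\<Prod>n<N. iexp (Re (e (Suc n) * \<xi> (Suc n) \<omega>))) = iexp (Re (\<Sum>n<Suc N. \<xi> n \<omega> * e n))"
        unfolding sum.lessThan_Suc_shift Re_sum plus_complex.sel of_real_add of_real_sum distrib_left sum_distrib_left exp_add
        by (simp only: exp_sum finite_lessThan mult.commute[of "\<xi> _ \<omega>"])
      finally show ?thesis ..
    qed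
    then have "(\<integral>\<omega>. f (\<xi> 0 \<omega>) * iexp (Re (\<Sum>n<Suc N. \<xi> n \<omega> * e n)) \<partial>M) = (\<integral>\<omega>. (\<Prod>n<Suc N. g n (\<xi> n \<omega>)) \<partial>M)" by simp
    also have "\<dots> = (\<Prod>n<Suc N. \<integral>\<omega>. g n (\<xi> n \<omega>) \<partial>M)"
    proof (rule indep_vars_lebesgue_integral)
      have "indep_vars (\<lambda>_. borel) \<xi> {..<Suc N}"
        using iid by (auto simp: iid_std_complex_gaussian_def intro: indep_vars_subset)
      then show "indep_vars (\<lambda>_. borel) (\<lambda>n \<omega>. g n (\<xi> n \<omega>)) {..<Suc N}"
        by (rule indep_vars_compose2) measurable
      show "integrable M (\<lambda>\<omega>. g n (\<xi> n \<omega>))" for n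
        by (rule integrable_const_bound[of _ 1]) (use gb in auto)
    qed simp
    also have "\<dots> = (\<integral>\<omega>. f (\<xi> 0 \<omega>) * iexp (Re (e 0 * \<xi> 0 \<omega>)) \<partial>M) * (\<Prod>n<N. exp (- of_real ((norm (e (Suc n)))\<^sup>2 / 4)))"
      unfolding prod.lessThan_Suc_shift by (simp only: g_def char_xi if_True nat.distinct refl if_False)
    also have "(\<Prod>n<N. exp (- complex_of_real ((norm (e (Suc n)))\<^sup>2 / 4))) = exp (- of_real (\<Sum>n<N. (norm (e (Suc n)))\<^sup>2 / 4))"
      unfolding of_real_sum sum_negf[symmetric] by (simp only: exp_sum finite_lessThan)
    finally show ?thesis .
  qed
  have "(\<lambda>N. \<integral>\<omega>. f (\<xi> 0 \<omega>) * iexp (Re (\<Sum>n<Suc N. \<xi> n \<omega> * e n)) \<partial>M) \<longlonglongrightarrow>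
      (\<integral>\<omega>. f (\<xi> 0 \<omega>) * iexp (Re (\<Sum>n. \<xi> n \<omega> * e n)) \<partial>M)"
  proof (rule integral_dominated_convergence[where w = "\<lambda>_. 1"])
    show "AE \<omega> in M. (\<lambda>N. f (\<xi> 0 \<omega>) * iexp (Re (\<Sum>n<Suc N. \<xi> n \<omega> * e n))) \<longlonglongrightarrow> f (\<xi> 0 \<omega>) * iexp (Re (\<Sum>n. \<xi> n \<omega> * e n))"
      using AE_gaussian_series_summable[OF e]
    proof eventually_elim
      case (elim \<omega>)
      have "(\<lambda>N. \<Sum>n<N. \<xi> n \<omega> * e n) \<longlonglongrightarrow> (\<Sum>n. \<xi> n \<omega> * e n)"
        by (rule summable_LIMSEQ[OF summable_norm_cancel[OF elim]])
      then have "(\<lambda>N. \<Sum>n<Suc N. \<xi> n \<omega> * e n) \<longlonglongrightarrow> (\<Sum>n. \<xi> n \<omega> * e n)"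
        by (rule LIMSEQ_Suc)
      then show ?case by (intro tendsto_intros)
    qed
    show "AE \<omega> in M. norm (f (\<xi> 0 \<omega>) * iexp (Re (\<Sum>n<Suc N. \<xi> n \<omega> * e n))) \<le> 1" for N
      using fb by (simp add: norm_mult)
  qed (auto simp del: sum.lessThan_Suc)
  moreover have "(\<lambda>N. \<integral>\<omega>. f (\<xi> 0 \<omega>) * iexp (Re (\<Sum>n<Suc N. \<xi> n \<omega> * e n)) \<partial>M) \<longlonglongrightarrow>
     (\<integral>\<omega>. f (\<xi> 0 \<omega>) * iexp (Re (e 0 * \<xi> 0 \<omega>)) \<partial>M) * exp (- of_real (\<Sum>n. (norm (e (Suc n)))\<^sup>2 / 4))"
  proof -
    have "summable (\<lambda>n. (norm (e (Suc n)))\<^sup>2 / 4)"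
      using geom_summable_norm_sq[OF geom_Suc[OF e] geom_Suc[OF e]]
      by (intro summable_divide) (simp add: norm_mult power2_eq_square)
    from summable_LIMSEQ[OF this] show ?thesis unfolding part by (intro tendsto_intros)
  qed
  ultimately show ?thesis by (rule LIMSEQ_unique)
qed

lemma gaussian_series_char_total:
  assumes e: "geom e"
  shows "(\<integral>\<omega>. iexp (Re (\<Sum>n. \<xi> n \<omega> * e n)) \<partial>M) = exp (- of_real (\<Sum>n. (norm (e n))\<^sup>2 / 4))"
proof -
  have "summable (\<lambda>n. (norm (e n))\<^sup>2 / 4)"
    using geom_summable_norm_sq[OF e e] by (intro summable_divide) (simp add: norm_mult power2_eq_square)
  from suminf_split_head[OF this] have "(\<Sum>n. (norm (e n))\<^sup>2 / 4) = (norm (e 0))\<^sup>2 / 4 + (\<Sum>n. (norm (e (Suc n)))\<^sup>2 / 4)" by simp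
  then have eq: "- complex_of_real (\<Sum>n. (norm (e n))\<^sup>2 / 4) =
      - of_real ((norm (e 0))\<^sup>2 / 4) + - of_real (\<Sum>n. (norm (e (Suc n)))\<^sup>2 / 4)"
    by (simp only: of_real_add minus_add_distrib)
  show ?thesis
    using gaussian_series_char[OF e, of "\<lambda>_. 1"] unfolding eq exp_add char_xi mult_1
    by (simp only: borel_measurable_const norm_one order_refl simp_thms)
qed

lemma gaussian_series_linear_comb:
  assumes c: "\<And>z. geom (c z)" and J: "finite J"
  shows "AE \<omega> in M. (\<Sum>j\<in>J. l j * (\<Sum>n. \<xi> n \<omega> * c j n)) = (\<Sum>n. \<xi> n \<omega> * (\<Sum>j\<in>J. l j * c j n))"
  using AE_subexp
proof eventually_elim
  case (elim \<omega>)
  have s: "summable (\<lambda>n. \<xi> n \<omega> * c j n)" for j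
    using summable_subexp_geom[OF elim c[of j]] by (intro summable_norm_cancel[of "\<lambda>n. \<xi> n \<omega> * c j n"]) (simp add: norm_mult)
  have "(\<Sum>n. \<xi> n \<omega> * (\<Sum>j\<in>J. l j * c j n)) = (\<Sum>n. \<Sum>j\<in>J. l j * (\<xi> n \<omega> * c j n))"
    by (simp add: sum_distrib_left mult_ac)
  also have "\<dots> = (\<Sum>j\<in>J. \<Sum>n. l j * (\<xi> n \<omega> * c j n))"
    by (intro suminf_sum summable_mult s)
  also have "\<dots> = (\<Sum>j\<in>J. l j * (\<Sum>n. \<xi> n \<omega> * c j n))"
    by (intro sum.cong refl suminf_mult s)
  finally show ?case ..
qed

lemma gaussian_series_law:
  fixes c c' :: "complex \<Rightarrow> nat \<Rightarrow> complex"
  assumes c: "\<And>z. geom (c z)" and c': "\<And>z. geom (c' z)"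
    and K: "\<And>z w. (\<Sum>n. c z n * cnj (c w n)) = (\<Sum>n. c' z n * cnj (c' w n))"
  shows "distr M (\<Pi>\<^sub>M z\<in>UNIV. borel) (\<lambda>\<omega> z. \<Sum>n. \<xi> n \<omega> * c z n) = distr M (\<Pi>\<^sub>M z\<in>UNIV. borel) (\<lambda>\<omega> z. \<Sum>n. \<xi> n \<omega> * c' z n)"
proof (rule law_eqI)
  fix J :: "complex set" and l :: "complex \<Rightarrow> complex"
  assume J: "finite J"
  \<comment> \<open>The squared norm of the combined coefficients is a Hermitian form in
    \<open>l\<close> whose matrix is the kernel, so \<open>d\<close> enters only through its
    kernel.\<close>
  have ch: "(\<integral>\<omega>. iexp (Re (\<Sum>j\<in>J. l j * (\<Sum>n. \<xi> n \<omega> * d j n))) \<partial>M) =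
     exp (- ((\<Sum>j\<in>J. \<Sum>k\<in>J. l j * cnj (l k) * (\<Sum>n. d j n * cnj (d k n))) / 4))"
    if d: "\<And>z. geom (d z)" for d :: "complex \<Rightarrow> nat \<Rightarrow> complex"
  proof -
    define e where "e n = (\<Sum>j\<in>J. l j * d j n)" for n
    have e: "geom e" unfolding e_def by (intro geom_sum J geom_cmult d)
    have "(\<integral>\<omega>. iexp (Re (\<Sum>j\<in>J. l j * (\<Sum>n. \<xi> n \<omega> * d j n))) \<partial>M) = (\<integral>\<omega>. iexp (Re (\<Sum>n. \<xi> n \<omega> * e n)) \<partial>M)"
      unfolding e_def
    proof (rule integral_cong_AE)
      show "AE \<omega> in M. iexp (Re (\<Sum>j\<in>J. l j * (\<Sum>n. \<xi> n \<omega> * d j n))) = iexp (Re (\<Sum>n. \<xi> n \<omega> * (\<Sum>j\<in>J. l j * d j n)))"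
        using gaussian_series_linear_comb[where c = d, OF d J, of l] by eventually_elim (simp only:)
    qed measurable
    also have "\<dots> = exp (- of_real (\<Sum>n. (norm (e n))\<^sup>2 / 4))"
      by (rule gaussian_series_char_total[OF e])
    also have "complex_of_real (\<Sum>n. (norm (e n))\<^sup>2 / 4) = (\<Sum>n. e n * cnj (e n)) / 4"
    proof -
      have s: "summable (\<lambda>n. (norm (e n))\<^sup>2)"
        using geom_summable_norm_sq[OF e e] by (simp add: norm_mult power2_eq_square)
      have "complex_of_real (\<Sum>n. (norm (e n))\<^sup>2 / 4) = of_real (\<Sum>n. (norm (e n))\<^sup>2) / 4"
        by (subst suminf_divide[OF s]) simp
      also have "complex_of_real (\<Sum>n. (norm (e n))\<^sup>2) = (\<Sum>n. of_real ((norm (e n))\<^sup>2))"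
        by (rule suminf_of_real[OF s])
      finally show ?thesis by (simp only: complex_norm_square)
    qed
    also have "(\<Sum>n. e n * cnj (e n)) = (\<Sum>j\<in>J. \<Sum>k\<in>J. l j * cnj (l k) * (\<Sum>n. d j n * cnj (d k n)))"
    proof -
      have s: "summable (\<lambda>n. d j n * cnj (d k n))" for j k
        by (rule summable_norm_cancel[OF geom_summable_norm_sq[OF d d]])
      have "(\<Sum>n. e n * cnj (e n)) = (\<Sum>n. \<Sum>j\<in>J. \<Sum>k\<in>J. l j * cnj (l k) * (d j n * cnj (d k n)))"
        unfolding e_def by (simp add: cnj_sum sum_product mult_ac)
      also have "\<dots> = (\<Sum>j\<in>J. \<Sum>n. \<Sum>k\<in>J. l j * cnj (l k) * (d j n * cnj (d k n)))"
        by (intro suminf_sum summable_sum summable_mult s)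
      also have "\<dots> = (\<Sum>j\<in>J. \<Sum>k\<in>J. \<Sum>n. l j * cnj (l k) * (d j n * cnj (d k n)))"
        by (intro sum.cong refl suminf_sum summable_mult s)
      also have "\<dots> = (\<Sum>j\<in>J. \<Sum>k\<in>J. l j * cnj (l k) * (\<Sum>n. d j n * cnj (d k n)))"
        by (intro sum.cong refl suminf_mult s)
      finally show ?thesis .
    qed
    finally show ?thesis .
  qed
  show "(\<integral>\<omega>. iexp (Re (\<Sum>j\<in>J. l j * (\<Sum>n. \<xi> n \<omega> * c j n))) \<partial>M) = (\<integral>\<omega>. iexp (Re (\<Sum>j\<in>J. l j * (\<Sum>n. \<xi> n \<omega> * c' j n))) \<partial>M)"
    unfolding ch[OF c] ch[OF c'] K ..
qed (use prob_space_axioms in measurable)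

end


subsection \<open>The metaplectic operators\<close>

lemma hk_cnj: "cnj (hk \<tau> w n) = hk (cnj \<tau>) (cnj w) n"
  by (simp add: hk_def hcoef_def)

lemma fock_cnj_hk: "fock (\<lambda>n. cnj (hk \<tau> w n)) u = exp (- cnj \<tau> / 2 * u\<^sup>2 + cnj w * u)"
  using hk_power_sums[of "cnj \<tau>" "cnj w" u] by (simp add: fock_def hk_cnj sums_iff)

text \<open>A Mehler-type formula. The sum is the heat operator applied to the function with
  coefficients \<open>cnj (hk \<tau> w n)\<close>, which the generating function identifies as a
  Gaussian exponential, so \<open>heat_integral\<close> reduces it to
  \<open>gaussian_integral_2\<close>.\<close>

lemma hk_kernel:
  assumes "norm \<tau> < 1"
  shows "(\<Sum>n. hk \<tau> z n * cnj (hk \<tau> w n)) = of_real (1 / sqrt (1 - (norm \<tau>)\<^sup>2)) *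
    exp ((z * cnj w - cnj \<tau> / 2 * z\<^sup>2 - \<tau> / 2 * (cnj w)\<^sup>2) / of_real (1 - (norm \<tau>)\<^sup>2))"
proof -
  let ?c = "\<lambda>n. cnj (hk \<tau> w n)"
  have c: "subexp ?c"
    by (rule geom_imp_subexp, rule geom_mono[OF geom_hk[OF assms, of w]]) simp
  have "(\<Sum>n. hk \<tau> z n * cnj (hk \<tau> w n)) = heat \<tau> (fock ?c) z"
    using heat_fock(2)[OF c assms] by (simp add: mult.commute)
  also have "\<dots> = (\<integral>u. of_real (1 / pi) * exp (- \<tau> / 2 * (cnj u)\<^sup>2 - cnj \<tau> / 2 * u\<^sup>2 + z * cnj u + cnj w * u - of_real ((norm u)\<^sup>2)) \<partial>lborel)"
    unfolding heat_integral(2)[OF c assms] fock_cnj_hk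
  proof (rule Bochner_Integration.integral_cong[OF refl])
    fix u :: complex
    have g: "gweight u = of_real (1 / pi) * exp (- of_real ((norm u)\<^sup>2))"
      by (simp add: gweight_def exp_of_real[symmetric])
    have "- \<tau> / 2 * (cnj u)\<^sup>2 - cnj \<tau> / 2 * u\<^sup>2 + z * cnj u + cnj w * u - of_real ((norm u)\<^sup>2) =
      (- \<tau> / 2 * (cnj u)\<^sup>2 + z * cnj u) + (- cnj \<tau> / 2 * u\<^sup>2 + cnj w * u) + - of_real ((norm u)\<^sup>2)" by simp
    then show "exp (- \<tau> / 2 * (cnj u)\<^sup>2 + z * cnj u) * exp (- cnj \<tau> / 2 * u\<^sup>2 + cnj w * u) * gweight u =
      of_real (1 / pi) * exp (- \<tau> / 2 * (cnj u)\<^sup>2 - cnj \<tau> / 2 * u\<^sup>2 + z * cnj u + cnj w * u - of_real ((norm u)\<^sup>2))"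
      unfolding g by (simp only: exp_add mult_ac)
  qed
  also have "\<dots> = of_real (1 / pi) * (of_real (pi / sqrt (1 - (norm \<tau>)\<^sup>2)) *
    exp ((z * cnj w - cnj \<tau> / 2 * z\<^sup>2 - \<tau> / 2 * (cnj w)\<^sup>2) / of_real (1 - (norm \<tau>)\<^sup>2)))"
    unfolding integral_mult_right_zero gaussian_integral_2(2)[OF assms] ..
  finally show ?thesis by simp
qed

lemma hk_0_kernel: "(\<Sum>n. hk 0 z n * cnj (hk 0 w n)) = exp (z * cnj w)"
  using hk_kernel[of 0 z w] by simp

text \<open>Time and point may vary together; this is what the Newton iterates and a zero path
  inserted into the heat evolution call for.\<close>

lemma heat_series_holomorphic:
  assumes c: "subexp c" and S: "open S" and t: "t holomorphic_on S" and \<zeta>: "\<zeta> holomorphic_on S"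
    and t1: "\<And>x. x \<in> S \<Longrightarrow> norm (t x) < 1"
  shows "(\<lambda>x. \<Sum>n. c n * hk (t x) (\<zeta> x) n) holomorphic_on S"
proof (rule holomorphic_uniform_sequence[OF S, where f = "\<lambda>N x. \<Sum>n<N. c n * hk (t x) (\<zeta> x) n"])
  show "(\<lambda>x. \<Sum>n<N. c n * hk (t x) (\<zeta> x) n) holomorphic_on S" for N
    unfolding hk_def hcoef_def by (intro holomorphic_intros t \<zeta>) auto
  fix x assume x: "x \<in> S"
  \<comment> \<open>Bounds valid on a whole neighbourhood: \<open>T\<close> stays below 1 because it
    is the midpoint between |t x| and 1.\<close>
  define T where "T = (1 + norm (t x)) / 2"
  define Z where "Z = norm (\<zeta> x) + 1"
  have T: "0 \<le> T" "T < 1" "norm (t x) < T" "0 \<le> Z" "norm (\<zeta> x) < Z"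
    using t1[OF x] by (auto simp: T_def Z_def intro: add_nonneg_nonneg)
  have "isCont t x" "isCont \<zeta> x"
    using t \<zeta> x S holomorphic_on_imp_continuous_on continuous_on_eq_continuous_at by blast+
  then have "((\<lambda>y. norm (t y)) \<longlongrightarrow> norm (t x)) (at x)" "((\<lambda>y. norm (\<zeta> y)) \<longlongrightarrow> norm (\<zeta> x)) (at x)"
    by (auto simp: isCont_def intro: tendsto_norm)
  then have "eventually (\<lambda>y. norm (t y) < T) (at x)" "eventually (\<lambda>y. norm (\<zeta> y) < Z) (at x)"
    using T order_tendstoD(2) by blast+
  then have "eventually (\<lambda>y. norm (t y) < T \<and> norm (\<zeta> y) < Z \<and> y \<in> S) (nhds x)"
    using T S x by (auto simp: eventually_nhds_conv_at eventually_conj_iff eventually_at_topological)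
  then obtain d where d: "0 < d" "\<And>y. dist y x < d \<Longrightarrow> norm (t y) < T \<and> norm (\<zeta> y) < Z \<and> y \<in> S"
    unfolding eventually_nhds_metric by blast
  show "\<exists>d>0. cball x d \<subseteq> S \<and> uniform_limit (cball x d) (\<lambda>N x. \<Sum>n<N. c n * hk (t x) (\<zeta> x) n) (\<lambda>x. \<Sum>n. c n * hk (t x) (\<zeta> x) n) sequentially"
  proof (intro exI[of _ "d / 2"] conjI)
    have *: "norm (t y) \<le> T \<and> norm (\<zeta> y) \<le> Z \<and> y \<in> S" if "y \<in> cball x (d / 2)" for y
      using d(2)[of y] d(1) that by (auto simp: dist_commute less_imp_le)
    show "cball x (d / 2) \<subseteq> S" using * by blast
    show "uniform_limit (cball x (d / 2)) (\<lambda>N x. \<Sum>n<N. c n * hk (t x) (\<zeta> x) n) (\<lambda>x. \<Sum>n. c n * hk (t x) (\<zeta> x) n) sequentially"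
    proof (rule Weierstrass_m_test)
      show "summable (\<lambda>n. norm (c n) * hk (- T) Z n)" by (rule summable_hk_abs) (use c T in auto)
      show "norm (c n * hk (t y) (\<zeta> y) n) \<le> norm (c n) * hk (- T) Z n" if "y \<in> cball x (d / 2)" for n y
        unfolding norm_mult using *[OF that] by (intro mult_left_mono norm_hk_le) auto
    qed
  qed (use d in auto)
qed

lemma heat_holomorphic:
  assumes "subexp c" "norm \<tau> < 1" shows "heat \<tau> (fock c) holomorphic_on S"
proof -
  have "(\<lambda>x. \<Sum>n. c n * hk \<tau> x n) holomorphic_on UNIV"
    by (rule heat_series_holomorphic[OF assms(1)]) (use assms in auto)
  moreover have "(\<lambda>x. \<Sum>n. c n * hk \<tau> x n) = heat \<tau> (fock c)"
    using heat_fock(2)[OF assms] by auto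
  ultimately show ?thesis using holomorphic_on_subset by force
qed

section \<open>The parameters p and q, and the polar factorisation\<close>

lemma mp_norm_diff:
  assumes "A \<in> SL2R" shows "(norm (mp_p A))\<^sup>2 - (norm (mp_q A))\<^sup>2 = 1"
proof -
  have e: "Re (mp_p A) = (A$1$1 + A$2$2) / 2" "Im (mp_p A) = (A$2$1 - A$1$2) / 2"
     "Re (mp_q A) = (A$1$1 - A$2$2) / 2" "Im (mp_q A) = (A$1$2 + A$2$1) / 2"
    by (simp_all add: mp_p_def mp_q_def)
  have "(norm (mp_p A))\<^sup>2 - (norm (mp_q A))\<^sup>2 = A$1$1 * A$2$2 - A$1$2 * A$2$1"
    unfolding cmod_power2 e by (simp add: power2_eq_square field_simps)
  then show ?thesis using assms by (simp add: SL2R_def det_2)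
qed

text \<open>The pair (p, q) is a coordinate system for real matrices: it describes the map z -> p z
  + q cnj z.\<close>

lemma mat2_eq_iff: "(A :: real^2^2) = B \<longleftrightarrow> mp_p A = mp_p B \<and> mp_q A = mp_q B"
proof
  assume *: "mp_p A = mp_p B \<and> mp_q A = mp_q B"
  have e: "C$1$1 = Re (mp_p C) + Re (mp_q C)" "C$2$2 = Re (mp_p C) - Re (mp_q C)"
     "C$2$1 = Im (mp_p C) + Im (mp_q C)" "C$1$2 = Im (mp_q C) - Im (mp_p C)" for C
    by (simp_all add: mp_p_def mp_q_def field_simps)
  show "A = B" using * by (simp add: vec_eq_iff forall_2 e)
qed simp

text \<open>Left multiplication by a rotation multiplies p and q by \<open>cis \<theta>\<close>; the
  symmetric factor itself has p = s and q = s \<tau>.\<close>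

lemma mp_factored:
  fixes \<tau> :: complex and \<theta> :: real
  defines "s \<equiv> 1 / sqrt (1 - (norm \<tau>)\<^sup>2)"
  shows "mp_p (rot_mat \<theta> ** sym_mat \<tau>) = cis \<theta> * of_real s"
    and "mp_q (rot_mat \<theta> ** sym_mat \<tau>) = cis \<theta> * of_real s * \<tau>"
proof -
  have e: "(rot_mat \<theta> ** sym_mat \<tau>)$1$1 = cos \<theta> * (s * (1 + Re \<tau>)) - sin \<theta> * (s * Im \<tau>)"
    "(rot_mat \<theta> ** sym_mat \<tau>)$1$2 = cos \<theta> * (s * Im \<tau>) - sin \<theta> * (s * (1 - Re \<tau>))"
    "(rot_mat \<theta> ** sym_mat \<tau>)$2$1 = sin \<theta> * (s * (1 + Re \<tau>)) + cos \<theta> * (s * Im \<tau>)"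
    "(rot_mat \<theta> ** sym_mat \<tau>)$2$2 = sin \<theta> * (s * Im \<tau>) + cos \<theta> * (s * (1 - Re \<tau>))"
    by (simp_all add: matrix_matrix_mult_def sum_2 rot_mat_def sym_mat_def s_def)
  show "mp_p (rot_mat \<theta> ** sym_mat \<tau>) = cis \<theta> * of_real s"
    "mp_q (rot_mat \<theta> ** sym_mat \<tau>) = cis \<theta> * of_real s * \<tau>"
    unfolding mp_p_def mp_q_def e by (simp_all add: complex_eq_iff algebra_simps add_divide_distrib diff_divide_distrib)
qed

lemma mp_p_nonzero: "A \<in> SL2R \<Longrightarrow> mp_p A \<noteq> 0"
proof
  assume A: "A \<in> SL2R" and "mp_p A = 0"
  then have "- ((norm (mp_q A))\<^sup>2) = 1" using mp_norm_diff[OF A] by simp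
  then show False by (smt (verit) zero_le_power2)
qed

lemma mp_ratio:
  assumes A: "A \<in> SL2R"
  shows "norm (mp_q A / mp_p A) < 1" and "1 / sqrt (1 - (norm (mp_q A / mp_p A))\<^sup>2) = norm (mp_p A)"
proof -
  let ?p = "norm (mp_p A)" and ?q = "norm (mp_q A)"
  have p: "0 < ?p" using mp_p_nonzero[OF A] by simp
  have d: "?p\<^sup>2 - ?q\<^sup>2 = 1" by (rule mp_norm_diff[OF A])
  then have "?q\<^sup>2 < ?p\<^sup>2" by linarith
  then have "?q < ?p" by (rule power_less_imp_less_base) (use p in auto)
  then show "norm (mp_q A / mp_p A) < 1" using p by (simp add: norm_divide)
  have "1 - (?q / ?p)\<^sup>2 = (?p\<^sup>2 - ?q\<^sup>2) / ?p\<^sup>2" using p by (simp add: power_divide field_simps)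
  then have "1 - (?q / ?p)\<^sup>2 = (1 / ?p)\<^sup>2" unfolding d by (simp add: power_divide)
  then show "1 / sqrt (1 - (norm (mp_q A / mp_p A))\<^sup>2) = norm (mp_p A)"
    by (simp add: norm_divide)
qed

text \<open>Existence and uniqueness of the factorisation reduce to the polar form of the nonzero
  number p, with \<tau> forced to be q / p.\<close>

lemma factors_as_iff:
  assumes A: "A \<in> SL2R"
  shows "factors_as A \<theta> \<tau> \<longleftrightarrow> \<tau> = mp_q A / mp_p A \<and> mp_p A = of_real (norm (mp_p A)) * cis \<theta>"
proof
  assume f: "factors_as A \<theta> \<tau>"
  define s where "s = 1 / sqrt (1 - (norm \<tau>)\<^sup>2)"
  have t: "norm \<tau> < 1" using f by (simp add: factors_as_def)
  then have "(norm \<tau>)\<^sup>2 < 1" by (simp add: abs_square_less_1)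
  then have s: "0 < s" by (simp add: s_def)
  have p: "mp_p A = cis \<theta> * of_real s" "mp_q A = cis \<theta> * of_real s * \<tau>"
    using f mp_factored[of \<theta> \<tau>] by (auto simp: factors_as_def s_def)
  then have "norm (mp_p A) = s" using s by (simp add: norm_mult)
  then show "\<tau> = mp_q A / mp_p A \<and> mp_p A = of_real (norm (mp_p A)) * cis \<theta>"
    using p s by auto
next
  assume *: "\<tau> = mp_q A / mp_p A \<and> mp_p A = of_real (norm (mp_p A)) * cis \<theta>"
  have s: "1 / sqrt (1 - (norm \<tau>)\<^sup>2) = norm (mp_p A)" using mp_ratio(2)[OF A] * by simp
  have "A = rot_mat \<theta> ** sym_mat \<tau>"
    unfolding mat2_eq_iff mp_factored s using * mp_p_nonzero[OF A] by (metis mult.commute nonzero_mult_div_cancel_left times_divide_eq_right)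
  then show "factors_as A \<theta> \<tau>" using * mp_ratio(1)[OF A] by (simp add: factors_as_def)
qed

lemma factorization_unique:
  assumes A: "A \<in> SL2R"
  shows "\<exists>!x. case x of (\<theta>, \<tau>) \<Rightarrow> 0 \<le> \<theta> \<and> \<theta> < 2 * pi \<and> factors_as A \<theta> \<tau>"
proof (rule ex1I[of _ "(Arg2pi (mp_p A), mp_q A / mp_p A)"])
  show "case (Arg2pi (mp_p A), mp_q A / mp_p A) of (\<theta>, \<tau>) \<Rightarrow> 0 \<le> \<theta> \<and> \<theta> < 2 * pi \<and> factors_as A \<theta> \<tau>"
    unfolding prod.case factors_as_iff[OF A] using Arg2pi[of "mp_p A"] unfolding is_Arg_def cis_conv_exp by blast
  fix x assume "case x of (\<theta>, \<tau>) \<Rightarrow> 0 \<le> \<theta> \<and> \<theta> < 2 * pi \<and> factors_as A \<theta> \<tau>"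
  then obtain \<theta> \<tau> where x: "x = (\<theta>, \<tau>)" "0 \<le> \<theta>" "\<theta> < 2 * pi" "\<tau> = mp_q A / mp_p A"
      "mp_p A = of_real (norm (mp_p A)) * cis \<theta>"
    by (auto simp: factors_as_iff[OF A])
  have "Arg2pi (mp_p A) = \<theta>"
    by (rule Arg2pi_unique[of "norm (mp_p A)"]) (use x mp_p_nonzero[OF A] in \<open>auto simp: cis_conv_exp\<close>)
  with x show "x = (Arg2pi (mp_p A), mp_q A / mp_p A)" by simp
qed

lemma factorization_factors:
  assumes A: "A \<in> SL2R" and f: "factorization A = (\<theta>, \<tau>)"
  shows "factors_as A \<theta> \<tau>"
  using theI'[OF factorization_unique[OF A]] f unfolding factorization_def by auto

section \<open>The metaplectic image as a zero-free factor times a heat evolution\<close>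

definition mp_coef :: "real^2^2 \<Rightarrow> complex \<Rightarrow> complex \<Rightarrow> complex" where
  "mp_coef A s z = 1 / s * exp (1/2 * (cnj (mp_q A) / mp_p A) * z\<^sup>2)"

lemma mp_integrand_eq:
  "mp_integrand A F z w = exp (1/2 * (cnj (mp_q A) / mp_p A) * z\<^sup>2) *
    (exp (- (mp_q A / mp_p A) / 2 * (cnj w)\<^sup>2 + z / mp_p A * cnj w) * F w * gweight w)"
proof -
  have "1/2 * (cnj (mp_q A) / mp_p A) * z\<^sup>2 - 1/2 * (mp_q A / mp_p A) * (cnj w)\<^sup>2 + 1 / mp_p A * z * cnj w =
     1/2 * (cnj (mp_q A) / mp_p A) * z\<^sup>2 + (- (mp_q A / mp_p A) / 2 * (cnj w)\<^sup>2 + z / mp_p A * cnj w)"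
    by simp
  then show ?thesis unfolding mp_integrand_def gweight_def by (simp only: exp_add mult.assoc)
qed

lemma mp_integrable:
  assumes "A \<in> SL2R" "subexp c" shows "integrable lborel (mp_integrand A (fock c) z)"
  unfolding mp_integrand_eq[abs_def]
  by (intro integrable_mult_right heat_integral(1) assms mp_ratio(1))

lemma mp_fock:
  assumes A: "A \<in> SL2R" and c: "subexp c"
  shows "1 / s * (\<integral>w. mp_integrand A (fock c) z w \<partial>lborel) = mp_coef A s z * heat (mp_q A / mp_p A) (fock c) (z / mp_p A)"
  unfolding mp_integrand_eq integral_mult_right_zero heat_integral(2)[OF c mp_ratio(1)[OF A]]
  by (simp add: mp_coef_def)

lemma mp_kernel:
  fixes A :: "real^2^2" and s z w :: complex
  assumes A: "A \<in> SL2R" and s: "s\<^sup>2 = mp_p A"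
  defines "\<tau> \<equiv> mp_q A / mp_p A"
  shows "(\<Sum>n. (mp_coef A s z * hk \<tau> (z / mp_p A) n) * cnj (mp_coef A s w * hk \<tau> (w / mp_p A) n)) = exp (z * cnj w)"
proof -
  define p where "p = mp_p A"
  define q where "q = mp_q A"
  define e where "e z = 1/2 * (cnj q / p) * z\<^sup>2" for z
  have p: "p \<noteq> 0" using mp_p_nonzero[OF A] by (simp add: p_def)
  have t: "norm \<tau> < 1" "1 / sqrt (1 - (norm \<tau>)\<^sup>2) = norm p" using mp_ratio[OF A] by (auto simp: \<tau>_def p_def)
  have t2: "complex_of_real (1 - (norm \<tau>)\<^sup>2) = 1 / (p * cnj p)"
  proof -
    have "(norm \<tau>)\<^sup>2 < 1" using t by (simp add: abs_square_less_1)
    then have "1 - (norm \<tau>)\<^sup>2 = 1 / (1 / sqrt (1 - (norm \<tau>)\<^sup>2))\<^sup>2" by (simp add: power_divide)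
    also have "\<dots> = 1 / (norm p)\<^sup>2" unfolding t(2) ..
    finally show ?thesis by (simp add: complex_norm_square del: of_real_power of_real_diff)
  qed
  have qt: "q = \<tau> * p" using p by (simp add: \<tau>_def p_def q_def)
  have geo: "geom (hk \<tau> x)" for x by (rule geom_hk[OF t(1)])
  have sm: "summable (\<lambda>n. hk \<tau> (z / p) n * cnj (hk \<tau> (w / p) n))"
    by (rule summable_norm_cancel[OF geom_summable_norm_sq[OF geo geo]])
  \<comment> \<open>Either square root of p has squared modulus |p|; this cancels the factor 1 /
    sqrt(1 - |\<tau>|^2) = |p| of \<open>hk_kernel\<close>, and the sign of \<open>s\<close> drops
    out.\<close>
  have "s * cnj s = of_real (norm p)"
  proof -
    have "(norm s)\<^sup>2 = norm p" using s by (metis norm_power p_def)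
    then show ?thesis using complex_norm_square[of s] by simp
  qed
  then have ss: "mp_coef A s z * cnj (mp_coef A s w) = exp (e z + cnj (e w)) / of_real (norm p)"
    by (simp add: mp_coef_def e_def p_def q_def exp_add exp_cnj)
  have "(\<Sum>n. (mp_coef A s z * hk \<tau> (z / mp_p A) n) * cnj (mp_coef A s w * hk \<tau> (w / mp_p A) n)) =
     (\<Sum>n. mp_coef A s z * cnj (mp_coef A s w) * (hk \<tau> (z / p) n * cnj (hk \<tau> (w / p) n)))"
    by (simp add: p_def mult_ac)
  also have "\<dots> = mp_coef A s z * cnj (mp_coef A s w) * (\<Sum>n. hk \<tau> (z / p) n * cnj (hk \<tau> (w / p) n))"
    by (rule suminf_mult[OF sm])
  also have "\<dots> = exp (e z + cnj (e w)) * exp ((z / p * cnj (w / p) - cnj \<tau> / 2 * (z / p)\<^sup>2 - \<tau> / 2 * (cnj (w / p))\<^sup>2) / of_real (1 - (norm \<tau>)\<^sup>2))"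
    unfolding ss hk_kernel[OF t(1)] t(2) using p by simp
  also have "\<dots> = exp (z * cnj w)"
    unfolding exp_add[symmetric]
  proof (rule arg_cong[where f = exp])
    \<comment> \<open>Since 1 / (1 - |\<tau>|^2) = p cnj p, the mixed term becomes z cnj w, and with
      q = \<tau> p the pure squares cancel against \<open>e z\<close> and
      \<open>cnj (e w)\<close>.\<close>
    have "(z / p * cnj (w / p) - cnj \<tau> / 2 * (z / p)\<^sup>2 - \<tau> / 2 * (cnj (w / p))\<^sup>2) / of_real (1 - (norm \<tau>)\<^sup>2) =
       z * cnj w - 1/2 * (cnj \<tau> * cnj p / p) * z\<^sup>2 - 1/2 * (\<tau> * p / cnj p) * (cnj w)\<^sup>2"
      unfolding t2 using p by (simp add: field_simps power2_eq_square)
    then show "e z + cnj (e w) + (z / p * cnj (w / p) - cnj \<tau> / 2 * (z / p)\<^sup>2 - \<tau> / 2 * (cnj (w / p))\<^sup>2) / of_real (1 - (norm \<tau>)\<^sup>2) = z * cnj w"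
      unfolding e_def qt by simp
  qed
  finally show ?thesis .
qed


subsection \<open>Equality in distribution up to null sets\<close>

lemma measurable_completion_AE:
  assumes X': "X' \<in> measurable (completion M) K" and sp: "\<And>\<omega>. \<omega> \<in> space M \<Longrightarrow> X \<omega> \<in> space K"
    and ae: "AE \<omega> in M. X \<omega> = X' \<omega>"
  shows "X \<in> measurable (completion M) K"
proof (rule measurableI)
  show "X \<omega> \<in> space K" if "\<omega> \<in> space (completion M)" for \<omega> using sp that by simp
  fix S assume S: "S \<in> sets K"
  have "AE \<omega> in completion M. X \<omega> = X' \<omega>" using ae by (rule AE_completion)
  then obtain N where N1: "{\<omega> \<in> space (completion M). \<not> X \<omega> = X' \<omega>} \<subseteq> N"
    and "emeasure (completion M) N = 0" "N \<in> sets (completion M)" by (rule AE_E)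
  then have N: "{\<omega> \<in> space (completion M). X \<omega> \<noteq> X' \<omega>} \<subseteq> N" "N \<in> null_sets (completion M)"
    by (auto simp only: null_sets_def mem_Collect_eq)
  have eq: "X -` S \<inter> space (completion M) = (X' -` S \<inter> space (completion M) - N) \<union> (X -` S \<inter> space (completion M) \<inter> N)"
    using N(1) by auto
  have "X -` S \<inter> space (completion M) \<inter> N \<in> sets (completion M)"
    by (rule null_setsD2[OF null_sets_completion_subset[OF _ N(2)]]) auto
  then show "X -` S \<inter> space (completion M) \<in> sets (completion M)"
    by (subst eq) (intro sets.Un sets.Diff measurable_sets[OF X' S] null_setsD2[OF N(2)])
qed

text \<open>Random objects are compared with everywhere measurable versions; on the exceptional null
  set the originals may be arbitrary, which the completion tolerates.\<close>

lemma eq_in_dist_AE: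
  assumes X: "X' \<in> measurable M K" "\<And>\<omega>. \<omega> \<in> space M \<Longrightarrow> X \<omega> \<in> space K" "AE \<omega> in M. X \<omega> = X' \<omega>"
    and Y: "Y' \<in> measurable N K" "\<And>\<omega>. \<omega> \<in> space N \<Longrightarrow> Y \<omega> \<in> space K" "AE \<omega> in N. Y \<omega> = Y' \<omega>"
    and eq: "distr M K X' = distr N K Y'"
  shows "eq_in_dist M X N Y K"
proof -
  have d: "Z \<in> measurable (completion P) K \<and> distr (completion P) K Z = distr P K Z'"
    if Z: "Z' \<in> measurable P K" "\<And>\<omega>. \<omega> \<in> space P \<Longrightarrow> Z \<omega> \<in> space K" "AE \<omega> in P. Z \<omega> = Z' \<omega>" for P :: "'z measure" and Z Z'
  proof -
    have Z': "Z' \<in> measurable (completion P) K" using Z(1) by (rule measurable_completion)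
    have m: "Z \<in> measurable (completion P) K" by (rule measurable_completion_AE[OF Z' Z(2,3)])
    have "distr (completion P) K Z = distr (completion P) K Z'"
      by (rule distr_cong_AE[OF refl refl AE_completion[OF Z(3)] m Z'])
    then show ?thesis using m distr_completion[OF Z(1)] by simp
  qed
  show ?thesis unfolding eq_in_dist_def using d[OF X] d[OF Y] eq by simp
qed


subsection \<open>Taylor coefficients as measurable functionals of the values\<close>

text \<open>Divided Taylor remainders along the points 1 / (m + 1): the coefficient at 0 uses only
  countably many point values, so it is measurable for the product sigma-algebra.\<close>

fun tcoef :: "(complex \<Rightarrow> complex) \<Rightarrow> nat \<Rightarrow> complex" where
  "tcoef F n = lim (\<lambda>m. (F (1 / of_nat (Suc m)) - (\<Sum>k<n. tcoef F k * (1 / of_nat (Suc m)) ^ k)) * of_nat (Suc m) ^ n)"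

declare tcoef.simps [simp del]

lemma tcoef_eq:
  assumes r: "0 < r" and a: "\<And>x. norm x < r \<Longrightarrow> (\<lambda>n. a n * x ^ n) sums F x"
  shows "tcoef F n = a n"
proof (induction n rule: less_induct)
  case (less n)
  define x where "x m = 1 / complex_of_nat (Suc m)" for m
  define g where "g y = (F y - (\<Sum>k<n. a k * y ^ k)) / y ^ n" for y
  have "(g \<longlongrightarrow> a (0 + n)) (at 0)"
  proof (rule powser_limit_0_strong[OF r, where a = "\<lambda>k. a (k + n)"])
    fix y :: complex assume y: "y \<noteq> 0" "norm y < r"
    have "(\<lambda>k. a (k + n) * y ^ (k + n)) sums (F y - (\<Sum>k<n. a k * y ^ k))"
      by (rule sums_split_initial_segment[OF a[OF y(2)]])
    then have "(\<lambda>k. a (k + n) * y ^ (k + n) / y ^ n) sums g y"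
      unfolding g_def by (rule sums_divide)
    then show "(\<lambda>k. a (k + n) * y ^ k) sums g y" using y by (simp add: power_add)
  qed
  moreover have "filterlim x (at 0) sequentially"
    unfolding filterlim_at
  proof
    show "x \<longlonglongrightarrow> 0" unfolding x_def by (rule LIMSEQ_Suc[OF lim_1_over_n])
    show "\<forall>\<^sub>F m in sequentially. x m \<in> UNIV \<and> x m \<noteq> 0" by (simp add: x_def del: of_nat_Suc)
  qed
  ultimately have "(\<lambda>m. g (x m)) \<longlonglongrightarrow> a n" by (simp add: filterlim_compose)
  moreover have "(F (1 / of_nat (Suc m)) - (\<Sum>k<n. tcoef F k * (1 / of_nat (Suc m)) ^ k)) * of_nat (Suc m) ^ n = g (x m)" for m
  proof -
    have "(\<Sum>k<n. tcoef F k * (1 / of_nat (Suc m)) ^ k) = (\<Sum>k<n. a k * x m ^ k)"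
      using less by (intro sum.cong) (auto simp: x_def)
    then show ?thesis by (simp add: g_def x_def power_divide del: of_nat_Suc)
  qed
  ultimately show ?case unfolding tcoef.simps[of F n] by (simp add: limI del: of_nat_Suc)
qed

lemma tcoef_measurable:
  assumes "\<And>x. (\<lambda>\<omega>. F \<omega> x) \<in> borel_measurable P"
  shows "(\<lambda>\<omega>. tcoef (F \<omega>) n) \<in> borel_measurable P"
proof (induction n rule: less_induct)
  case (less n)
  show ?case unfolding tcoef.simps[of _ n]
    by (intro borel_measurable_lim_metric borel_measurable_times borel_measurable_diff borel_measurable_sum
        less assms borel_measurable_const) auto
qed

lemma tcoef_entire:
  assumes "F holomorphic_on UNIV" shows "(\<lambda>n. tcoef F n * z ^ n) sums F z"
proof -
  have s: "(\<lambda>n. (deriv ^^ n) F 0 / fact n * x ^ n) sums F x" for x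
    using holomorphic_power_series[of F 0 "norm x + 1" x] holomorphic_on_subset[OF assms] by simp
  have "tcoef F n = (deriv ^^ n) F 0 / fact n" for n
    by (rule tcoef_eq[of 1]) (use s in auto)
  with s show ?thesis by simp
qed

text \<open>Recovers the orthonormal coefficients from point values, so that laws of random entire
  functions become laws of sequences.\<close>

definition fcoef :: "(complex \<Rightarrow> complex) \<Rightarrow> nat \<Rightarrow> complex" where
  "fcoef F n = of_real (sqrt (fact n)) * tcoef F n"

lemma fcoef_fock:
  assumes "subexp c" shows "fcoef (fock c) = c"
proof
  fix n
  have "tcoef (fock c) n = c n / of_real (sqrt (fact n))"
    by (rule tcoef_eq[of 1]) (use fock_power_series[OF assms] in auto)
  then show "fcoef (fock c) n = c n" by (simp add: fcoef_def)
qed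

lemma fock_fcoef: "F holomorphic_on UNIV \<Longrightarrow> fock (fcoef F) = F"
  using tcoef_entire by (auto simp: fock_def fcoef_def sums_iff fun_eq_iff)

lemma fcoef_measurable: "fcoef \<in> measurable (\<Pi>\<^sub>M z\<in>UNIV. borel) (\<Pi>\<^sub>M n\<in>UNIV. borel)"
proof (rule measurable_PiM_single')
  have *: "(\<lambda>F :: complex \<Rightarrow> complex. F x) \<in> borel_measurable (\<Pi>\<^sub>M z\<in>UNIV. borel)" for x :: complex
    by (rule measurable_component_singleton) simp
  show "(\<lambda>F. fcoef F n) \<in> borel_measurable (\<Pi>\<^sub>M z\<in>UNIV. borel)" for n
    unfolding fcoef_def by (intro borel_measurable_times borel_measurable_const tcoef_measurable *)
qed auto

lemma measurable_subexp: "{c :: nat \<Rightarrow> complex. subexp c} \<in> sets (\<Pi>\<^sub>M n\<in>UNIV. borel)"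
proof -
  have [measurable]: "(\<lambda>c :: nat \<Rightarrow> complex. c n) \<in> borel_measurable (\<Pi>\<^sub>M n\<in>UNIV. borel)" for n
    by (rule measurable_component_singleton) simp
  have "{c \<in> space (\<Pi>\<^sub>M n\<in>UNIV. borel). \<forall>j::nat. \<exists>K::nat. \<forall>n. cmod (c n) \<le> real K * (1 + 1 / Suc j) ^ n} \<in> sets (\<Pi>\<^sub>M n\<in>UNIV. borel)"
    by measurable
  then show ?thesis by (simp add: subexp_def space_PiM)
qed


subsection \<open>Conditioning on a zero\<close>

lemma fock_0: "fock c 0 = c 0"
  using powser_zero[of "\<lambda>n. c n / of_real (sqrt (fact n))"] by (simp add: fock_def)

lemma trans_op_fock_series:
  assumes "subexp c"
  shows "trans_op b (fock c) z = (\<Sum>n. c n * (exp (z * cnj b - of_real ((norm b)\<^sup>2) / 2) * hk 0 (z - b) n))"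
proof -
  have "summable (\<lambda>n. c n * hk 0 (z - b) n)"
    using summable_norm_cancel[OF fock_summable[OF assms, of "z - b"]] by (simp add: hk_0)
  from suminf_mult[OF this, of "exp (z * cnj b - of_real ((norm b)\<^sup>2) / 2)"] show ?thesis
    unfolding trans_op_def fock_eq_hk by (simp add: mult_ac)
qed

lemma trans_kernel:
  fixes b :: complex
  defines "c \<equiv> \<lambda>z n. exp (z * cnj b - of_real ((norm b)\<^sup>2) / 2) * hk 0 (z - b) n"
  shows "(\<Sum>n. c z n * cnj (c w n)) = exp (z * cnj w)"
proof -
  let ?e = "\<lambda>z. exp (z * cnj b - of_real ((norm b)\<^sup>2) / 2)"
  have geo: "geom (hk 0 x)" for x :: complex by (rule geom_hk) simp
  have sm: "summable (\<lambda>n. hk 0 (z - b) n * cnj (hk 0 (w - b) n))"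
    by (rule summable_norm_cancel[OF geom_summable_norm_sq[OF geo geo]])
  have "(\<Sum>n. c z n * cnj (c w n)) = (\<Sum>n. ?e z * cnj (?e w) * (hk 0 (z - b) n * cnj (hk 0 (w - b) n)))"
    by (simp add: c_def mult_ac)
  also have "\<dots> = ?e z * cnj (?e w) * exp ((z - b) * cnj (w - b))"
    unfolding suminf_mult[OF sm] hk_0_kernel ..
  also have "\<dots> = exp ((z * cnj b - of_real ((norm b)\<^sup>2) / 2) + cnj (w * cnj b - of_real ((norm b)\<^sup>2) / 2) + (z - b) * cnj (w - b))"
    by (simp only: exp_add exp_cnj)
  also have "(z * cnj b - of_real ((norm b)\<^sup>2) / 2) + cnj (w * cnj b - of_real ((norm b)\<^sup>2) / 2) + (z - b) * cnj (w - b) = z * cnj w"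
    unfolding complex_norm_square by (simp add: algebra_simps)
  finally show ?thesis .
qed

context
  fixes M :: "'a measure" and \<xi> :: "nat \<Rightarrow> 'a \<Rightarrow> complex"
  assumes iid: "iid_std_complex_gaussian M \<xi>"
begin

interpretation prob_space M
  using iid by (simp add: iid_std_complex_gaussian_def)

lemmas [measurable] = xi_measurable[OF iid]

lemma gaf_measurable [measurable]: "(\<lambda>\<omega>. gaf \<xi> \<omega> z) \<in> borel_measurable M"
  unfolding gaf_def by measurable

lemma trans_gaf_measurable [measurable]: "(\<lambda>\<omega>. trans_op b (gaf \<xi> \<omega>) z) \<in> borel_measurable M"
  unfolding trans_op_def by (intro borel_measurable_times borel_measurable_const gaf_measurable)

text \<open>At 0 the function translated by -a equals exp(-|a|^2/2) G(a), so the event is a disk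
  event for the translated series at 0. Invariance of the law replaces that series by the original,
  whose value at 0 is \<xi>_0; this is where conditioning at \<open>a\<close> becomes conditioning
  on one coefficient.\<close>

lemma conditioned_expectation:
  fixes J :: "complex set" and l :: "complex \<Rightarrow> complex"
  assumes J: "finite J"
  defines "e \<equiv> \<lambda>n. \<Sum>z\<in>J. l z * hk 0 z n"
  shows "(\<integral>\<omega>. indicator {\<omega> \<in> space M. cmod (gaf \<xi> \<omega> a) < \<epsilon>} \<omega> * iexp (Re (\<Sum>z\<in>J. l z * trans_op (- a) (gaf \<xi> \<omega>) z)) \<partial>M) =
    (\<integral>\<omega>. indicator (ball 0 (\<epsilon> * exp (- ((norm a)\<^sup>2) / 2))) (\<xi> 0 \<omega>) * iexp (Re (e 0 * \<xi> 0 \<omega>)) \<partial>M) *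
    exp (- of_real (\<Sum>n. (norm (e (Suc n)))\<^sup>2 / 4))"
proof -
  define \<delta> where "\<delta> = \<epsilon> * exp (- ((norm a)\<^sup>2) / 2)"
  define c where "c z n = exp (z * cnj (- a) - of_real ((norm (- a))\<^sup>2) / 2) * hk 0 (z - (- a)) n" for z n
  \<comment> \<open>The indicator and the exponential form one functional of the values, so equality
    of laws is applied to both at once.\<close>
  define \<Psi> where "\<Psi> x = indicator (ball 0 \<delta>) (x 0) * iexp (Re (\<Sum>z\<in>J. l z * x z))" for x :: "complex \<Rightarrow> complex"
  have geo: "geom (hk 0 x)" for x :: complex by (rule geom_hk) simp
  have gc: "geom (c z)" for z unfolding c_def by (rule geom_cmult[OF geo])
  have cm: "(\<lambda>x :: complex \<Rightarrow> complex. x z) \<in> borel_measurable (\<Pi>\<^sub>M z\<in>UNIV. borel)" for z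
    by (rule measurable_component_singleton) simp
  have "(\<lambda>x :: complex \<Rightarrow> complex. indicator (ball 0 \<delta>) (x 0) :: complex) \<in> borel_measurable (\<Pi>\<^sub>M z\<in>UNIV. borel)"
  proof -
    have "(indicator (ball 0 \<delta>) :: complex \<Rightarrow> complex) \<in> borel_measurable borel"
      by (rule borel_measurable_indicator) simp
    from measurable_compose[OF cm this] show ?thesis .
  qed
  moreover have "(\<lambda>x :: complex \<Rightarrow> complex. \<Sum>z\<in>J. l z * x z) \<in> borel_measurable (\<Pi>\<^sub>M z\<in>UNIV. borel)"
    by (intro borel_measurable_sum borel_measurable_times borel_measurable_const cm)
  from measurable_compose[OF this, of "\<lambda>w. iexp (Re w)"]
  have "(\<lambda>x :: complex \<Rightarrow> complex. iexp (Re (\<Sum>z\<in>J. l z * x z))) \<in> borel_measurable (\<Pi>\<^sub>M z\<in>UNIV. borel)" by simp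
  ultimately have \<Psi>m: "\<Psi> \<in> borel_measurable (\<Pi>\<^sub>M z\<in>UNIV. borel)"
    unfolding \<Psi>_def by (rule borel_measurable_times)
  have m: "(\<lambda>\<omega> z. \<Sum>n. \<xi> n \<omega> * d z n) \<in> measurable M (\<Pi>\<^sub>M z\<in>UNIV. borel)" for d :: "complex \<Rightarrow> nat \<Rightarrow> complex"
    by (rule measurable_PiM_single') auto
  have 1: "trans_op (- a) F 0 = of_real (exp (- ((norm a)\<^sup>2) / 2)) * F a" for F
    by (simp add: trans_op_def exp_of_real[symmetric])
  have "(\<integral>\<omega>. indicator {\<omega> \<in> space M. cmod (gaf \<xi> \<omega> a) < \<epsilon>} \<omega> * iexp (Re (\<Sum>z\<in>J. l z * trans_op (- a) (gaf \<xi> \<omega>) z)) \<partial>M) =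
     (\<integral>\<omega>. \<Psi> (trans_op (- a) (gaf \<xi> \<omega>)) \<partial>M)"
  proof (rule Bochner_Integration.integral_cong[OF refl])
    fix \<omega> assume "\<omega> \<in> space M"
    moreover have "cmod (trans_op (- a) (gaf \<xi> \<omega>) 0) < \<delta> \<longleftrightarrow> cmod (gaf \<xi> \<omega> a) < \<epsilon>"
      unfolding 1 \<delta>_def norm_mult norm_of_real by simp
    ultimately show "indicator {\<omega> \<in> space M. cmod (gaf \<xi> \<omega> a) < \<epsilon>} \<omega> * iexp (Re (\<Sum>z\<in>J. l z * trans_op (- a) (gaf \<xi> \<omega>) z)) = \<Psi> (trans_op (- a) (gaf \<xi> \<omega>))"
      by (simp add: \<Psi>_def indicator_def)
  qed
  also have "\<dots> = (\<integral>\<omega>. \<Psi> (\<lambda>z. \<Sum>n. \<xi> n \<omega> * c z n) \<partial>M)"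
  proof (rule integral_cong_AE)
    show "(\<lambda>\<omega>. \<Psi> (trans_op (- a) (gaf \<xi> \<omega>))) \<in> borel_measurable M"
    proof (rule measurable_compose[OF _ \<Psi>m])
      show "(\<lambda>\<omega>. trans_op (- a) (gaf \<xi> \<omega>)) \<in> measurable M (\<Pi>\<^sub>M z\<in>UNIV. borel)"
        by (rule measurable_PiM_single') (auto intro: trans_gaf_measurable)
    qed
    show "(\<lambda>\<omega>. \<Psi> (\<lambda>z. \<Sum>n. \<xi> n \<omega> * c z n)) \<in> borel_measurable M"
      by (rule measurable_compose[OF m \<Psi>m])
    show "AE \<omega> in M. \<Psi> (trans_op (- a) (gaf \<xi> \<omega>)) = \<Psi> (\<lambda>z. \<Sum>n. \<xi> n \<omega> * c z n)"
      using AE_subexp[OF iid]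
    proof eventually_elim
      case (elim \<omega>)
      have "trans_op (- a) (gaf \<xi> \<omega>) = (\<lambda>z. \<Sum>n. \<xi> n \<omega> * c z n)"
        unfolding gaf_eq_fock c_def by (rule ext, rule trans_op_fock_series[OF elim])
      then show ?case by simp
    qed
  qed
  also have "\<dots> = (\<integral>x. \<Psi> x \<partial>distr M (\<Pi>\<^sub>M z\<in>UNIV. borel) (\<lambda>\<omega> z. \<Sum>n. \<xi> n \<omega> * c z n))"
    by (rule integral_distr[symmetric, OF m \<Psi>m])
  also have "distr M (\<Pi>\<^sub>M z\<in>UNIV. borel) (\<lambda>\<omega> z. \<Sum>n. \<xi> n \<omega> * c z n) = distr M (\<Pi>\<^sub>M z\<in>UNIV. borel) (\<lambda>\<omega> z. \<Sum>n. \<xi> n \<omega> * hk 0 z n)"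
    by (rule gaussian_series_law[OF iid gc geo]) (simp only: c_def trans_kernel hk_0_kernel)
  also have "(\<integral>x. \<Psi> x \<partial>distr M (\<Pi>\<^sub>M z\<in>UNIV. borel) (\<lambda>\<omega> z. \<Sum>n. \<xi> n \<omega> * hk 0 z n)) = (\<integral>\<omega>. \<Psi> (\<lambda>z. \<Sum>n. \<xi> n \<omega> * hk 0 z n) \<partial>M)"
    by (rule integral_distr[OF m \<Psi>m])
  also have "\<dots> = (\<integral>\<omega>. indicator (ball 0 \<delta>) (\<xi> 0 \<omega>) * iexp (Re (\<Sum>n. \<xi> n \<omega> * e n)) \<partial>M)"
  proof (rule integral_cong_AE)
    show "(\<lambda>\<omega>. \<Psi> (\<lambda>z. \<Sum>n. \<xi> n \<omega> * hk 0 z n)) \<in> borel_measurable M"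
      by (rule measurable_compose[OF m \<Psi>m])
    show "AE \<omega> in M. \<Psi> (\<lambda>z. \<Sum>n. \<xi> n \<omega> * hk 0 z n) = indicator (ball 0 \<delta>) (\<xi> 0 \<omega>) * iexp (Re (\<Sum>n. \<xi> n \<omega> * e n))"
      using gaussian_series_linear_comb[OF iid, where c = "hk 0" and l = l, OF geo J]
    proof eventually_elim
      case (elim \<omega>)
      have "(\<Sum>n. \<xi> n \<omega> * hk 0 0 n) = \<xi> 0 \<omega>"
        using fock_0[of "\<lambda>n. \<xi> n \<omega>"] by (simp add: fock_eq_hk)
      then show ?case unfolding \<Psi>_def elim e_def by simp
    qed
    have "(\<lambda>\<omega>. indicator (ball 0 \<delta>) (\<xi> 0 \<omega>) :: complex) \<in> borel_measurable M"
      by (rule measurable_compose[OF xi_measurable[OF iid]], rule borel_measurable_indicator) simp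
    then show "(\<lambda>\<omega>. indicator (ball 0 \<delta>) (\<xi> 0 \<omega>) * iexp (Re (\<Sum>n. \<xi> n \<omega> * e n))) \<in> borel_measurable M"
      by (rule borel_measurable_times) measurable
  qed
  also have "\<dots> = (\<integral>\<omega>. indicator (ball 0 \<delta>) (\<xi> 0 \<omega>) * iexp (Re (e 0 * \<xi> 0 \<omega>)) \<partial>M) * exp (- of_real (\<Sum>n. (norm (e (Suc n)))\<^sup>2 / 4))"
    by (rule gaussian_series_char[OF iid]) (auto simp: e_def indicator_def intro!: geom_sum J geom_cmult geo)
  finally show ?thesis unfolding \<delta>_def .
qed

text \<open>Both sides have characteristic functional \<open>q\<close>. For \<open>H\<close> it is
  the limit of the conditional ones: in terms of \<xi>_0 the event is a disk of radius proportional
  to \<epsilon>, so the factor carried by \<xi>_0 tends to 1, while the other factor does not depend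
  on \<epsilon>.\<close>

lemma conditioned_law:
  assumes H: "conditioned_on_zero M (gaf \<xi>) a N H"
  shows "distr N (\<Pi>\<^sub>M z\<in>UNIV. borel) (\<lambda>\<omega> z. trans_op (- a) (H \<omega>) z) =
    distr M (\<Pi>\<^sub>M z\<in>UNIV. borel) (\<lambda>\<omega> z. \<Sum>n. \<xi> n \<omega> * (if n = 0 then 0 else hk 0 z n))"
proof (rule law_eqI)
  show N: "prob_space N" using H by (simp add: conditioned_on_zero_def)
  show "prob_space M" by (rule prob_space_axioms)
  have Hm [measurable]: "(\<lambda>\<omega>. H \<omega> z) \<in> borel_measurable N" for z using H by (simp add: conditioned_on_zero_def)
  show tm: "(\<lambda>\<omega>. trans_op (- a) (H \<omega>) z) \<in> borel_measurable N" for z unfolding trans_op_def by measurable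
  show "(\<lambda>\<omega>. \<Sum>n. \<xi> n \<omega> * (if n = 0 then 0 else hk 0 z n)) \<in> borel_measurable M" for z by measurable
  fix J and l :: "complex \<Rightarrow> complex"
  assume J: "finite (J :: complex set)"
  define e where "e n = (\<Sum>z\<in>J. l z * hk 0 z n)" for n
  define q where "q = exp (- complex_of_real (\<Sum>n. (norm (e (Suc n)))\<^sup>2 / 4))"
  have geo: "geom (hk 0 x)" for x :: complex by (rule geom_hk) simp
  have ge: "geom e" unfolding e_def by (intro geom_sum J geom_cmult geo)
  have Q: "(\<integral>\<omega>. iexp (Re (\<Sum>z\<in>J. l z * (\<Sum>n. \<xi> n \<omega> * (if n = 0 then 0 else hk 0 z n)))) \<partial>M) = q"
  proof -
    define d where "d z n = (if n = 0 then 0 else hk 0 z n)" for z :: complex and n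
    have gd: "geom (d z)" for z by (rule geom_mono[OF geo[of z]]) (simp add: d_def)
    define e' where "e' n = (\<Sum>z\<in>J. l z * d z n)" for n
    have ge': "geom e'" unfolding e'_def by (intro geom_sum J geom_cmult gd)
    have "(\<integral>\<omega>. iexp (Re (\<Sum>z\<in>J. l z * (\<Sum>n. \<xi> n \<omega> * d z n))) \<partial>M) = (\<integral>\<omega>. iexp (Re (\<Sum>n. \<xi> n \<omega> * e' n)) \<partial>M)"
    proof (rule integral_cong_AE)
      show "AE \<omega> in M. iexp (Re (\<Sum>z\<in>J. l z * (\<Sum>n. \<xi> n \<omega> * d z n))) = iexp (Re (\<Sum>n. \<xi> n \<omega> * e' n))"
        using gaussian_series_linear_comb[OF iid, where c = d and l = l, OF gd J]
        by eventually_elim (simp only: e'_def)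
    qed measurable
    also have "\<dots> = q"
    proof -
      have e': "e' (Suc n) = e (Suc n)" "e' 0 = 0" for n by (simp_all add: e_def e'_def d_def)
      have "summable (\<lambda>n. (norm (e' n))\<^sup>2 / 4)"
        using geom_summable_norm_sq[OF ge' ge'] by (intro summable_divide) (simp add: norm_mult power2_eq_square)
      from suminf_split_head[OF this] have "(\<Sum>n. (norm (e' n))\<^sup>2 / 4) = (\<Sum>n. (norm (e (Suc n)))\<^sup>2 / 4)"
        by (simp add: e')
      then show ?thesis unfolding gaussian_series_char_total[OF iid ge'] q_def by simp
    qed
    finally show ?thesis unfolding d_def .
  qed
  define S where "S \<epsilon> = {\<omega> \<in> space M. cmod (gaf \<xi> \<omega> a) < \<epsilon>}" for \<epsilon>
  have Sm [measurable]: "S \<epsilon> \<in> sets M" for \<epsilon> unfolding S_def by measurable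
  define \<kappa> where "\<kappa> = exp (- ((norm a)\<^sup>2) / 2)"
  have \<kappa>: "0 < \<kappa>" by (simp add: \<kappa>_def)
  have mS: "measure M (S \<epsilon>) = measure M {\<omega> \<in> space M. cmod (\<xi> 0 \<omega>) < \<epsilon> * \<kappa>}"
      and mS0: "0 < \<epsilon> \<Longrightarrow> 0 < measure M (S \<epsilon>)" for \<epsilon>
  proof -
    have "complex_of_real (measure M (S \<epsilon>)) = (\<integral>\<omega>. of_real (indicator (S \<epsilon>) \<omega>) \<partial>M)" by simp
    \<comment> \<open>\<open>conditioned_expectation\<close> with no evaluation points gives the
      probability of the event itself.\<close>
    also have "\<dots> = (\<integral>\<omega>. indicator (S \<epsilon>) \<omega> * iexp (Re (\<Sum>z\<in>{}. 0 * trans_op (- a) (gaf \<xi> \<omega>) z)) \<partial>M)"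
      by (intro Bochner_Integration.integral_cong) (auto simp: indicator_def)
    also have "\<dots> = (\<integral>\<omega>. indicator (ball 0 (\<epsilon> * \<kappa>)) (\<xi> 0 \<omega>) \<partial>M)"
      unfolding S_def conditioned_expectation[OF finite.emptyI] by (simp add: \<kappa>_def)
    also have "\<dots> = (\<integral>\<omega>. of_real (indicator {\<omega> \<in> space M. cmod (\<xi> 0 \<omega>) < \<epsilon> * \<kappa>} \<omega>) \<partial>M)"
      by (intro Bochner_Integration.integral_cong) (auto simp: indicator_def)
    finally show eq: "measure M (S \<epsilon>) = measure M {\<omega> \<in> space M. cmod (\<xi> 0 \<omega>) < \<epsilon> * \<kappa>}" by simp
    show "0 < \<epsilon> \<Longrightarrow> 0 < measure M (S \<epsilon>)"
      unfolding eq using \<kappa> by (intro prob_xi_ball_pos[OF iid]) simp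
  qed
  define G where "G \<omega> = iexp (Re (\<Sum>z\<in>J. l z * trans_op (- a) (gaf \<xi> \<omega>) z))" for \<omega>
  have Gm [measurable]: "G \<in> borel_measurable M" 
  proof -
    have "(\<lambda>\<omega>. \<Sum>z\<in>J. l z * trans_op (- a) (gaf \<xi> \<omega>) z) \<in> borel_measurable M"
      by (intro borel_measurable_sum borel_measurable_times borel_measurable_const trans_gaf_measurable)
    from measurable_compose[OF this, of "\<lambda>w. iexp (Re w)"] show ?thesis unfolding G_def by simp
  qed
  define L where "L \<epsilon> = (\<integral>\<omega>. G \<omega> \<partial>uniform_measure M (S \<epsilon>))" for \<epsilon>
  \<comment> \<open>The error is linear in \<epsilon>, from |exp(\<i> x) - 1| \<le> |x| on the event
    |\<xi>_0| < \<epsilon> \<kappa>; the probability \<open>m\<close> cancels.\<close>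
  have Lb: "norm (L \<epsilon> - q) \<le> (norm (e 0) * \<kappa> * norm q) * \<epsilon>" if \<epsilon>: "0 < \<epsilon>" for \<epsilon>
  proof -
    define m where "m = measure M (S \<epsilon>)"
    define B where "B = {\<omega> \<in> space M. cmod (\<xi> 0 \<omega>) < \<epsilon> * \<kappa>}"
    have [measurable]: "B \<in> sets M" unfolding B_def by measurable
    have m: "0 < m" "m = measure M B" using mS0[OF \<epsilon>] mS[of \<epsilon>] by (auto simp: m_def B_def)
    define I where "I = (\<integral>\<omega>. indicator B \<omega> * iexp (Re (e 0 * \<xi> 0 \<omega>)) \<partial>M)"
    have "(\<integral>\<omega>. indicator (ball 0 (\<epsilon> * \<kappa>)) (\<xi> 0 \<omega>) * iexp (Re (e 0 * \<xi> 0 \<omega>)) \<partial>M) = I"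
      unfolding I_def B_def by (intro Bochner_Integration.integral_cong) (auto simp: indicator_def)
    then have L: "L \<epsilon> = I * q / of_real m"
      unfolding L_def integral_uniform_measure[OF prob_space_axioms Sm mS0[OF \<epsilon>] Gm] m_def G_def
      by (simp only: S_def conditioned_expectation[OF J] q_def e_def \<kappa>_def)
    have int1: "integrable M (\<lambda>\<omega>. indicator B \<omega> * iexp (Re (e 0 * \<xi> 0 \<omega>)))"
      by (rule integrable_bounded_prob[OF prob_space_axioms, of _ 1]) (auto simp: indicator_def norm_mult)
    have int2: "integrable M (\<lambda>\<omega>. indicator B \<omega> :: complex)"
      by (rule integrable_bounded_prob[OF prob_space_axioms, of _ 1]) (auto simp: indicator_def)
    have "I - of_real m = (\<integral>\<omega>. indicator B \<omega> * iexp (Re (e 0 * \<xi> 0 \<omega>)) - indicator B \<omega> \<partial>M)"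
    proof -
      have "(\<integral>\<omega>. indicator B \<omega> \<partial>M) = (\<integral>\<omega>. complex_of_real (indicator B \<omega>) \<partial>M)"
        by (intro Bochner_Integration.integral_cong) (auto simp: indicator_def)
      then show ?thesis unfolding I_def m(2) by (subst Bochner_Integration.integral_diff[OF int1 int2]) simp
    qed
    also have "norm \<dots> \<le> (\<integral>\<omega>. (norm (e 0) * (\<epsilon> * \<kappa>)) * indicator B \<omega> \<partial>M)"
    proof (rule order_trans[OF integral_norm_bound], rule Bochner_Integration.integral_mono)
      show "integrable M (\<lambda>\<omega>. norm (indicator B \<omega> * iexp (Re (e 0 * \<xi> 0 \<omega>)) - indicator B \<omega>))"
        by (intro integrable_norm Bochner_Integration.integrable_diff int1 int2)
      show "integrable M (\<lambda>\<omega>. (norm (e 0) * (\<epsilon> * \<kappa>)) * indicator B \<omega>)"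
        by (intro integrable_mult_right) (simp add: emeasure_eq_measure)
      fix \<omega>
      show "norm (indicator B \<omega> * iexp (Re (e 0 * \<xi> 0 \<omega>)) - indicator B \<omega>) \<le> (norm (e 0) * (\<epsilon> * \<kappa>)) * indicator B \<omega>"
      proof (cases "\<omega> \<in> B")
        case True
        have "norm (iexp (Re (e 0 * \<xi> 0 \<omega>)) - 1) \<le> \<bar>Re (e 0 * \<xi> 0 \<omega>)\<bar>"
          using iexp_approx1[of "Re (e 0 * \<xi> 0 \<omega>)" 0] by simp
        also have "\<dots> \<le> norm (e 0) * norm (\<xi> 0 \<omega>)" unfolding norm_mult[symmetric] by (rule abs_Re_le_cmod)
        also have "\<dots> \<le> norm (e 0) * (\<epsilon> * \<kappa>)" using True by (intro mult_left_mono) (auto simp: B_def)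
        finally show ?thesis using True by simp
      qed simp
    qed
    also have "\<dots> = norm (e 0) * (\<epsilon> * \<kappa>) * m" by (simp add: m(2))
    finally have b: "norm (I - of_real m) \<le> norm (e 0) * (\<epsilon> * \<kappa>) * m" .
    have "L \<epsilon> - q = (I - of_real m) * q / of_real m" using m unfolding L by (simp add: field_simps)
    then have "norm (L \<epsilon> - q) = norm (I - of_real m) * norm q / m" using m(1) by (simp add: norm_mult norm_divide)
    also have "\<dots> \<le> (norm (e 0) * (\<epsilon> * \<kappa>) * m) * norm q / m"
      using m(1) by (intro divide_right_mono mult_right_mono b) auto
    also have "\<dots> = (norm (e 0) * \<kappa> * norm q) * \<epsilon>" using m(1) by simp
    finally show ?thesis .
  qed
  have pos: "\<forall>\<^sub>F \<epsilon> in at_right 0. 0 < (\<epsilon> :: real)" by (simp add: eventually_at_right_less)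
  have Llim: "(L \<longlongrightarrow> q) (at_right 0)"
  proof (rule LIM_zero_cancel, rule Lim_null_comparison)
    show "\<forall>\<^sub>F \<epsilon> in at_right 0. norm (L \<epsilon> - q) \<le> (norm (e 0) * \<kappa> * norm q) * \<epsilon>"
      using pos by eventually_elim (rule Lb)
    show "((\<lambda>\<epsilon>. (norm (e 0) * \<kappa> * norm q) * \<epsilon>) \<longlongrightarrow> 0) (at_right 0)"
      by (rule tendsto_eq_intros | simp)+
  qed
  \<comment> \<open>The conditioning is stated for sequences of points, so \<open>J\<close> is
    enumerated; each point is shifted by \<open>a\<close> because \<open>trans_op (- a)\<close>
    evaluates there.\<close>
  obtain g :: "nat \<Rightarrow> complex" where g: "bij_betw g {..<card J} J"
    using ex_bij_betw_nat_finite[OF J] by (auto simp: atLeast0LessThan)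
  define pt where "pt i = g i - (- a)" for i
  define \<Phi> where "\<Phi> x = iexp (Re (\<Sum>i<card J. l (g i) * (exp (g i * cnj (- a) - of_real ((norm (- a))\<^sup>2) / 2) * x i)))" for x :: "nat \<Rightarrow> complex"
  have \<Phi>: "\<Phi> (\<lambda>i. F (pt i)) = iexp (Re (\<Sum>z\<in>J. l z * trans_op (- a) F z))" for F
    unfolding \<Phi>_def pt_def trans_op_def[symmetric] sum.reindex_bij_betw[OF g, of "\<lambda>z. l z * trans_op (- a) F z"] ..
  have \<Phi>c: "continuous_on UNIV \<Phi>" unfolding \<Phi>_def by (intro continuous_intros) auto
  define K where "K = (\<integral>\<omega>. \<Phi> (\<lambda>i. H \<omega> (pt i)) \<partial>N)"
  have iN: "integrable N (\<lambda>\<omega>. \<Phi> (\<lambda>i. H \<omega> (pt i)))"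
    by (rule integrable_bounded_prob[OF N, of _ 1]) (auto simp: \<Phi>_def)
  have iU: "integrable (uniform_measure M (S \<epsilon>)) G" if "0 < \<epsilon>" for \<epsilon>
  proof (rule integrable_bounded_prob[of _ _ 1])
    show "prob_space (uniform_measure M (S \<epsilon>))"
      by (rule prob_space_uniform_measure) (use mS0[OF that] in \<open>auto simp: emeasure_eq_measure\<close>)
    show "norm (G x) \<le> 1" for x by (simp add: G_def)
  qed (simp add: Gm)
  \<comment> \<open>Test functions in the definition of the conditioning are real, hence the
    separate passage for real and imaginary parts.\<close>
  have lim: "((\<lambda>\<epsilon>. \<integral>\<omega>. h (\<Phi> (\<lambda>i. gaf \<xi> \<omega> (pt i))) \<partial>uniform_measure M (S \<epsilon>)) \<longlongrightarrow> (\<integral>\<omega>. h (\<Phi> (\<lambda>i. H \<omega> (pt i))) \<partial>N)) (at_right 0)"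
    if h: "continuous_on UNIV h" "\<And>x. \<bar>h x\<bar> \<le> norm x" for h :: "complex \<Rightarrow> real"
  proof -
    have "continuous_on UNIV (\<lambda>x. h (\<Phi> x))" using continuous_on_compose2[OF h(1) \<Phi>c] by simp
    moreover have "bounded (range (\<lambda>x. h (\<Phi> x)))"
    proof (rule boundedI[of _ 1])
      fix y assume "y \<in> range (\<lambda>x. h (\<Phi> x))"
      then obtain x where "y = h (\<Phi> x)" by auto
      then show "norm y \<le> 1" using h(2)[of "\<Phi> x"] by (simp add: \<Phi>_def)
    qed
    ultimately show ?thesis using H unfolding conditioned_on_zero_def S_def by blast
  qed
  have "((\<lambda>\<epsilon>. Re (L \<epsilon>)) \<longlongrightarrow> Re K) (at_right 0)"
  proof -
    have "\<forall>\<^sub>F \<epsilon> in at_right 0. (\<integral>\<omega>. Re (\<Phi> (\<lambda>i. gaf \<xi> \<omega> (pt i))) \<partial>uniform_measure M (S \<epsilon>)) = Re (L \<epsilon>)"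
      using pos by eventually_elim (simp only: L_def \<Phi> G_def[symmetric] integral_Re[OF iU])
    from tendsto_cong[THEN iffD1, OF this lim[of Re]] show ?thesis
      unfolding K_def integral_Re[OF iN, symmetric] by (simp add: continuous_intros abs_Re_le_cmod)
  qed
  moreover have "((\<lambda>\<epsilon>. Im (L \<epsilon>)) \<longlongrightarrow> Im K) (at_right 0)"
  proof -
    have "\<forall>\<^sub>F \<epsilon> in at_right 0. (\<integral>\<omega>. Im (\<Phi> (\<lambda>i. gaf \<xi> \<omega> (pt i))) \<partial>uniform_measure M (S \<epsilon>)) = Im (L \<epsilon>)"
      using pos by eventually_elim (simp only: L_def \<Phi> G_def[symmetric] integral_Im[OF iU])
    from tendsto_cong[THEN iffD1, OF this lim[of Im]] show ?thesis
      unfolding K_def integral_Im[OF iN, symmetric] by (simp add: continuous_intros abs_Im_le_cmod)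
  qed
  ultimately have "(L \<longlongrightarrow> K) (at_right 0)" by (simp add: tendsto_complex_iff)
  then have "K = q" using Llim by (rule tendsto_unique[OF trivial_limit_at_right_real])
  then show "(\<integral>\<omega>. iexp (Re (\<Sum>z\<in>J. l z * trans_op (- a) (H \<omega>) z)) \<partial>N) =
      (\<integral>\<omega>. iexp (Re (\<Sum>z\<in>J. l z * (\<Sum>n. \<xi> n \<omega> * (if n = 0 then 0 else hk 0 z n)))) \<partial>M)"
    unfolding Q K_def \<Phi> .
qed

text \<open>From here on the conditioned function is represented by a coefficient sequence,
  distributed as that of the GAF with entry 0 set to zero. The entry at index 1 being nonzero is the
  simplicity of the zero.\<close>

lemma conditioned_coefficients:
  assumes H: "conditioned_on_zero M (gaf \<xi>) a N H"
  defines "C \<equiv> \<lambda>\<omega>. fcoef (trans_op (- a) (H \<omega>))"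
  shows "C \<in> measurable N (\<Pi>\<^sub>M n\<in>UNIV. borel)"
    and "distr N (\<Pi>\<^sub>M n\<in>UNIV. borel) C = distr M (\<Pi>\<^sub>M n\<in>UNIV. borel) (\<lambda>\<omega> n. if n = 0 then 0 else \<xi> n \<omega>)"
    and "AE \<omega> in N. subexp (C \<omega>) \<and> C \<omega> 0 = 0 \<and> C \<omega> 1 \<noteq> 0 \<and> H \<omega> = trans_op a (fock (C \<omega>))"
proof -
  define X where "X \<omega> n = (if n = 0 then 0 else \<xi> n \<omega>)" for \<omega> n
  let ?P = "\<Pi>\<^sub>M z\<in>(UNIV :: complex set). (borel :: complex measure)"
  let ?Q = "\<Pi>\<^sub>M n\<in>(UNIV :: nat set). (borel :: complex measure)"
  have [measurable]: "(\<lambda>\<omega>. H \<omega> z) \<in> borel_measurable N" for z using H by (simp add: conditioned_on_zero_def)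
  have m1: "(\<lambda>\<omega> z. trans_op (- a) (H \<omega>) z) \<in> measurable N ?P"
    by (rule measurable_PiM_single') (auto simp: trans_op_def)
  have m2: "(\<lambda>\<omega> z. \<Sum>n. \<xi> n \<omega> * (if n = 0 then 0 else hk 0 z n)) \<in> measurable M ?P"
    by (rule measurable_PiM_single') auto
  have m3: "X \<in> measurable M ?Q"
  proof (rule measurable_PiM_single')
    show "(\<lambda>\<omega>. X \<omega> n) \<in> borel_measurable M" for n unfolding X_def by (cases "n = 0") auto
  qed auto
  show mC: "C \<in> measurable N ?Q"
    unfolding C_def using measurable_compose[OF m1 fcoef_measurable] by simp
  have Xs: "subexp (X \<omega>)" if sub: "subexp (\<lambda>n. \<xi> n \<omega>)" for \<omega>
  proof (rule subexpI)
    fix t :: real assume "1 < t"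
    then obtain K where "0 \<le> K" "\<And>n. norm (\<xi> n \<omega>) \<le> K * t ^ n" using subexp_bound[OF sub] by blast
    with \<open>1 < t\<close> show "\<exists>K. \<forall>n. norm (X \<omega> n) \<le> K * t ^ n" by (intro exI[of _ K]) (auto simp: X_def)
  qed
  have "distr N ?Q C = distr (distr N ?P (\<lambda>\<omega> z. trans_op (- a) (H \<omega>) z)) ?Q fcoef"
    by (subst distr_distr[OF fcoef_measurable m1]) (simp add: C_def o_def)
  also have "\<dots> = distr M ?Q (\<lambda>\<omega>. fcoef (\<lambda>z. \<Sum>n. \<xi> n \<omega> * (if n = 0 then 0 else hk 0 z n)))"
    unfolding conditioned_law[OF H] by (subst distr_distr[OF fcoef_measurable m2]) (simp add: o_def)
  also have "\<dots> = distr M ?Q X"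
  proof (rule distr_cong_AE[OF refl refl _ _ m3])
    show "(\<lambda>\<omega>. fcoef (\<lambda>z. \<Sum>n. \<xi> n \<omega> * (if n = 0 then 0 else hk 0 z n))) \<in> measurable M ?Q"
      by (rule measurable_compose[OF m2 fcoef_measurable])
    show "AE \<omega> in M. fcoef (\<lambda>z. \<Sum>n. \<xi> n \<omega> * (if n = 0 then 0 else hk 0 z n)) = X \<omega>"
      using AE_subexp[OF iid]
    proof eventually_elim
      case (elim \<omega>)
      have "(\<lambda>z. \<Sum>n. \<xi> n \<omega> * (if n = 0 then 0 else hk 0 z n)) = fock (X \<omega>)"
        unfolding fock_eq_hk[abs_def] by (intro ext suminf_cong) (auto simp: X_def)
      then show ?case using fcoef_fock[OF Xs[OF elim]] by simp
    qed
  qed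
  finally show D: "distr N ?Q C = distr M ?Q (\<lambda>\<omega> n. if n = 0 then 0 else \<xi> n \<omega>)" by (simp add: X_def[abs_def])
  have cm: "(\<lambda>c :: nat \<Rightarrow> complex. c n) \<in> borel_measurable ?Q" for n by (rule measurable_component_singleton) simp
  have good: "{c \<in> space ?Q. subexp c \<and> c 0 = 0 \<and> c 1 \<noteq> 0} \<in> sets ?Q"
  proof -
    note cm [measurable]
    have "{c :: nat \<Rightarrow> complex. subexp c} \<inter> {c \<in> space ?Q. c 0 = 0 \<and> c 1 \<noteq> 0} \<in> sets ?Q"
      by (intro sets.Int measurable_subexp) measurable
    then show ?thesis by (rule back_subst[where P = "\<lambda>S. S \<in> sets ?Q"]) auto
  qed
  have "AE \<omega> in M. subexp (X \<omega>) \<and> X \<omega> 0 = 0 \<and> X \<omega> 1 \<noteq> 0"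
    using AE_subexp[OF iid] AE_xi_nonzero[OF iid, of 1] by eventually_elim (auto intro: Xs simp: X_def)
  \<comment> \<open>Almost sure properties of the sequence depend only on its law, so they pass from
    \<open>M\<close> to \<open>N\<close> through a measurable set of sequences.\<close>
  then have "AE c in distr M ?Q X. subexp c \<and> c 0 = 0 \<and> c 1 \<noteq> 0"
    by (subst AE_distr_iff[OF m3 good])
  then have "AE c in distr N ?Q C. subexp c \<and> c 0 = 0 \<and> c 1 \<noteq> 0"
    unfolding D X_def[abs_def] .
  then have 1: "AE \<omega> in N. subexp (C \<omega>) \<and> C \<omega> 0 = 0 \<and> C \<omega> 1 \<noteq> 0"
    by (subst (asm) AE_distr_iff[OF mC good])
  have "AE \<omega> in N. H \<omega> holomorphic_on UNIV" using H by (simp add: conditioned_on_zero_def)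
  with 1 show "AE \<omega> in N. subexp (C \<omega>) \<and> C \<omega> 0 = 0 \<and> C \<omega> 1 \<noteq> 0 \<and> H \<omega> = trans_op a (fock (C \<omega>))"
  proof eventually_elim
    case (elim \<omega>)
    have "H \<omega> \<circ> (\<lambda>z. z - (- a)) holomorphic_on UNIV"
      by (intro holomorphic_on_compose holomorphic_intros holomorphic_on_subset[OF elim(2)]) auto
    then have "trans_op (- a) (H \<omega>) holomorphic_on UNIV"
      unfolding trans_op_def by (intro holomorphic_intros) (simp add: o_def)
    then have "fock (C \<omega>) = trans_op (- a) (H \<omega>)" unfolding C_def by (rule fock_fcoef)
    then show ?case using elim(1) trans_op_inverse[of a "H \<omega>"] by simp
  qed
qed

end


subsection \<open>The zero issuing from the origin\<close>

text \<open>The heat evolution as a series in the coefficients: free of derivatives, and visibly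
  measurable in \<open>c\<close>.\<close>

definition heat_series :: "(nat \<Rightarrow> complex) \<Rightarrow> complex \<Rightarrow> complex \<Rightarrow> complex" where
  "heat_series c \<tau> z = (\<Sum>n. c n * hk \<tau> z n)"

lemma heat_eq_series: "subexp c \<Longrightarrow> norm \<tau> < 1 \<Longrightarrow> heat \<tau> (fock c) z = heat_series c \<tau> z"
  by (simp add: heat_series_def heat_fock)

lemma heat_series_uniform:
  assumes c: "subexp c" and T: "0 \<le> T" "T < 1" "0 \<le> Z"
    and S: "\<And>p. p \<in> S \<Longrightarrow> norm (t p) \<le> T \<and> norm (\<zeta> p) \<le> Z"
  shows "uniform_limit S (\<lambda>N p. \<Sum>n<N. c n * hk (t p) (\<zeta> p) n) (\<lambda>p. heat_series c (t p) (\<zeta> p)) sequentially"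
  unfolding heat_series_def
proof (rule Weierstrass_m_test)
  show "summable (\<lambda>n. norm (c n) * hk (- T) Z n)" by (rule summable_hk_abs) (use c T in auto)
  show "norm (c n * hk (t y) (\<zeta> y) n) \<le> norm (c n) * hk (- T) Z n" if "y \<in> S" for n y
    unfolding norm_mult using S[OF that] by (intro mult_left_mono norm_hk_le) auto
qed

lemma heat_series_continuous:
  assumes c: "subexp c"
  shows "continuous_on (cball 0 (1/2) \<times> cball 0 1) (\<lambda>p. heat_series c (fst p) (snd p))"
proof (rule uniform_limit_theorem)
  show "\<forall>\<^sub>F N in sequentially. continuous_on (cball 0 (1/2) \<times> cball 0 1) (\<lambda>p :: complex \<times> complex. \<Sum>n<N. c n * hk (fst p) (snd p) n)"
    unfolding hk_def hcoef_def by (intro always_eventually allI continuous_intros) auto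
  show "uniform_limit (cball 0 (1/2) \<times> cball 0 1) (\<lambda>N p. \<Sum>n<N. c n * hk (fst p) (snd p) n) (\<lambda>p. heat_series c (fst p) (snd p)) sequentially"
    by (rule heat_series_uniform[OF c, of "1/2" 1]) auto
qed simp

lemma hcoef_has_field_derivative:
  "((\<lambda>z. hcoef \<tau> z (Suc n)) has_field_derivative hcoef \<tau> z n) (at z)" for \<tau> z :: complex
proof -
  \<comment> \<open>The default 0 covers the one possible extra term 2k = n + 1, which is constant
    in z.\<close>
  define d where "d k = (if 2 * k \<le> n then (- \<tau> / 2) ^ k / fact k * (z ^ (n - 2 * k) / fact (n - 2 * k)) else 0)" for k
  have t: "((\<lambda>z. (- \<tau> / 2) ^ k / fact k * (z ^ (Suc n - 2 * k) / fact (Suc n - 2 * k))) has_field_derivative d k) (at z)" for k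
  proof (cases "2 * k \<le> n")
    case True
    then have e: "Suc n - 2 * k = Suc (n - 2 * k)" by simp
    have "((\<lambda>z. z ^ Suc (n - 2 * k) / fact (Suc (n - 2 * k))) has_field_derivative z ^ (n - 2 * k) / fact (n - 2 * k)) (at z)"
    proof -
      have "((\<lambda>z. z ^ Suc (n - 2 * k) / fact (Suc (n - 2 * k))) has_field_derivative
          of_nat (Suc (n - 2 * k)) * (1 * z ^ (Suc (n - 2 * k) - Suc 0)) / fact (Suc (n - 2 * k))) (at z)"
        by (intro DERIV_cdivide DERIV_power DERIV_ident)
      then show ?thesis by (simp del: of_nat_Suc)
    qed
    from DERIV_cmult[OF this, of "(- \<tau> / 2) ^ k / fact k"] show ?thesis unfolding e d_def using True by simp
  next
    case False
    then have "Suc n - 2 * k = 0" by simp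
    then show ?thesis using False by (simp add: d_def)
  qed
  have "((\<lambda>z. hcoef \<tau> z (Suc n)) has_field_derivative (\<Sum>k\<le>Suc n div 2. d k)) (at z)"
    unfolding hcoef_def by (intro DERIV_sum t)
  also have "(\<Sum>k\<le>Suc n div 2. d k) = (\<Sum>k\<le>n div 2. d k)"
    by (intro sum.mono_neutral_right) (auto simp: d_def)
  also have "\<dots> = hcoef \<tau> z n" unfolding hcoef_def by (intro sum.cong) (auto simp: d_def)
  finally show ?thesis .
qed

text \<open>The heat operator commutes with differentiation; on coefficients this is the index shift
  of \<open>hcoef_has_field_derivative\<close>.\<close>

lemma heat_series_has_field_derivative:
  assumes c: "subexp c" and t: "norm \<tau> < 1"
  shows "((\<lambda>z. heat_series c \<tau> z) has_field_derivative heat_series (dshift c) \<tau> z) (at z)"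
proof -
  define f' where "f' n z = (if n = 0 then 0 else dshift c (n - 1) * hk \<tau> z (n - 1))" for n z
  define S where "S = ball (0::complex) (norm z + 1)"
  have d: "((\<lambda>z. c n * hk \<tau> z n) has_field_derivative f' n x) (at x within S)" for n x
  proof (cases n)
    case 0
    have "hk \<tau> z 0 = 1" for z by (simp add: hk_def hcoef_def)
    then show ?thesis using 0 by (simp add: f'_def)
  next
    case (Suc m)
    have "((\<lambda>z. c n * (of_real (sqrt (fact n)) * hcoef \<tau> z n)) has_field_derivative c n * (of_real (sqrt (fact n)) * hcoef \<tau> x m)) (at x within S)"
      unfolding Suc by (rule has_field_derivative_at_within, intro DERIV_cmult hcoef_has_field_derivative)
    also have "c n * (of_real (sqrt (fact n)) * hcoef \<tau> x m) = f' n x"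
      by (simp add: f'_def Suc dshift_def hk_def real_sqrt_mult del: of_nat_Suc)
    finally show ?thesis by (simp only: hk_def)
  qed
  have u: "uniformly_convergent_on S (\<lambda>N x. \<Sum>n<N. f' n x)"
  proof (rule Weierstrass_m_test')
    define g where "g n = (if n = 0 then 0 else norm (dshift c (n - 1)) * hk (- norm \<tau>) (norm z + 1) (n - 1))" for n
    show "norm (f' n x) \<le> g n" if "x \<in> S" for n x
      using that by (auto simp: f'_def g_def norm_mult S_def intro!: mult_left_mono norm_hk_le)
    have "summable (\<lambda>n. g (Suc n))"
      using summable_hk_abs[OF subexp_dshift[OF c] _ t, of "norm z + 1"] by (simp add: g_def)
    then show "summable g" by (simp only: summable_Suc_iff)
  qed
  have s0: "summable (\<lambda>n. c n * hk \<tau> 0 n)"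
    using summable_subexp_geom[OF c geom_hk[OF t, of 0]] by (intro summable_norm_cancel[of "\<lambda>n. c n * hk \<tau> 0 n"]) (simp add: norm_mult)
  have "((\<lambda>x. \<Sum>n. c n * hk \<tau> x n) has_field_derivative (\<Sum>n. f' n z)) (at z)"
    by (rule has_field_derivative_series'(2)[OF _ d u _ s0]) (auto simp: S_def interior_open add_nonneg_pos)
  moreover have "(\<Sum>n. f' n z) = heat_series (dshift c) \<tau> z"
  proof -
    have "summable (\<lambda>n. f' (Suc n) z)"
      using summable_subexp_geom[OF subexp_dshift[OF c] geom_hk[OF t, of z]]
      by (intro summable_norm_cancel[of "\<lambda>n. f' (Suc n) z"]) (simp add: norm_mult f'_def)
    then have "summable (\<lambda>n. f' n z)" using summable_Suc_iff[of "\<lambda>n. f' n z"] by blast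
    from suminf_split_head[OF this] show ?thesis by (simp add: f'_def heat_series_def)
  qed
  ultimately show ?thesis by (simp add: heat_series_def)
qed

lemma heat_series_0: "heat_series c 0 0 = c 0"
  using fock_0[of c] by (simp add: heat_series_def fock_eq_hk)

text \<open>Newton's iteration with frozen derivative; its limit is the zero that starts at the origin.\<close>

primrec newton :: "(nat \<Rightarrow> complex) \<Rightarrow> complex \<Rightarrow> nat \<Rightarrow> complex" where
  "newton c \<tau> 0 = 0"
| "newton c \<tau> (Suc j) = newton c \<tau> j - heat_series c \<tau> (newton c \<tau> j) / c 1"

lemma local_zero:
  assumes c: "subexp c" and c0: "c 0 = 0" and c1: "c 1 \<noteq> 0"
  obtains \<delta> \<rho> where "0 < \<delta>" "\<delta> \<le> 1/2" "0 < \<rho>"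
    "(\<lambda>\<tau>. lim (newton c \<tau>)) holomorphic_on ball 0 \<delta>" "lim (newton c 0) = 0"
    "\<And>\<tau>. \<tau> \<in> ball 0 \<delta> \<Longrightarrow> heat_series c \<tau> (lim (newton c \<tau>)) = 0"
    "\<And>\<tau> z. \<tau> \<in> ball 0 \<delta> \<Longrightarrow> norm z \<le> \<rho> \<Longrightarrow> heat_series c \<tau> z = 0 \<Longrightarrow> z = lim (newton c \<tau>)"
proof -
  let ?U = "cball 0 (1/2) \<times> cball 0 1 :: (complex \<times> complex) set"
  define N where "N \<tau> z = z - heat_series c \<tau> z / c 1" for \<tau> z
  have near: "\<exists>d>0. \<forall>p\<in>?U. dist p (0, 0) < d \<longrightarrow> norm (heat_series e (fst p) (snd p) - heat_series e 0 0) < \<epsilon>"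
    if "subexp e" "0 < \<epsilon>" for e \<epsilon>
  proof -
    have "(0, 0) \<in> ?U" by simp
    from heat_series_continuous[OF that(1)] this that(2)
    show ?thesis unfolding continuous_on_iff by (fastforce simp: dist_norm)
  qed
  have d0: "heat_series (dshift c) 0 0 = c 1" by (simp add: heat_series_0 dshift_def)
  obtain d1 where d1: "0 < d1" "\<And>p. p \<in> ?U \<Longrightarrow> dist p (0, 0) < d1 \<Longrightarrow> norm (heat_series (dshift c) (fst p) (snd p) - c 1) < norm (c 1) / 2"
    using near[OF subexp_dshift[OF c], of "norm (c 1) / 2"] c1 unfolding d0 by auto
  \<comment> \<open>Quarters of \<open>d1\<close> keep (\<tau>, z) inside the region where the
    derivative is within |c 1| / 2 of \<open>c 1\<close>, hence the contraction factor 1/2.\<close>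
  define \<rho> where "\<rho> = min 1 (d1 / 4)"
  have \<rho>: "0 < \<rho>" "\<rho> \<le> 1" "\<rho> \<le> d1 / 4" using d1 by (auto simp: \<rho>_def)
  obtain d2 where d2: "0 < d2" "\<And>p. p \<in> ?U \<Longrightarrow> dist p (0, 0) < d2 \<Longrightarrow> norm (heat_series c (fst p) (snd p)) < norm (c 1) * \<rho> / 2"
    using near[OF c, of "norm (c 1) * \<rho> / 2"] c1 \<rho> by (auto simp: heat_series_0 c0)
  \<comment> \<open>\<open>d2\<close> makes the first iterate at most \<rho> / 2; with factor 1/2
    the disk of radius \<rho> is mapped into itself.\<close>
  define \<delta> where "\<delta> = min (1/2) (min (d1 / 4) d2)"
  have \<delta>: "0 < \<delta>" "\<delta> \<le> 1/2" "\<delta> \<le> d1 / 4" "\<delta> \<le> d2" using d1 d2 by (auto simp: \<delta>_def)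
  have contr: "norm (N \<tau> z - N \<tau> w) \<le> 1/2 * norm (z - w)"
    if \<tau>: "norm \<tau> < \<delta>" and z: "norm z \<le> \<rho>" and w: "norm w \<le> \<rho>" for \<tau> z w :: complex
  proof (rule field_differentiable_bound[of "cball (0::complex) \<rho>"])
    fix x :: complex assume x: "x \<in> cball 0 \<rho>"
    show "(N \<tau> has_field_derivative 1 - heat_series (dshift c) \<tau> x / c 1) (at x within cball 0 \<rho>)"
      unfolding N_def[abs_def] using \<tau> \<delta>
      by (intro has_field_derivative_at_within[OF DERIV_diff[OF DERIV_ident DERIV_cdivide[OF heat_series_has_field_derivative]]] c) auto
    have "dist (\<tau>, x) (0, 0) \<le> norm \<tau> + norm x" unfolding dist_norm by (simp add: norm_Pair sqrt_sum_squares_le_sum)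
    then have "dist (\<tau>, x) (0, 0) < d1" using x \<tau> \<delta> \<rho> d1 by simp
    then have "norm (heat_series (dshift c) \<tau> x - c 1) < norm (c 1) / 2"
      using d1(2)[of "(\<tau>, x)"] x \<tau> \<delta> \<rho> by simp
    then have "norm (heat_series (dshift c) \<tau> x - c 1) / norm (c 1) \<le> 1/2"
      using c1 by (simp add: divide_le_eq)
    moreover have "1 - heat_series (dshift c) \<tau> x / c 1 = - ((heat_series (dshift c) \<tau> x - c 1) / c 1)" using c1 by (simp add: field_simps)
    ultimately show "norm (1 - heat_series (dshift c) \<tau> x / c 1) \<le> 1/2" by (simp only: norm_minus_cancel norm_divide)
  qed (use z w in auto)
  have N0: "norm (N \<tau> 0) \<le> \<rho> / 2" if "norm \<tau> < \<delta>" for \<tau>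
  proof -
    have "dist (\<tau>, 0 :: complex) (0, 0) < d2" using that \<delta> by (simp add: dist_norm norm_Pair)
    then have "norm (heat_series c \<tau> 0) < norm (c 1) * \<rho> / 2" using d2(2)[of "(\<tau>, 0)"] that \<delta> by simp
    then show ?thesis using c1 by (simp add: N_def norm_divide field_simps)
  qed
  have Nmap: "norm (N \<tau> z) \<le> \<rho>" if "norm \<tau> < \<delta>" "norm z \<le> \<rho>" for \<tau> z
  proof -
    have "norm (N \<tau> z) \<le> norm (N \<tau> 0) + norm (N \<tau> z - N \<tau> 0)" by (rule norm_triangle_sub)
    also have "\<dots> \<le> \<rho> / 2 + 1/2 * norm (z - 0)" using that \<rho> by (intro add_mono N0 contr) auto
    finally show ?thesis using that by simp
  qed
  have fix_iff: "N \<tau> z = z \<longleftrightarrow> heat_series c \<tau> z = 0" for \<tau> z using c1 by (simp add: N_def)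
  have uniq: "z = w" if "norm \<tau> < \<delta>" "norm z \<le> \<rho>" "norm w \<le> \<rho>" "N \<tau> z = z" "N \<tau> w = w" for \<tau> z w
    using contr[of \<tau> z w] that by simp
  have ex: "\<exists>y. norm y \<le> \<rho> \<and> N \<tau> y = y" if "norm \<tau> < \<delta>" for \<tau>
  proof -
    have "\<exists>!y. y \<in> cball 0 \<rho> \<and> N \<tau> y = y"
    proof (rule Banach_fix)
      show "N \<tau> ` cball 0 \<rho> \<subseteq> cball 0 \<rho>" using Nmap[OF that] by auto
      show "dist (N \<tau> x) (N \<tau> y) \<le> 1/2 * dist x y" if "x \<in> cball 0 \<rho>" "y \<in> cball 0 \<rho>" for x y
        using contr[of \<tau> x y] \<open>norm \<tau> < \<delta>\<close> that by (simp add: dist_norm)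
    qed (use \<rho> in \<open>auto simp: complete_eq_closed\<close>)
    then show ?thesis by auto
  qed
  have nb: "norm (newton c \<tau> j) \<le> \<rho>" if "norm \<tau> < \<delta>" for \<tau> j
  proof (induction j)
    case (Suc j)
    then show ?case using Nmap[OF that Suc] by (simp add: N_def)
  qed (use \<rho> in simp)
  have nd: "norm (newton c \<tau> j - y) \<le> (1/2) ^ j * \<rho>" if \<tau>: "norm \<tau> < \<delta>" and y: "norm y \<le> \<rho>" "N \<tau> y = y" for \<tau> y j
  proof (induction j)
    case (Suc j)
    have "norm (newton c \<tau> (Suc j) - y) = norm (N \<tau> (newton c \<tau> j) - N \<tau> y)"
      unfolding y(2) by (simp add: N_def)
    also have "\<dots> \<le> 1/2 * norm (newton c \<tau> j - y)" by (intro contr \<tau> nb y)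
    finally show ?case using Suc by simp
  qed (use y in simp)
  have p0: "(\<lambda>j. (1/2) ^ j * \<rho>) \<longlonglongrightarrow> 0"
    by (intro tendsto_mult_left_zero LIMSEQ_power_zero) simp
  have L: "lim (newton c \<tau>) = y" if "norm \<tau> < \<delta>" "norm y \<le> \<rho>" "N \<tau> y = y" for \<tau> y
  proof (rule limI, rule LIM_zero_cancel, rule Lim_null_comparison[OF _ p0])
    show "\<forall>\<^sub>F j in sequentially. norm (newton c \<tau> j - y) \<le> (1/2) ^ j * \<rho>" using nd[OF that] by simp
  qed
  have Ly: "norm (lim (newton c \<tau>)) \<le> \<rho> \<and> N \<tau> (lim (newton c \<tau>)) = lim (newton c \<tau>)" if \<tau>: "norm \<tau> < \<delta>" for \<tau>
    using ex[OF \<tau>] L[OF \<tau>] by auto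
  have nh: "(\<lambda>\<tau>. newton c \<tau> j) holomorphic_on ball 0 \<delta>" for j
  proof (induction j)
    case (Suc j)
    have "(\<lambda>\<tau>. heat_series c \<tau> (newton c \<tau> j)) holomorphic_on ball 0 \<delta>"
      unfolding heat_series_def by (rule heat_series_holomorphic[OF c _ _ Suc]) (use \<delta> in \<open>auto intro: holomorphic_intros\<close>)
    then show ?case unfolding newton.simps by (intro holomorphic_intros Suc) (use c1 in auto)
  qed simp
  have hol: "(\<lambda>\<tau>. lim (newton c \<tau>)) holomorphic_on ball 0 \<delta>"
  proof (rule holomorphic_uniform_sequence[where f = "\<lambda>j \<tau>. newton c \<tau> j"])
    fix x :: complex assume x: "x \<in> ball 0 \<delta>"
    then obtain d where d: "0 < d" "cball x d \<subseteq> ball 0 \<delta>"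
      using open_contains_cball[of "ball (0::complex) \<delta>"] open_ball by blast
    have "uniform_limit (cball x d) (\<lambda>j \<tau>. newton c \<tau> j) (\<lambda>\<tau>. lim (newton c \<tau>)) sequentially"
    proof (rule uniform_limitI)
      fix \<epsilon> :: real assume "0 < \<epsilon>"
      then have "\<forall>\<^sub>F j in sequentially. (1/2) ^ j * \<rho> < \<epsilon>" using p0 order_tendstoD(2) by blast
      then show "\<forall>\<^sub>F j in sequentially. \<forall>\<tau>\<in>cball x d. dist (newton c \<tau> j) (lim (newton c \<tau>)) < \<epsilon>"
      proof eventually_elim
        case (elim j)
        show ?case
        proof
          fix \<tau> assume "\<tau> \<in> cball x d"
          then have \<tau>: "norm \<tau> < \<delta>" using d by auto
          show "dist (newton c \<tau> j) (lim (newton c \<tau>)) < \<epsilon>"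
            using nd[OF \<tau>, of "lim (newton c \<tau>)" j] Ly[OF \<tau>] elim by (simp add: dist_norm)
        qed
      qed
    qed
    with d show "\<exists>d>0. cball x d \<subseteq> ball 0 \<delta> \<and> uniform_limit (cball x d) (\<lambda>j \<tau>. newton c \<tau> j) (\<lambda>\<tau>. lim (newton c \<tau>)) sequentially" by blast
  qed (use nh in auto)
  have "lim (newton c 0) = 0"
    by (rule L) (use \<delta> \<rho> in \<open>auto simp: fix_iff heat_series_0 c0\<close>)
  moreover have "heat_series c \<tau> (lim (newton c \<tau>)) = 0" if "\<tau> \<in> ball 0 \<delta>" for \<tau>
    using Ly[of \<tau>] that fix_iff by simp
  moreover have "z = lim (newton c \<tau>)" if "\<tau> \<in> ball 0 \<delta>" "norm z \<le> \<rho>" "heat_series c \<tau> z = 0" for \<tau> z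
    using L[of \<tau> z] that fix_iff by simp
  ultimately show ?thesis using that[of \<delta> \<rho>] \<delta> \<rho> hol by blast
qed

section \<open>Zero paths as power series\<close>

definition zcoef :: "(nat \<Rightarrow> complex) \<Rightarrow> nat \<Rightarrow> complex" where
  "zcoef c = tcoef (\<lambda>\<tau>. lim (newton c \<tau>))"

text \<open>Near 0 a path agrees with the Newton limit by local uniqueness, so its Taylor
  coefficients are \<open>zcoef c\<close>; being holomorphic on the whole disk, it is the sum of
  that series there. Uniqueness of zero paths follows.\<close>

lemma zero_path_sums:
  assumes c: "subexp c" "c 0 = 0" "c 1 \<noteq> 0" and p: "zero_path (fock c) 0 r f" and \<tau>: "norm \<tau> < r"
  shows "(\<lambda>n. zcoef c n * \<tau> ^ n) sums f \<tau>"
proof -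
  have r: "0 < r" "r \<le> 1" "f holomorphic_on ball 0 r" "f 0 = 0" "\<And>\<tau>. \<tau> \<in> ball 0 r \<Longrightarrow> heat \<tau> (fock c) (f \<tau>) = 0"
    using p by (auto simp: zero_path_def)
  obtain \<delta> \<rho> where d: "0 < \<delta>" "\<delta> \<le> 1/2" "0 < \<rho>"
    "\<And>\<tau> z. \<tau> \<in> ball 0 \<delta> \<Longrightarrow> norm z \<le> \<rho> \<Longrightarrow> heat_series c \<tau> z = 0 \<Longrightarrow> z = lim (newton c \<tau>)"
    using local_zero[OF c] by metis
  have s: "(\<lambda>n. (deriv ^^ n) f 0 / fact n * x ^ n) sums f x" if "norm x < r" for x
    using holomorphic_power_series[OF r(3), of x] that by simp
  have "continuous (at 0) f"
    using holomorphic_on_imp_continuous_on[OF r(3)] r(1) by (simp add: continuous_on_eq_continuous_at)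
  then have "\<exists>e>0. \<forall>x. dist x 0 < e \<longrightarrow> dist (f x) (f 0) < \<rho>" using d(3) unfolding continuous_at_eps_delta by blast
  then obtain e where e: "0 < e" "\<And>x. norm x < e \<Longrightarrow> norm (f x) < \<rho>" by (auto simp: r(4))
  \<comment> \<open>Small enough that the path stays within the radius \<rho> of local uniqueness;
    farther out its size is not controlled.\<close>
  define \<eta> where "\<eta> = min e (min r \<delta>)"
  have \<eta>: "0 < \<eta>" "\<eta> \<le> e" "\<eta> \<le> r" "\<eta> \<le> \<delta>" using e r d by (auto simp: \<eta>_def)
  have "f x = lim (newton c x)" if x: "norm x < \<eta>" for x
  proof (rule d(4))
    show "heat_series c x (f x) = 0" using r(2) r(5)[of x] x \<eta> heat_eq_series[OF c(1), of x] by simp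
    show "norm (f x) \<le> \<rho>" using e(2)[of x] x \<eta> by simp
  qed (use x \<eta> in simp)
  then have "zcoef c n = (deriv ^^ n) f 0 / fact n" for n
    unfolding zcoef_def by (intro tcoef_eq[OF \<eta>(1)]) (use s \<eta> in \<open>auto simp flip: \<open>\<And>x. norm x < \<eta> \<Longrightarrow> f x = lim (newton c x)\<close>\<close>)
  then show ?thesis using s[OF \<tau>] by simp
qed

text \<open>The heat evolution along the sum of the series is holomorphic and vanishes near 0, hence
  on the whole disk by the identity theorem.\<close>

lemma zero_path_of_series:
  assumes c: "subexp c" "c 0 = 0" "c 1 \<noteq> 0" and r: "0 < r" "r \<le> 1"
    and s: "\<And>\<tau>. norm \<tau> < r \<Longrightarrow> summable (\<lambda>n. zcoef c n * \<tau> ^ n)"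
  shows "zero_path (fock c) 0 r (\<lambda>\<tau>. \<Sum>n. zcoef c n * \<tau> ^ n)"
proof -
  define f where "f \<tau> = (\<Sum>n. zcoef c n * \<tau> ^ n)" for \<tau>
  obtain \<delta> \<rho> where d: "0 < \<delta>" "\<delta> \<le> 1/2" "(\<lambda>\<tau>. lim (newton c \<tau>)) holomorphic_on ball 0 \<delta>" "lim (newton c 0) = 0"
    "\<And>\<tau>. \<tau> \<in> ball 0 \<delta> \<Longrightarrow> heat_series c \<tau> (lim (newton c \<tau>)) = 0"
    using local_zero[OF c] by metis
  have ps: "(\<lambda>n. (deriv ^^ n) (\<lambda>\<tau>. lim (newton c \<tau>)) 0 / fact n * x ^ n) sums lim (newton c x)" if "norm x < \<delta>" for x
    using holomorphic_power_series[OF d(3), of x] that by simp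
  have zc: "zcoef c n = (deriv ^^ n) (\<lambda>\<tau>. lim (newton c \<tau>)) 0 / fact n" for n
    unfolding zcoef_def by (rule tcoef_eq[OF d(1) ps])
  have fL: "f x = lim (newton c x)" if "norm x < \<delta>" for x
    using ps[OF that] by (simp add: f_def zc sums_iff)
  have hol: "f holomorphic_on ball 0 r"
    by (rule power_series_holomorphic[where a = "zcoef c"]) (use s in \<open>auto simp: f_def intro: summable_sums\<close>)
  define g where "g \<tau> = heat_series c \<tau> (f \<tau>)" for \<tau>
  have gh: "g holomorphic_on ball 0 r"
    unfolding g_def heat_series_def by (rule heat_series_holomorphic[OF c(1) _ _ hol]) (use r in \<open>auto intro: holomorphic_intros\<close>)
  have "g \<tau> = 0" if "\<tau> \<in> ball 0 r" for \<tau>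
  proof (rule analytic_continuation_open[of "ball 0 (min \<delta> r)" "ball 0 r" g "\<lambda>_. 0" \<tau>])
    show "g z = 0" if "z \<in> ball 0 (min \<delta> r)" for z using that d(5)[of z] fL[of z] by (simp add: g_def)
  qed (use d r gh that in auto)
  then have "heat \<tau> (fock c) (f \<tau>) = 0" if "\<tau> \<in> ball 0 r" for \<tau>
    using that r heat_eq_series[OF c(1), of \<tau>] by (simp add: g_def)
  moreover have "f 0 = 0" using fL[of 0] d by simp
  ultimately show ?thesis unfolding zero_path_def f_def[symmetric] using r hol by simp
qed

text \<open>The condition says that the radius of convergence exceeds \<open>norm \<tau>\<close>; it is phrased with
  countable quantifiers for the sake of measurability.\<close>

definition zero_series :: "(nat \<Rightarrow> complex) \<Rightarrow> complex \<Rightarrow> complex option" where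
  "zero_series c \<tau> =
    (if \<exists>s::rat. norm \<tau> < of_rat s \<and> (\<exists>K::nat. \<forall>n. norm (zcoef c n) * of_rat s ^ n \<le> real K)
     then Some (\<Sum>n. zcoef c n * \<tau> ^ n) else None)"

lemma zero_fun_eq_Some:
  assumes p: "zero_path F a r f" "norm \<tau> < r"
    and u: "\<And>s g. zero_path F a s g \<Longrightarrow> norm \<tau> < s \<Longrightarrow> g \<tau> = f \<tau>"
  shows "zero_fun F a \<tau> = Some (f \<tau>)"
proof -
  have ex: "\<exists>r f. zero_path F a r f \<and> cmod \<tau> < r" using p by blast
  have the: "(THE v. \<exists>r f. zero_path F a r f \<and> cmod \<tau> < r \<and> v = f \<tau>) = f \<tau>"
  proof (rule the_equality)
    show "\<exists>r g. zero_path F a r g \<and> cmod \<tau> < r \<and> f \<tau> = g \<tau>" using p by blast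
    fix v assume "\<exists>r f. zero_path F a r f \<and> cmod \<tau> < r \<and> v = f \<tau>"
    then obtain s g where "zero_path F a s g" "cmod \<tau> < s" "v = g \<tau>" by (elim exE conjE)
    then show "v = f \<tau>" by (simp only: u)
  qed
  show ?thesis unfolding zero_fun_def if_P[OF ex] the ..
qed

lemma zcoef_bounded_summable:
  assumes "\<And>n. norm (b n) * s ^ n \<le> K" and "norm (x :: complex) < s"
  shows "summable (\<lambda>n. b n * x ^ n)"
proof (rule summable_comparison_test)
  have s: "0 < s" using assms(2) norm_ge_zero[of x] by linarith
  show "summable (\<lambda>n. K * (norm x / s) ^ n)"
    using assms(2) s by (intro summable_mult summable_geometric) auto
  show "\<exists>N. \<forall>n\<ge>N. norm (b n * x ^ n) \<le> K * (norm x / s) ^ n"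
  proof (intro exI allI impI)
    fix n
    have "norm (b n * x ^ n) = (norm (b n) * s ^ n) * (norm x / s) ^ n"
      using s by (simp add: norm_mult norm_power power_divide)
    also have "\<dots> \<le> K * (norm x / s) ^ n" using assms s by (intro mult_right_mono) auto
    finally show "norm (b n * x ^ n) \<le> K * (norm x / s) ^ n" .
  qed
qed

text \<open>A path beyond |\<tau>| exists exactly when the radius of convergence exceeds |\<tau>|.
  This removes the quantifiers over radii and functions from \<open>zero_fun\<close>.\<close>

lemma zero_fun_fock:
  assumes c: "subexp c" "c 0 = 0" "c 1 \<noteq> 0" and \<tau>: "norm \<tau> < 1"
  shows "zero_fun (fock c) 0 \<tau> = zero_series c \<tau>"
proof (cases "\<exists>r f. zero_path (fock c) 0 r f \<and> cmod \<tau> < r")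
  case True
  then obtain r f where p: "zero_path (fock c) 0 r f" "cmod \<tau> < r" by blast
  have "zero_fun (fock c) 0 \<tau> = Some (f \<tau>)"
    using p sums_unique2[OF zero_path_sums[OF c] zero_path_sums[OF c p]] by (rule zero_fun_eq_Some)
  \<comment> \<open>A rational radius strictly inside the disk turns convergence into bounded terms,
    a condition with countable quantifiers.\<close>
  moreover obtain s :: rat where s: "cmod \<tau> < of_rat s" "of_rat s < r" using of_rat_dense[OF p(2)] by blast
  have s0: "0 < (of_rat s :: real)" using s(1) norm_ge_zero[of \<tau>] by linarith
  have "summable (\<lambda>n. zcoef c n * (of_real (of_rat s)) ^ n)"
    using zero_path_sums[OF c p(1), of "of_real (of_rat s)"] s s0 by (simp add: sums_iff)
  then obtain K where K: "\<And>n. norm (zcoef c n * (of_real (of_rat s)) ^ n) \<le> K"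
    using summable_imp_Bseq unfolding Bseq_def by blast
  obtain K' :: nat where "K \<le> real K'" using real_arch_simple by blast
  then have "norm (zcoef c n) * of_rat s ^ n \<le> real K'" for n
    using K[of n] s0 by (simp add: norm_mult norm_power)
  then have "zero_series c \<tau> = Some (\<Sum>n. zcoef c n * \<tau> ^ n)"
    unfolding zero_series_def using s(1) by auto
  moreover have "(\<Sum>n. zcoef c n * \<tau> ^ n) = f \<tau>" using zero_path_sums[OF c p] by (simp add: sums_iff)
  ultimately show ?thesis by simp
next
  case False
  have "\<not> (\<exists>s::rat. norm \<tau> < of_rat s \<and> (\<exists>K::nat. \<forall>n. norm (zcoef c n) * of_rat s ^ n \<le> real K))"
  proof
    assume "\<exists>s::rat. norm \<tau> < of_rat s \<and> (\<exists>K::nat. \<forall>n. norm (zcoef c n) * of_rat s ^ n \<le> real K)"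
    then obtain s :: rat and K :: nat where s: "norm \<tau> < of_rat s" "\<And>n. norm (zcoef c n) * of_rat s ^ n \<le> real K" by blast
    have "0 < (of_rat s :: real)" using s(1) norm_ge_zero[of \<tau>] by linarith
    \<comment> \<open>Paths have radius at most 1, and |\<tau>| < 1 keeps \<tau> inside the
      truncated disk.\<close>
    then have "zero_path (fock c) 0 (min (of_rat s) 1) (\<lambda>\<tau>. \<Sum>n. zcoef c n * \<tau> ^ n)"
      by (intro zero_path_of_series c) (auto intro: zcoef_bounded_summable[OF s(2)])
    then show False using False s(1) \<tau> by auto
  qed
  then show ?thesis using False by (auto simp: zero_fun_def zero_series_def)
qed


subsection \<open>Translation and measurability of the zero\<close>

lemma zero_path_trans_op:
  assumes c: "subexp c"
  shows "zero_path (trans_op a (fock c)) a r f \<longleftrightarrow> zero_path (fock c) 0 r (\<lambda>\<tau>. f \<tau> - a - \<tau> * cnj a)"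
proof (cases "0 < r \<and> r \<le> 1")
  case True
  have "heat \<tau> (trans_op a (fock c)) (f \<tau>) = 0 \<longleftrightarrow> heat \<tau> (fock c) (f \<tau> - a - \<tau> * cnj a) = 0" if "\<tau> \<in> ball 0 r" for \<tau>
    using heat_trans_op[OF c, of \<tau> a "f \<tau>"] that True by simp
  moreover have "f holomorphic_on ball 0 r \<longleftrightarrow> (\<lambda>\<tau>. f \<tau> - a - \<tau> * cnj a) holomorphic_on ball 0 r"
  proof
    assume h: "(\<lambda>\<tau>. f \<tau> - a - \<tau> * cnj a) holomorphic_on ball 0 r"
    have "(\<lambda>\<tau>. a + \<tau> * cnj a) holomorphic_on ball 0 r" by (intro holomorphic_intros)
    from holomorphic_on_add[OF h this] show "f holomorphic_on ball 0 r"
      by (rule holomorphic_transform) simp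
  qed (intro holomorphic_intros)
  moreover have "f 0 = a \<longleftrightarrow> f 0 - a - 0 * cnj a = 0" by simp
  ultimately show ?thesis unfolding zero_path_def by blast
qed (auto simp: zero_path_def)

lemma zero_fun_trans_op:
  assumes c: "subexp c" "c 0 = 0" "c 1 \<noteq> 0"
  shows "zero_fun (trans_op a (fock c)) a \<tau> = map_option (\<lambda>v. a + \<tau> * cnj a + v) (zero_fun (fock c) 0 \<tau>)"
proof (cases "\<exists>r f. zero_path (fock c) 0 r f \<and> cmod \<tau> < r")
  case True
  then obtain r f where p: "zero_path (fock c) 0 r f" "cmod \<tau> < r" by blast
  have u: "g \<tau> = f \<tau>" if "zero_path (fock c) 0 s g" "cmod \<tau> < s" for s g
    using zero_path_sums[OF c p] zero_path_sums[OF c that] by (rule sums_unique2[symmetric])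
  have "zero_fun (fock c) 0 \<tau> = Some (f \<tau>)" using p u by (rule zero_fun_eq_Some)
  moreover have "zero_fun (trans_op a (fock c)) a \<tau> = Some ((\<lambda>\<tau>. a + \<tau> * cnj a + f \<tau>) \<tau>)"
  proof (rule zero_fun_eq_Some)
    show "zero_path (trans_op a (fock c)) a r (\<lambda>\<tau>. a + \<tau> * cnj a + f \<tau>)"
      unfolding zero_path_trans_op[OF c(1)] using p(1) by simp
    fix s g assume "zero_path (trans_op a (fock c)) a s g" "cmod \<tau> < s"
    then show "g \<tau> = (\<lambda>\<tau>. a + \<tau> * cnj a + f \<tau>) \<tau>"
      unfolding zero_path_trans_op[OF c(1)] using u[of s "\<lambda>\<tau>. g \<tau> - a - \<tau> * cnj a"] by (simp add: algebra_simps)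
  qed (rule p(2))
  ultimately show ?thesis by simp
next
  case False
  then have "\<not> (\<exists>r f. zero_path (trans_op a (fock c)) a r f \<and> cmod \<tau> < r)"
    unfolding zero_path_trans_op[OF c(1)] by blast
  then show ?thesis using False by (simp add: zero_fun_def)
qed

section \<open>The process u^a as a measurable functional of the coefficients\<close>

lemma act_eq: "act A z = mp_p A * z + mp_q A * cnj z"
  by (simp add: act_def Let_def matrix_vector_mult_def sum_2 mp_p_def mp_q_def complex_eq_iff field_simps)

text \<open>The process \<open>u_fun\<close> at the origin written through the coefficient sequence
  alone, so that a single measurable map serves every conditioned function.\<close>

definition u_series :: "(nat \<Rightarrow> complex) \<Rightarrow> real^2^2 \<Rightarrow> complex option" where
  "u_series c A = (case factorization A of (\<theta>, \<tau>) \<Rightarrow>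
     map_option (\<lambda>z. cis \<theta> * (z / of_real (sqrt (1 - (cmod \<tau>)\<^sup>2)))) (zero_series c \<tau>))"

lemma u_fun_trans_op:
  assumes A: "A \<in> SL2R" and c: "subexp c" "c 0 = 0" "c 1 \<noteq> 0"
  shows "u_fun (trans_op a (fock c)) a A = map_option (\<lambda>u. act A a + u) (u_series c A)"
proof -
  obtain \<theta> \<tau> where f: "factorization A = (\<theta>, \<tau>)" by fastforce
  have fa: "factors_as A \<theta> \<tau>" by (rule factorization_factors[OF A f])
  then have t: "cmod \<tau> < 1" by (simp add: factors_as_def)
  define s where "s = complex_of_real (sqrt (1 - (cmod \<tau>)\<^sup>2))"
  have p: "mp_p A = cis \<theta> / s" "mp_q A = cis \<theta> / s * \<tau>"
    using fa mp_factored[of \<theta> \<tau>] by (auto simp: factors_as_def s_def)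
  have e: "cis \<theta> * ((a + \<tau> * cnj a + v) / s) = act A a + cis \<theta> * (v / s)" for v
    unfolding act_eq p by (simp add: add_divide_distrib algebra_simps)
  show ?thesis
    unfolding u_fun_def u_series_def f prod.case zero_fun_trans_op[OF c] zero_fun_fock[OF c t] option.map_comp o_def s_def[symmetric] e ..
qed

lemma u_fun_fock:
  assumes "A \<in> SL2R" and "subexp c" "c 0 = 0" "c 1 \<noteq> 0"
  shows "u_fun (fock c) 0 A = u_series c A"
  using u_fun_trans_op[OF assms, of 0] by (simp add: act_eq option.map_ident)

lemma space_option_borel: "space option_borel = UNIV"
  by (simp add: option_borel_def space_measure_of_conv)

lemma measurable_option_borel:
  assumes P: "{x \<in> space M. P x} \<in> sets M" and f: "f \<in> borel_measurable M"
  shows "(\<lambda>x. if P x then Some (f x) else None) \<in> measurable M option_borel"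
  unfolding option_borel_def
proof (rule measurable_measure_of)
  fix y :: "complex option set" assume "y \<in> insert {None} {Some ` B |B. B \<in> sets borel}"
  then consider "y = {None}" | B where "y = Some ` B" "B \<in> sets borel" by blast
  then show "(\<lambda>x. if P x then Some (f x) else None) -` y \<inter> space M \<in> sets M"
  proof cases
    case 1
    have "(\<lambda>x. if P x then Some (f x) else None) -` y \<inter> space M = space M - {x \<in> space M. P x}"
      using 1 by (auto split: if_splits)
    then show ?thesis using P by simp
  next
    case 2
    have "(\<lambda>x. if P x then Some (f x) else None) -` y \<inter> space M = (f -` B \<inter> space M) \<inter> {x \<in> space M. P x}"
      using 2 by (auto split: if_splits)
    then show ?thesis using P measurable_sets[OF f 2(2)] by auto
  qed
qed auto

lemma coefficient_measurable: "(\<lambda>c :: nat \<Rightarrow> complex. c n) \<in> borel_measurable (\<Pi>\<^sub>M n\<in>UNIV. borel)"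
  by (rule measurable_component_singleton) simp

lemma newton_measurable: "(\<lambda>c. newton c \<tau> j) \<in> borel_measurable (\<Pi>\<^sub>M n\<in>UNIV. borel)"
proof (induction j)
  case (Suc j)
  have "(\<lambda>c. hk \<tau> (newton c \<tau> j) n) \<in> borel_measurable (\<Pi>\<^sub>M n\<in>UNIV. borel)" for n
    unfolding hk_def hcoef_def
    by (intro borel_measurable_times borel_measurable_sum borel_measurable_divide borel_measurable_power borel_measurable_const Suc)
  then have "(\<lambda>c. heat_series c \<tau> (newton c \<tau> j)) \<in> borel_measurable (\<Pi>\<^sub>M n\<in>UNIV. borel)"
    unfolding heat_series_def
    by (intro borel_measurable_suminf borel_measurable_times coefficient_measurable)
  then show ?case unfolding newton.simps
    by (intro borel_measurable_diff borel_measurable_divide coefficient_measurable Suc)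
qed simp

lemma zcoef_measurable [measurable]: "(\<lambda>c. zcoef c n) \<in> borel_measurable (\<Pi>\<^sub>M n\<in>UNIV. borel)"
  unfolding zcoef_def
  by (intro tcoef_measurable borel_measurable_lim_metric newton_measurable)

lemma u_series_measurable:
  "(\<lambda>c. map_option (\<lambda>u. b + u) (u_series c A)) \<in> measurable (\<Pi>\<^sub>M n\<in>UNIV. borel) option_borel"
proof -
  obtain \<theta> \<tau> where f: "factorization A = (\<theta>, \<tau>)" by fastforce
  let ?P = "\<lambda>c. \<exists>s::rat. norm \<tau> < of_rat s \<and> (\<exists>K::nat. \<forall>n. norm (zcoef c n) * of_rat s ^ n \<le> real K)"
  let ?f = "\<lambda>c. b + cis \<theta> * ((\<Sum>n. zcoef c n * \<tau> ^ n) / of_real (sqrt (1 - (cmod \<tau>)\<^sup>2)))"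
  have "(\<lambda>c. map_option (\<lambda>u. b + u) (u_series c A)) = (\<lambda>c. if ?P c then Some (?f c) else None)"
    by (auto simp: u_series_def f zero_series_def fun_eq_iff)
  moreover have "(\<lambda>c. if ?P c then Some (?f c) else None) \<in> measurable (\<Pi>\<^sub>M n\<in>UNIV. borel) option_borel"
    by (rule measurable_option_borel) measurable
  ultimately show ?thesis by simp
qed


subsection \<open>Images of the Gaussian analytic function\<close>

lemma metaplectic_preserves_gaf:
  assumes iid: "iid_std_complex_gaussian M \<xi>" and A: "A \<in> SL2R" and V: "V \<in> metaplectic A"
  shows "eq_in_dist_entire M (\<lambda>\<omega>. V (gaf \<xi> \<omega>)) M (gaf \<xi>)"
proof -
  obtain s where s: "s\<^sup>2 = mp_p A" "V = (\<lambda>f z. 1 / s * (\<integral>w. mp_integrand A f z w \<partial>lborel))"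
    using V by (auto simp: metaplectic_def)
  define \<tau> where "\<tau> = mp_q A / mp_p A"
  have t: "norm \<tau> < 1" unfolding \<tau>_def by (rule mp_ratio(1)[OF A])
  define c where "c z n = mp_coef A s z * hk \<tau> (z / mp_p A) n" for z n
  have gc: "geom (c z)" for z unfolding c_def by (intro geom_cmult geom_hk t)
  have g0: "geom (hk 0 z)" for z :: complex by (rule geom_hk) simp
  note [measurable] = xi_measurable[OF iid]
  have Vf: "V (fock d) = (\<lambda>z. mp_coef A s z * heat \<tau> (fock d) (z / mp_p A))" if "subexp d" for d
    unfolding s(2) using mp_fock[OF A that] by (simp add: \<tau>_def)
  have Vs: "V (fock d) = (\<lambda>z. \<Sum>n. d n * c z n)" if d: "subexp d" for d
  proof
    fix z
    have "summable (\<lambda>n. d n * hk \<tau> (z / mp_p A) n)"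
      by (rule summable_norm_cancel) (use summable_subexp_geom[OF d geom_hk[OF t]] in \<open>simp add: norm_mult\<close>)
    from suminf_mult[OF this, of "mp_coef A s z"]
    show "V (fock d) z = (\<Sum>n. d n * c z n)"
      unfolding Vf[OF d] heat_fock(2)[OF d t] c_def by (simp add: mult_ac)
  qed
  have hol: "V (fock d) holomorphic_on UNIV" if d: "subexp d" for d
  proof -
    have "heat \<tau> (fock d) \<circ> (\<lambda>z. z / mp_p A) holomorphic_on UNIV"
      using mp_p_nonzero[OF A] by (intro holomorphic_on_compose holomorphic_intros heat_holomorphic[OF d t])
    then show ?thesis unfolding Vf[OF d] mp_coef_def o_def by (intro holomorphic_intros)
  qed
  have "eq_in_dist M (\<lambda>\<omega>. V (gaf \<xi> \<omega>)) M (gaf \<xi>) (Pi\<^sub>M UNIV (\<lambda>_. borel))"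
  proof (rule eq_in_dist_AE)
    show "(\<lambda>\<omega> z. \<Sum>n. \<xi> n \<omega> * c z n) \<in> measurable M (Pi\<^sub>M UNIV (\<lambda>_. borel))"
      "(\<lambda>\<omega> z. \<Sum>n. \<xi> n \<omega> * hk 0 z n) \<in> measurable M (Pi\<^sub>M UNIV (\<lambda>_. borel))"
      by (rule measurable_PiM_single'; simp)+
    show "distr M (Pi\<^sub>M UNIV (\<lambda>_. borel)) (\<lambda>\<omega> z. \<Sum>n. \<xi> n \<omega> * c z n) = distr M (Pi\<^sub>M UNIV (\<lambda>_. borel)) (\<lambda>\<omega> z. \<Sum>n. \<xi> n \<omega> * hk 0 z n)"
      by (rule gaussian_series_law[OF iid gc g0]) (simp only: c_def \<tau>_def mp_kernel[OF A s(1)] hk_0_kernel)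
    show "AE \<omega> in M. V (gaf \<xi> \<omega>) = (\<lambda>z. \<Sum>n. \<xi> n \<omega> * c z n)"
      using AE_subexp[OF iid] by eventually_elim (simp only: gaf_eq_fock Vs)
    show "AE \<omega> in M. gaf \<xi> \<omega> = (\<lambda>z. \<Sum>n. \<xi> n \<omega> * hk 0 z n)"
      by (simp add: gaf_eq_fock fock_eq_hk[abs_def])
  qed (auto simp: space_PiM)
  moreover have "AE \<omega> in M. V (gaf \<xi> \<omega>) holomorphic_on UNIV" "AE \<omega> in M. gaf \<xi> \<omega> holomorphic_on UNIV"
    using AE_subexp[OF iid] unfolding gaf_eq_fock by (eventually_elim, auto intro: hol fock_holomorphic)+
  ultimately show ?thesis by (simp add: eq_in_dist_entire_def)
qed

lemma zeros_metaplectic: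
  assumes A: "A \<in> SL2R" and f: "factors_as A \<theta> \<tau>" and V: "V \<in> metaplectic A" and c: "subexp c"
  shows "zeros (V (fock c)) = {cis \<theta> * (z / of_real (sqrt (1 - (cmod \<tau>)\<^sup>2))) |z. z \<in> zeros (heat \<tau> (fock c))}"
proof -
  obtain s where s: "s\<^sup>2 = mp_p A" "V = (\<lambda>f z. 1 / s * (\<integral>w. mp_integrand A f z w \<partial>lborel))"
    using V by (auto simp: metaplectic_def)
  have p0: "mp_p A \<noteq> 0" by (rule mp_p_nonzero[OF A])
  then have "s \<noteq> 0" using s(1) by auto
  have \<tau>: "\<tau> = mp_q A / mp_p A" using f factors_as_iff[OF A] by blast
  have p: "mp_p A = cis \<theta> / of_real (sqrt (1 - (cmod \<tau>)\<^sup>2))"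
    using f mp_factored(1)[of \<theta> \<tau>] by (auto simp: factors_as_def)
  have "V (fock c) z = mp_coef A s z * heat \<tau> (fock c) (z / mp_p A)" for z
    unfolding s(2) \<tau> by (rule mp_fock[OF A c])
  then have z: "z \<in> zeros (V (fock c)) \<longleftrightarrow> z / mp_p A \<in> zeros (heat \<tau> (fock c))" for z
    using \<open>s \<noteq> 0\<close> by (simp add: zeros_def mp_coef_def)
  have "zeros (V (fock c)) = {mp_p A * z |z. z \<in> zeros (heat \<tau> (fock c))}"
  proof (intro equalityI subsetI)
    fix z assume "z \<in> zeros (V (fock c))"
    then show "z \<in> {mp_p A * z |z. z \<in> zeros (heat \<tau> (fock c))}"
      using z[of z] p0 by (intro CollectI exI[of _ "z / mp_p A"]) simp
  next
    fix z assume "z \<in> {mp_p A * z |z. z \<in> zeros (heat \<tau> (fock c))}"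
    then show "z \<in> zeros (V (fock c))" using z p0 by auto
  qed
  also have "\<dots> = {cis \<theta> * (z / of_real (sqrt (1 - (cmod \<tau>)\<^sup>2))) |z. z \<in> zeros (heat \<tau> (fock c))}"
    unfolding p by simp
  finally show ?thesis .
qed

text \<open>Gathers, for a single function, the pathwise claims made about the conditioned GAF; the
  translation carries the simple zero of \<open>fock c\<close> at 0 to \<open>a\<close>.\<close>

lemma trans_op_zero_path:
  fixes a :: complex and c :: "nat \<Rightarrow> complex"
  assumes c: "subexp c" "c 0 = 0" "c 1 \<noteq> 0"
  defines "F \<equiv> trans_op a (fock c)"
  shows "\<forall>\<tau> z. cmod \<tau> < 1 \<longrightarrow> summable (heat_term \<tau> F z)" "F a = 0" "deriv F a \<noteq> 0"
    "\<exists>r f. zero_path F a r f"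
    "\<forall>r f s g. zero_path F a r f \<and> zero_path F a s g \<longrightarrow> (\<forall>\<tau>\<in>ball 0 (min r s). f \<tau> = g \<tau>)"
proof -
  obtain c' where c': "subexp c'" "F = fock c'" unfolding F_def using trans_op_fock[OF c(1)] by blast
  show "\<forall>\<tau> z. cmod \<tau> < 1 \<longrightarrow> summable (heat_term \<tau> F z)" unfolding c'(2) using heat_fock(1)[OF c'(1)] by blast
  show "F a = 0" by (simp add: F_def trans_op_def fock_0 c)
  have "(F has_field_derivative exp (a * cnj a - of_real ((norm a)\<^sup>2) / 2) * c 1) (at a)"
  proof -
    have "((\<lambda>z. fock c (z - a)) has_field_derivative c 1) (at a)"
      using DERIV_shift[of "fock c" "c 1" a "- a"] fock_has_field_derivative[OF c(1), of 0] by (simp add: fock_0 dshift_def)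
    moreover have "((\<lambda>z. exp (z * cnj a - of_real ((norm a)\<^sup>2) / 2)) has_field_derivative
        exp (a * cnj a - of_real ((norm a)\<^sup>2) / 2) * cnj a) (at a)"
      by (auto intro!: derivative_eq_intros)
    \<comment> \<open>In the product rule the derivative of the exponential factor meets the value
      \<open>c 0 = 0\<close>, so only \<open>c 1\<close> remains.\<close>
    ultimately show ?thesis unfolding F_def trans_op_def[abs_def]
      by (intro DERIV_cong[OF DERIV_mult]) (auto simp: fock_0 c)
  qed
  then show "deriv F a \<noteq> 0" using c(3) by (simp add: DERIV_imp_deriv)
  obtain \<delta> \<rho> where d: "0 < \<delta>" "\<delta> \<le> 1/2" "(\<lambda>\<tau>. lim (newton c \<tau>)) holomorphic_on ball 0 \<delta>" "lim (newton c 0) = 0"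
    "\<And>\<tau>. \<tau> \<in> ball 0 \<delta> \<Longrightarrow> heat_series c \<tau> (lim (newton c \<tau>)) = 0"
    using local_zero[OF c] by metis
  have "zero_path (fock c) 0 \<delta> (\<lambda>\<tau>. lim (newton c \<tau>))"
    unfolding zero_path_def using d heat_eq_series[OF c(1)] by auto
  then have "zero_path F a \<delta> (\<lambda>\<tau>. a + \<tau> * cnj a + lim (newton c \<tau>))"
    unfolding F_def zero_path_trans_op[OF c(1)] by simp
  then show "\<exists>r f. zero_path F a r f" by blast
  show "\<forall>r f s g. zero_path F a r f \<and> zero_path F a s g \<longrightarrow> (\<forall>\<tau>\<in>ball 0 (min r s). f \<tau> = g \<tau>)"
  proof (intro allI impI ballI)
    fix r f s g and \<tau> :: complex assume p: "zero_path F a r f \<and> zero_path F a s g" and t: "\<tau> \<in> ball 0 (min r s)"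
    have "(\<lambda>n. zcoef c n * \<tau> ^ n) sums (f \<tau> - a - \<tau> * cnj a)" "(\<lambda>n. zcoef c n * \<tau> ^ n) sums (g \<tau> - a - \<tau> * cnj a)"
      using p t unfolding F_def zero_path_trans_op[OF c(1)] by (auto intro: zero_path_sums[OF c])
    then have "f \<tau> - a - \<tau> * cnj a = g \<tau> - a - \<tau> * cnj a" by (rule sums_unique2)
    then show "f \<tau> = g \<tau>" by simp
  qed
qed

theorem proposition1p5:
  fixes M :: "'a measure" and \<xi> :: "nat \<Rightarrow> 'a \<Rightarrow> complex"
  assumes "iid_std_complex_gaussian M \<xi>"
  shows
    "(\<forall>A\<in>SL2R.
        (AE \<omega> in M. \<forall>z. integrable lborel (mp_integrand A (gaf \<xi> \<omega>) z)) \<and>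
        (\<forall>V\<in>metaplectic A. eq_in_dist_entire M (\<lambda>\<omega>. V (gaf \<xi> \<omega>)) M (gaf \<xi>)))
   \<and> (\<forall>A\<in>SL2R.
        (\<exists>!x. case x of (\<theta>, \<tau>) \<Rightarrow> 0 \<le> \<theta> \<and> \<theta> < 2 * pi \<and> factors_as A \<theta> \<tau>) \<and>
        (\<forall>\<theta> \<tau>. factors_as A \<theta> \<tau> \<longrightarrow>
           (AE \<omega> in M. \<forall>z. summable (heat_term \<tau> (gaf \<xi> \<omega>) z)) \<and>
           (\<forall>V\<in>metaplectic A. AE \<omega> in M.
              zeros (V (gaf \<xi> \<omega>)) =
                {cis \<theta> * (z / of_real (sqrt (1 - (cmod \<tau>)\<^sup>2))) |z. z \<in> zeros (heat \<tau> (gaf \<xi> \<omega>))})))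
   \<and> (\<forall>a (N :: 'b measure) H (N\<^sub>0 :: 'c measure) H\<^sub>0.
        conditioned_on_zero M (gaf \<xi>) a N H \<and> conditioned_on_zero M (gaf \<xi>) 0 N\<^sub>0 H\<^sub>0 \<longrightarrow>
        (AE \<omega> in N.
           (\<forall>\<tau> z. cmod \<tau> < 1 \<longrightarrow> summable (heat_term \<tau> (H \<omega>) z)) \<and>
           H \<omega> a = 0 \<and> deriv (H \<omega>) a \<noteq> 0 \<and>
           (\<exists>r f. zero_path (H \<omega>) a r f) \<and>
           (\<forall>r f s g. zero_path (H \<omega>) a r f \<and> zero_path (H \<omega>) a s g \<longrightarrow>
              (\<forall>\<tau>\<in>ball 0 (min r s). f \<tau> = g \<tau>))) \<and>
        eq_in_dist
          N (\<lambda>\<omega>. \<lambda>A\<in>SL2R. u_fun (H \<omega>) a A)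
          N\<^sub>0 (\<lambda>\<omega>. \<lambda>A\<in>SL2R. map_option (\<lambda>u. act A a + u) (u_fun (H\<^sub>0 \<omega>) 0 A))
          (Pi\<^sub>M SL2R (\<lambda>_. option_borel)))"
proof (intro conjI ballI allI impI)
  note iid = assms
  fix A assume A: "A \<in> SL2R"
  show "AE \<omega> in M. \<forall>z. integrable lborel (mp_integrand A (gaf \<xi> \<omega>) z)"
    using AE_subexp[OF iid] by eventually_elim (simp add: gaf_eq_fock mp_integrable[OF A])
  show "eq_in_dist_entire M (\<lambda>\<omega>. V (gaf \<xi> \<omega>)) M (gaf \<xi>)" if "V \<in> metaplectic A" for V
    by (rule metaplectic_preserves_gaf[OF iid A that])
  show "\<exists>!x. case x of (\<theta>, \<tau>) \<Rightarrow> 0 \<le> \<theta> \<and> \<theta> < 2 * pi \<and> factors_as A \<theta> \<tau>"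
    by (rule factorization_unique[OF A])
  fix \<theta> \<tau> assume f: "factors_as A \<theta> \<tau>"
  then have t: "cmod \<tau> < 1" by (simp add: factors_as_def)
  show "AE \<omega> in M. \<forall>z. summable (heat_term \<tau> (gaf \<xi> \<omega>) z)"
    using AE_subexp[OF iid] by eventually_elim (simp add: gaf_eq_fock heat_fock(1) t)
  show "AE \<omega> in M. zeros (V (gaf \<xi> \<omega>)) =
      {cis \<theta> * (z / of_real (sqrt (1 - (cmod \<tau>)\<^sup>2))) |z. z \<in> zeros (heat \<tau> (gaf \<xi> \<omega>))}" if "V \<in> metaplectic A" for V
    using AE_subexp[OF iid] by eventually_elim (simp only: gaf_eq_fock zeros_metaplectic[OF A f that])
next
  note iid = assms
  fix a and N :: "'b measure" and H and N\<^sub>0 :: "'c measure" and H\<^sub>0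
  assume "conditioned_on_zero M (gaf \<xi>) a N H \<and> conditioned_on_zero M (gaf \<xi>) 0 N\<^sub>0 H\<^sub>0"
  then have H: "conditioned_on_zero M (gaf \<xi>) a N H" and H0: "conditioned_on_zero M (gaf \<xi>) 0 N\<^sub>0 H\<^sub>0" by auto
  note C = conditioned_coefficients[OF iid H] and C0 = conditioned_coefficients[OF iid H0]
  show "AE \<omega> in N.
       (\<forall>\<tau> z. cmod \<tau> < 1 \<longrightarrow> summable (heat_term \<tau> (H \<omega>) z)) \<and>
       H \<omega> a = 0 \<and> deriv (H \<omega>) a \<noteq> 0 \<and>
       (\<exists>r f. zero_path (H \<omega>) a r f) \<and>
       (\<forall>r f s g. zero_path (H \<omega>) a r f \<and> zero_path (H \<omega>) a s g \<longrightarrow>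
          (\<forall>\<tau>\<in>ball 0 (min r s). f \<tau> = g \<tau>))"
    using C(3)
  proof eventually_elim
    case (elim \<omega>)
    define c where "c = fcoef (trans_op (- a) (H \<omega>))"
    have c: "subexp c" "c 0 = 0" "c 1 \<noteq> 0" "H \<omega> = trans_op a (fock c)" using elim by (auto simp: c_def)
    show ?case unfolding c(4) using trans_op_zero_path[OF c(1-3), of a] by blast
  qed
  \<comment> \<open>One measurable functional of the coefficient sequence gives both processes,
    jointly in all \<open>A\<close>, with the shift by \<open>act A a\<close> built in. The two
    coefficient sequences have the same law, hence so do their images.\<close>
  define \<Phi> where "\<Phi> c = (\<lambda>A\<in>SL2R. map_option (\<lambda>u. act A a + u) (u_series c A))" for c
  let ?Q = "\<Pi>\<^sub>M n\<in>(UNIV :: nat set). (borel :: complex measure)"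
  let ?K = "Pi\<^sub>M SL2R (\<lambda>_. option_borel)"
  have \<Phi>m: "\<Phi> \<in> measurable ?Q ?K"
    unfolding \<Phi>_def by (intro measurable_restrict u_series_measurable)
  show "eq_in_dist
      N (\<lambda>\<omega>. \<lambda>A\<in>SL2R. u_fun (H \<omega>) a A)
      N\<^sub>0 (\<lambda>\<omega>. \<lambda>A\<in>SL2R. map_option (\<lambda>u. act A a + u) (u_fun (H\<^sub>0 \<omega>) 0 A))
      (Pi\<^sub>M SL2R (\<lambda>_. option_borel))"
  proof (rule eq_in_dist_AE)
    show "(\<lambda>\<omega>. \<Phi> (fcoef (trans_op (- a) (H \<omega>)))) \<in> measurable N ?K"
      "(\<lambda>\<omega>. \<Phi> (fcoef (trans_op (- 0) (H\<^sub>0 \<omega>)))) \<in> measurable N\<^sub>0 ?K"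
      by (rule measurable_compose[OF C(1) \<Phi>m] measurable_compose[OF C0(1) \<Phi>m])+
    show "AE \<omega> in N. (\<lambda>A\<in>SL2R. u_fun (H \<omega>) a A) = \<Phi> (fcoef (trans_op (- a) (H \<omega>)))"
      using C(3)
    proof eventually_elim
      case (elim \<omega>)
      define c where "c = fcoef (trans_op (- a) (H \<omega>))"
      have c: "subexp c" "c 0 = 0" "c 1 \<noteq> 0" "H \<omega> = trans_op a (fock c)" using elim by (auto simp: c_def)
      have "(\<lambda>A\<in>SL2R. u_fun (H \<omega>) a A) = \<Phi> c"
        unfolding \<Phi>_def c(4) using u_fun_trans_op[OF _ c(1-3)] by (intro restrict_ext) blast
      then show ?case unfolding c_def .
    qed
    show "AE \<omega> in N\<^sub>0. (\<lambda>A\<in>SL2R. map_option (\<lambda>u. act A a + u) (u_fun (H\<^sub>0 \<omega>) 0 A)) = \<Phi> (fcoef (trans_op (- 0) (H\<^sub>0 \<omega>)))"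
      using C0(3)
    proof eventually_elim
      case (elim \<omega>)
      define c where "c = fcoef (trans_op (- 0) (H\<^sub>0 \<omega>))"
      have c: "subexp c" "c 0 = 0" "c 1 \<noteq> 0" "H\<^sub>0 \<omega> = fock c" using elim by (auto simp: c_def)
      have "(\<lambda>A\<in>SL2R. map_option (\<lambda>u. act A a + u) (u_fun (H\<^sub>0 \<omega>) 0 A)) = \<Phi> c"
        unfolding \<Phi>_def c(4) using u_fun_fock[OF _ c(1-3)] by (intro restrict_ext) simp
      then show ?case unfolding c_def .
    qed
    have "distr N ?K (\<lambda>\<omega>. \<Phi> (fcoef (trans_op (- a) (H \<omega>)))) = distr (distr N ?Q (\<lambda>\<omega>. fcoef (trans_op (- a) (H \<omega>)))) ?K \<Phi>"
      by (subst distr_distr[OF \<Phi>m C(1)]) (simp add: o_def)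
    also have "\<dots> = distr (distr N\<^sub>0 ?Q (\<lambda>\<omega>. fcoef (trans_op (- 0) (H\<^sub>0 \<omega>)))) ?K \<Phi>"
      unfolding C(2) C0(2) ..
    also have "\<dots> = distr N\<^sub>0 ?K (\<lambda>\<omega>. \<Phi> (fcoef (trans_op (- 0) (H\<^sub>0 \<omega>))))"
      by (subst distr_distr[OF \<Phi>m C0(1)]) (simp add: o_def)
    finally show "distr N ?K (\<lambda>\<omega>. \<Phi> (fcoef (trans_op (- a) (H \<omega>)))) = distr N\<^sub>0 ?K (\<lambda>\<omega>. \<Phi> (fcoef (trans_op (- 0) (H\<^sub>0 \<omega>))))" .
  qed (auto simp: space_PiM space_option_borel)
qed

end
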